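(* There is a hybrid dynamic programming algorithm (\textsc{algorithm TwoLevel}) on the uniform-cost RAM which, given any instance of the optimum-BST problem on the two-level memory model HMM$_2$ with $n$ keys and memory levels of sizes $m_1$ and $m_2$, $m_1+m_2=n$, constructs an optimum solution $\langle T^*,\phi^*\rangle$ in time $$O\bigl(n(n-m)+m\,n^2(n-m)^2\bigr)=O\bigl(m\,n^2(n-m)^2\bigr),\qquad m=\min\{m_1,m_2\}.$$
   Context: Binary search trees. Given $n\ge 1$ keys $x_1\prec x_2\prec\cdots\prec x_n$ from a totally ordered universe, a binary search tree (BST) $T$ over the keys is an ordered rooted binary tree with $n$ internal nodes, identified with the keys so that an inorder traversal visits $x_1,\dots,x_n$ in order, and $n+1$ external nodes (leaves) $z_0,\dots,z_n$ from left to right, where $z_j$ represents the search arguments $y$ with $x_j\prec y\prec x_{j+1}$ (with the convention that $z_0$ means $y\prec x_1$ and $z_n$ means $y\succ x_n$). Also given are $p_i\ge 0$ ($1\le i\le n$), the probability that $y=x_i$, and $q_j\ge 0$ ($0\le j\le n$), the probability that $y$ falls in the interval of $z_j$; $\sum_i p_i+\sum_j q_j=1$. For a node $v$ of $T$, let $T_v$ be the subtree rooted at $v$ and let $w(T_v)$ be the sum of all $p_i$ and $q_j$ over the internal nodes $x_i$ and external nodes $z_j$ in $T_v$; in particular $w(T_{z_j})=q_j$. Two-level memory (HMM$_2$). There are $n=m_1+m_2$ memory locations with addresses $1,\dots,n$. A single access to address $a$ costs $\mu(a)=c_1$ for $1\le a\le m_1$ and $\mu(a)=c_2$ for $m_1<a\le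 n$, where $c_1<c_2$ are natural numbers. The problem. A solution is a pair $\langle T,\phi\rangle$ of a BST $T$ over the keys and a one-to-one memory assignment $\phi$ of the internal nodes of $T$ to the addresses $\{1,\dots,n\}$. External nodes are not stored; for an external node $z_j$, $\phi(z_j)$ denotes the address at which the parent of $z_j$ is stored. The cost of a solution (called the expected cost of a search) is $$\mathrm{cost}(\langle T,\phi\rangle)=\sum_{i=1}^n w(T_{x_i})\,\mu(\phi(x_i))+\sum_{j=0}^n w(T_{z_j})\,\mu(\phi(z_j)).$$ A solution is optimum if its cost is minimum over all pairs $\langle T,\phi\rangle$. The algorithm is given the $p_i$, $q_j$, $m_1,m_2$ and $c_1,c_2$. Uniform-cost RAM: each memory access, arithmetic operation and comparison on numbers takes unit time. *)

theory Defs
  imports Complex_Main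
begin

section \<open>Binary search trees with external nodes\<close>

text \<open>
  The key \<open>x\<^sub>i\<close> is represented by its index \<open>i\<close>, and the external node \<open>z\<^sub>j\<close> by \<open>Ext j\<close>.
  (The library type of binary trees has unlabelled leaves, so the leaves carry labels here.)
\<close>

datatype etree = Ext nat | Key etree nat etree

fun internals :: "etree \<Rightarrow> nat list" where
  "internals (Ext j) = []"
| "internals (Key l i r) = internals l @ i # internals r"

fun externals :: "etree \<Rightarrow> nat list" where
  "externals (Ext j) = [j]"
| "externals (Key l i r) = externals l @ externals r"

fun subtrees :: "etree \<Rightarrow> etree set" where
  "subtrees (Ext j) = {Ext j}"
| "subtrees (Key l i r) = insert (Key l i r) (subtrees l \<union> subtrees r)"

definition is_BST :: "nat \<Rightarrow> etree \<Rightarrow> bool" where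
  "is_BST n T \<longleftrightarrow> internals T = [1..<n+1] \<and> externals T = [0..<n+1]"

definition weight :: "(nat \<Rightarrow> real) \<Rightarrow> (nat \<Rightarrow> real) \<Rightarrow> etree \<Rightarrow> real" where
  "weight p q S = (\<Sum>i\<leftarrow>internals S. p i) + (\<Sum>j\<leftarrow>externals S. q j)"

definition subtree_at :: "etree \<Rightarrow> nat \<Rightarrow> etree" where
  "subtree_at T i = (THE S. S \<in> subtrees T \<and> (\<exists>l r. S = Key l i r))"

definition ext_parent :: "etree \<Rightarrow> nat \<Rightarrow> nat" where
  "ext_parent T j = (THE i. \<exists>l r. Key l i r \<in> subtrees T \<and> (l = Ext j \<or> r = Ext j))"

section \<open>The optimum-BST problem on the two-level memory model\<close>

definition valid_instance ::
  "nat \<Rightarrow> nat \<Rightarrow> nat \<Rightarrow> nat \<Rightarrow> (nat \<Rightarrow> real) \<Rightarrow> (nat \<Rightarrow> real) \<Rightarrow> bool" where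
  "valid_instance m1 m2 c1 c2 p q \<longleftrightarrow>
     (let n = m1 + m2 in
       1 \<le> n \<and> c1 < c2 \<and>
       (\<forall>i\<in>{1..n}. 0 \<le> p i) \<and> (\<forall>j\<in>{0..n}. 0 \<le> q j) \<and>
       (\<Sum>i=1..n. p i) + (\<Sum>j=0..n. q j) = 1)"

text \<open>Intended for an address \<open>a\<close> with \<open>1 \<le> a \<le> m1 + m2\<close>.\<close>

definition access_cost :: "nat \<Rightarrow> nat \<Rightarrow> nat \<Rightarrow> nat \<Rightarrow> nat" where
  "access_cost m1 c1 c2 a = (if a \<le> m1 then c1 else c2)"

definition is_solution :: "nat \<Rightarrow> etree \<Rightarrow> (nat \<Rightarrow> nat) \<Rightarrow> bool" where
  "is_solution n T \<phi> \<longleftrightarrow> is_BST n T \<and> bij_betw \<phi> {1..n} {1..n}"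

definition cost ::
  "nat \<Rightarrow> nat \<Rightarrow> nat \<Rightarrow> nat \<Rightarrow> (nat \<Rightarrow> real) \<Rightarrow> (nat \<Rightarrow> real) \<Rightarrow> etree \<Rightarrow> (nat \<Rightarrow> nat) \<Rightarrow> real" where
  "cost m1 m2 c1 c2 p q T \<phi> =
     (let n = m1 + m2; \<mu> = (\<lambda>a. real (access_cost m1 c1 c2 a)) in
       (\<Sum>i=1..n. weight p q (subtree_at T i) * \<mu> (\<phi> i)) +
       (\<Sum>j=0..n. weight p q (Ext j) * \<mu> (\<phi> (ext_parent T j))))"

definition optimum_solution ::
  "nat \<Rightarrow> nat \<Rightarrow> nat \<Rightarrow> nat \<Rightarrow> (nat \<Rightarrow> real) \<Rightarrow> (nat \<Rightarrow> real) \<Rightarrow> etree \<Rightarrow> (nat \<Rightarrow> nat) \<Rightarrow> bool" where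
  "optimum_solution m1 m2 c1 c2 p q T \<phi> \<longleftrightarrow>
     is_solution (m1 + m2) T \<phi> \<and>
     (\<forall>T' \<phi>'. is_solution (m1 + m2) T' \<phi>' \<longrightarrow>
        cost m1 m2 c1 c2 p q T \<phi> \<le> cost m1 m2 c1 c2 p q T' \<phi>')"

section \<open>Uniform-cost random access machine\<close>

text \<open>
  Register machine with a random access memory. Registers and memory cells hold real
  numbers, since the probabilities of an instance are arbitrary reals. There is no rounding
  instruction: a number can be used as an address only if it is a natural number.
  A program mentions finitely many registers. Every executed instruction takes one time unit.
\<close>

datatype arith_op = Add | Sub | Mul | Div

datatype instr =
    Const nat int
  | Move nat nat
  | Arith arith_op nat nat nat
  | Load nat nat
  | Store nat nat
  | Jump nat
  | JumpLe nat nat nat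

type_synonym program = "instr list"

text \<open>Program counter, registers, memory.\<close>

type_synonym config = "nat \<times> (nat \<Rightarrow> real) \<times> (nat \<Rightarrow> real)"

fun apply_op :: "arith_op \<Rightarrow> real \<Rightarrow> real \<Rightarrow> real option" where
  "apply_op Add x y = Some (x + y)"
| "apply_op Sub x y = Some (x - y)"
| "apply_op Mul x y = Some (x * y)"
| "apply_op Div x y = (if y = 0 then None else Some (x / y))"

definition address :: "real \<Rightarrow> nat option" where
  "address x = (if x \<in> \<nat> then Some (nat \<lfloor>x\<rfloor>) else None)"

fun exec_instr :: "instr \<Rightarrow> config \<Rightarrow> config option" where
  "exec_instr (Const d c) (pc, R, M) = Some (pc + 1, R(d := of_int c), M)"
| "exec_instr (Move d a) (pc, R, M) = Some (pc + 1, R(d := R a), M)"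
| "exec_instr (Arith f d a b) (pc, R, M) =
     map_option (\<lambda>x. (pc + 1, R(d := x), M)) (apply_op f (R a) (R b))"
| "exec_instr (Load d a) (pc, R, M) =
     map_option (\<lambda>k. (pc + 1, R(d := M k), M)) (address (R a))"
| "exec_instr (Store a s) (pc, R, M) =
     map_option (\<lambda>k. (pc + 1, R, M(k := R s))) (address (R a))"
| "exec_instr (Jump l) (pc, R, M) = Some (l, R, M)"
| "exec_instr (JumpLe a b l) (pc, R, M) = Some (if R a \<le> R b then l else pc + 1, R, M)"

definition step :: "program \<Rightarrow> config \<Rightarrow> config \<Rightarrow> bool" where
  "step P c c' \<longleftrightarrow> fst c < length P \<and> exec_instr (P ! fst c) c = Some c'"

text \<open>
  Started with memory \<open>M0\<close> and all registers zero, \<open>P\<close> runs off its end after exactly \<open>t\<close> steps,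
  with registers \<open>R\<close> and memory \<open>M\<close>. A faulting instruction (division by zero, or an address
  that is not a natural number) blocks the machine and does not count as halting.
\<close>

definition halts_in ::
  "program \<Rightarrow> (nat \<Rightarrow> real) \<Rightarrow> nat \<Rightarrow> (nat \<Rightarrow> real) \<Rightarrow> (nat \<Rightarrow> real) \<Rightarrow> bool" where
  "halts_in P M0 t R M \<longleftrightarrow>
     (\<exists>pc. (step P ^^ t) (0, \<lambda>_. 0, M0) (pc, R, M) \<and> length P \<le> pc)"

section \<open>Input and output conventions\<close>

definition input_memory ::
  "nat \<Rightarrow> nat \<Rightarrow> nat \<Rightarrow> nat \<Rightarrow> (nat \<Rightarrow> real) \<Rightarrow> (nat \<Rightarrow> real) \<Rightarrow> nat \<Rightarrow> real" where
  "input_memory m1 m2 c1 c2 p q =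
     (let n = m1 + m2;
          xs = [real m1, real m2, real c1, real c2] @ map p [1..<n+1] @ map q [0..<n+1]
      in (\<lambda>a. if a < length xs then xs ! a else 0))"

text \<open>External nodes are not stored; \<open>0\<close> plays the role of a null pointer.\<close>

fun node_ptr :: "etree \<Rightarrow> nat" where
  "node_ptr (Ext j) = 0"
| "node_ptr (Key l i r) = i"

text \<open>
  The solution is stored from address \<open>B\<close> on: first the root, then for each key
  \<open>i = 1, 2, \<dots>\<close> its left child, its right child and its assigned address \<open>\<phi> i\<close>.
\<close>

definition stores_solution :: "(nat \<Rightarrow> real) \<Rightarrow> nat \<Rightarrow> etree \<Rightarrow> (nat \<Rightarrow> nat) \<Rightarrow> bool" where
  "stores_solution M B T \<phi> \<longleftrightarrow>
     M B = real (node_ptr T) \<and>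
     (\<forall>l i r. Key l i r \<in> subtrees T \<longrightarrow>
        M (B + 3 * i - 2) = real (node_ptr l) \<and>
        M (B + 3 * i - 1) = real (node_ptr r) \<and>
        M (B + 3 * i) = real (\<phi> i))"

definition constructs_in ::
  "program \<Rightarrow> (nat \<Rightarrow> real) \<Rightarrow> nat \<Rightarrow> etree \<Rightarrow> (nat \<Rightarrow> nat) \<Rightarrow> bool" where
  "constructs_in P M0 t T \<phi> \<longleftrightarrow>
     (\<exists>R M B. halts_in P M0 t R M \<and> R 0 = real B \<and> stores_solution M B T \<phi>)"

end

(*
  Let F(i, j, k) be the least cost of a subtree on the keys i+1..j with exactly k nodes in the smaller
  of the two levels, where a node also pays for the external nodes that are its children. Trying every root, every
  level of the root and every distribution of the remaining k nodes gives O(n^3 m^2) steps for m >= 1,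
  within O(m n^4) because m <= n. For m = 0 only k = 0 occurs, and Knuth's restriction of the roots
  of (i, j) to the range from the root of (i, j-1) to the root of (i+1, j) makes the work telescope
  to O(n^2). Each key's subtree is recovered by a search from the root, in O(n^2) steps altogether.
*)
theory Submission
  imports Defs
begin

text \<open>Three points shape the proof. (1) Knuth's restriction of the roots is sound only under
  consistent tie-breaking, so every table entry must hold an optimal choice whose root is least; the
  specification \<open>first_best\<close> and the order of the loops serve this. (2) The cost
  charges an external node to its parent, whereas the quadrangle inequality wants an empty interval
  to carry its own price. The two agree when only one price occurs, which is why Knuth's method is
  confined to m = 0; there the second summand of the bound vanishes and n(n-m) = n^2 forces a
  quadratic method. For m >= 1 the full search is affordable because m is at most n/2, hence n <=
  2(n-m). (3) The number k of level-1 nodes is exact, so a bijective assignment can be recovered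
  from the levels alone, and it makes no difference to the recurrence whether the smaller level is
  the fast or the slow one. The tree is built by a recursive function only in the logic; the program
  keeps no stack and walks down the table afresh for each key. Memory beyond the input is zero,
  which already encodes the empty intervals: value 0 and null pointer 0.\<close>

section \<open>A structured language compiled to the machine\<close>

type_synonym state = "(nat \<Rightarrow> real) \<times> (nat \<Rightarrow> real)"

datatype com =
    Block "instr list"
  | Seq com com  (infixr ";;" 60)
  | IfLe nat nat com com
  | WhileLe nat nat com

text \<open>The postcondition is carried as a continuation, so that the simplifier can run a
  straight-line block symbolically. Faults and jumps make the predicate false; proving it therefore
  includes the absence of faults.\<close>

fun exec_block :: "instr list \<Rightarrow> state \<Rightarrow> (state \<Rightarrow> bool) \<Rightarrow> bool" where
  "exec_block [] s Q = Q s"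
| "exec_block (Const d c # is) (R, M) Q = exec_block is (R(d := of_int c), M) Q"
| "exec_block (Move d a # is) (R, M) Q = exec_block is (R(d := R a), M) Q"
| "exec_block (Arith f d a b # is) (R, M) Q =
     (\<exists>x. apply_op f (R a) (R b) = Some x \<and> exec_block is (R(d := x), M) Q)"
| "exec_block (Load d a # is) (R, M) Q =
     (\<exists>k. R a = real k \<and> exec_block is (R(d := M k), M) Q)"
| "exec_block (Store a b # is) (R, M) Q =
     (\<exists>k. R a = real k \<and> exec_block is (R, M(k := R b)) Q)"
| "exec_block (Jump l # is) s Q = False"
| "exec_block (JumpLe a b l # is) s Q = False"

text \<open>The step counts are those of the compiled code. A then branch pays for the taken test
  only, an else branch also for the jump over the then code; a loop round pays for the test and the
  jump back, the exit for the test and the jump out.\<close>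

inductive run :: "com \<Rightarrow> state \<Rightarrow> nat \<Rightarrow> state \<Rightarrow> bool" where
  "exec_block is s (\<lambda>s''. s'' = s') \<Longrightarrow> run (Block is) s (length is) s'"
| "run c s t s' \<Longrightarrow> run d s' t' s'' \<Longrightarrow> run (c ;; d) s (t + t') s''"
| "fst s a \<le> fst s b \<Longrightarrow> run c s t s' \<Longrightarrow> run (IfLe a b c d) s (t + 1) s'"
| "\<not> fst s a \<le> fst s b \<Longrightarrow> run d s t s' \<Longrightarrow> run (IfLe a b c d) s (t + 2) s'"
| "\<not> fst s a \<le> fst s b \<Longrightarrow> run (WhileLe a b c) s 2 s"
| "fst s a \<le> fst s b \<Longrightarrow> run c s t s' \<Longrightarrow> run (WhileLe a b c) s' t' s'' \<Longrightarrow>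
     run (WhileLe a b c) s (t + 2 + t') s''"

fun code_length :: "com \<Rightarrow> nat" where
  "code_length (Block is) = length is"
| "code_length (c ;; d) = code_length c + code_length d"
| "code_length (IfLe a b c d) = code_length c + code_length d + 2"
| "code_length (WhileLe a b c) = code_length c + 3"

text \<open>Jump targets of the machine are absolute, hence the parameter \<open>k\<close>, the
  position of the first instruction. The else branch is laid out first so that the then branch falls
  through to the end.\<close>

fun compile :: "nat \<Rightarrow> com \<Rightarrow> instr list" where
  "compile k (Block is) = is"
| "compile k (c ;; d) = compile k c @ compile (k + code_length c) d"
| "compile k (IfLe a b c d) =
     JumpLe a b (k + code_length d + 2) # compile (k + 1) d @
     Jump (k + code_length d + 2 + code_length c) # compile (k + code_length d + 2) c"
| "compile k (WhileLe a b c) =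
     JumpLe a b (k + 2) # Jump (k + code_length c + 3) # compile (k + 2) c @ [Jump k]"

lemma length_compile [simp]: "length (compile k c) = code_length c"
  by (induction c arbitrary: k) auto

fun code_at :: "program \<Rightarrow> nat \<Rightarrow> instr list \<Rightarrow> bool" where
  "code_at P k [] = True"
| "code_at P k (x # xs) = (k < length P \<and> P ! k = x \<and> code_at P (k + 1) xs)"

lemma code_at_append [simp]:
  "code_at P k (xs @ ys) \<longleftrightarrow> code_at P k xs \<and> code_at P (k + length xs) ys"
  by (induction xs arbitrary: k) auto

lemma code_at_self: "code_at (xs @ ys) (length xs) ys"
proof (induction ys arbitrary: xs)
  case (Cons y ys)
  from Cons[of "xs @ [y]"] show ?case by simp
qed simp

lemma relpowp_add_stepI:
  "(r ^^ a) x y \<Longrightarrow> (r ^^ b) y z \<Longrightarrow> (r ^^ (a + b)) x z"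
  by (auto simp: relpowp_add)

lemma address_real [simp]: "address (real k) = Some k"
  by (simp add: address_def)

lemma steps_block:
  assumes "exec_block is (R, M) (\<lambda>s''. s'' = s')" "code_at P k is"
  shows "(step P ^^ length is) (k, R, M) (k + length is, s')"
  using assms
proof (induction "is" arbitrary: R M k)
  case (Cons i "is")
  have "\<exists>R' M'. step P (k, R, M) (k + 1, R', M') \<and> exec_block is (R', M') (\<lambda>s''. s'' = s')"
    using Cons.prems by (cases i) (fastforce simp: step_def)+
  then obtain R' M' where 1: "step P (k, R, M) (k + 1, R', M')"
    and "exec_block is (R', M') (\<lambda>s''. s'' = s')" by blast
  with Cons.IH[of R' M' "k + 1"] Cons.prems(2)
  have "(step P ^^ length is) (k + 1, R', M') (k + 1 + length is, s')" by simp
  from relpowp_Suc_I2[OF 1 this] show ?case by simp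
qed auto

lemma run_steps:
  assumes "run c s t s'" "code_at P k (compile k c)"
  shows "(step P ^^ t) (k, s) (k + code_length c, s')"
  using assms
proof (induction arbitrary: k rule: run.induct)
  case (1 "is" s s')
  then show ?case using steps_block by (cases s) auto
next
  case (2 c s t s' d t' s'')
  from 2(3)[of k] 2(4)[of "k + code_length c"] 2(5) show ?case
    by (auto intro: relpowp_add_stepI simp: add.assoc)
next
  case (3 s a b c t s' d)
  have "(step P ^^ 1) (k, s) (k + code_length d + 2, s)"
    using 3(1,4) by (cases s) (auto simp: step_def)
  moreover have "(step P ^^ t) (k + code_length d + 2, s) (k + code_length d + 2 + code_length c, s')"
    using 3(3)[of "k + code_length d + 2"] 3(4) by simp
  ultimately show ?case using relpowp_add_stepI by (fastforce simp: add_ac)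
next
  case (4 s a b d t s' c)
  have "(step P ^^ 1) (k, s) (k + 1, s)"
    using 4(1,4) by (cases s) (auto simp: step_def)
  moreover have "(step P ^^ t) (k + 1, s) (k + 1 + code_length d, s')"
    using 4(3)[of "k + 1"] 4(4) by simp
  moreover have "(step P ^^ 1) (k + 1 + code_length d, s') (k + code_length (IfLe a b c d), s')"
    using 4(4) by (cases s') (auto simp: step_def)
  ultimately have "(step P ^^ (1 + t + 1)) (k, s) (k + code_length (IfLe a b c d), s')"
    using relpowp_add_stepI by metis
  then show ?case by simp
next
  case (5 s a b c)
  have "step P (k, s) (k + 1, s)" "step P (k + 1, s) (k + code_length (WhileLe a b c), s)"
    using 5 by (cases s; auto simp: step_def)+
  then show ?case by (auto simp: numeral_2_eq_2)
next
  case (6 s a b c t s' t' s'')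
  have "(step P ^^ 1) (k, s) (k + 2, s)"
    using 6(1,6) by (cases s) (auto simp: step_def)
  moreover have "(step P ^^ t) (k + 2, s) (k + 2 + code_length c, s')"
    using 6(4)[of "k + 2"] 6(6) by simp
  moreover have "(step P ^^ 1) (k + 2 + code_length c, s') (k, s')"
    using 6(6) by (cases s') (auto simp: step_def)
  moreover have "(step P ^^ t') (k, s') (k + code_length (WhileLe a b c), s'')"
    using 6(5)[of k] 6(6) by simp
  ultimately have "(step P ^^ (1 + t + 1 + t')) (k, s) (k + code_length (WhileLe a b c), s'')"
    using relpowp_add_stepI by metis
  then show ?case by (simp add: add_ac)
qed

section \<open>Total correctness with upper bounds on the running time\<close>

definition ok :: "com \<Rightarrow> state \<Rightarrow> nat \<Rightarrow> (state \<Rightarrow> bool) \<Rightarrow> bool" where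
  "ok c s t Q \<longleftrightarrow> (\<exists>t' s'. run c s t' s' \<and> t' \<le> t \<and> Q s')"

lemma ok_halts:
  assumes "ok c (\<lambda>_. 0, M0) t Q"
  shows "\<exists>t' R M. halts_in (compile 0 c) M0 t' R M \<and> t' \<le> t \<and> Q (R, M)"
proof -
  obtain t' R M where *: "run c (\<lambda>_. 0, M0) t' (R, M)" "t' \<le> t" "Q (R, M)"
    using assms by (auto simp: ok_def)
  have "code_at (compile 0 c) 0 (compile 0 c)" using code_at_self[of "[]"] by simp
  from run_steps[OF *(1) this] * show ?thesis
    unfolding halts_in_def by fastforce
qed

text \<open>Blocks are deterministic, so any postcondition can be narrowed to equality with one
  final state, the form in which \<open>run\<close> uses blocks.\<close>

lemma exec_block_witness:
  "exec_block is s Q \<Longrightarrow> \<exists>s'. exec_block is s (\<lambda>s''. s'' = s') \<and> Q s'"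
  by (induction "is" s Q rule: exec_block.induct) auto

lemma ok_Block: "exec_block is s Q \<Longrightarrow> length is \<le> t \<Longrightarrow> ok (Block is) s t Q"
  unfolding ok_def using exec_block_witness run.intros(1) by blast

lemma ok_mono: "ok c s t P \<Longrightarrow> t \<le> t' \<Longrightarrow> (\<And>s'. P s' \<Longrightarrow> Q s') \<Longrightarrow> ok c s t' Q"
  unfolding ok_def by fastforce

lemma ok_Seq:
  assumes "ok c s ta P" "\<And>R M. P (R, M) \<Longrightarrow> ok d (R, M) tb Q" "ta + tb \<le> t"
  shows "ok (c ;; d) s t Q"
proof -
  obtain t' R M where 1: "run c s t' (R, M)" "t' \<le> ta" "P (R, M)" using assms(1) by (auto simp: ok_def)
  obtain t'' s'' where 2: "run d (R, M) t'' s''" "t'' \<le> tb" "Q s''"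
    using assms(2)[OF 1(3)] by (auto simp: ok_def)
  from run.intros(2)[OF 1(1) 2(1)] 1 2 assms(3) show ?thesis unfolding ok_def by fastforce
qed

lemma ok_IfLe:
  assumes "R a \<le> R b \<Longrightarrow> ok c (R, M) ta Q" "\<not> R a \<le> R b \<Longrightarrow> ok d (R, M) ta Q" "ta + 2 \<le> t"
  shows "ok (IfLe a b c d) (R, M) t Q"
proof (cases "R a \<le> R b")
  case True
  then obtain t' s' where 1: "run c (R, M) t' s'" "t' \<le> ta" "Q s'" using assms(1) by (auto simp: ok_def)
  from run.intros(3)[OF _ 1(1), of a b] True 1 assms(3) show ?thesis unfolding ok_def by fastforce
next
  case False
  then obtain t' s' where 1: "run d (R, M) t' s'" "t' \<le> ta" "Q s'" using assms(2) by (auto simp: ok_def)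
  from run.intros(4)[OF _ 1(1), of a b] False 1 assms(3) show ?thesis unfolding ok_def by fastforce
qed

text \<open>For counting loops: \<open>v\<close> is the number of completed rounds. The time of a
  round may depend on \<open>v\<close>, which is needed for bounds that hold only after summation,
  as with Knuth's telescoping ranges.\<close>

lemma ok_WhileLe:
  assumes step: "\<And>v R M. I v (R, M) \<Longrightarrow> v < N \<Longrightarrow> R a \<le> R b \<and> ok c (R, M) (T v) (I (Suc v))"
    and final: "\<And>R M. I N (R, M) \<Longrightarrow> \<not> R a \<le> R b \<and> Q (R, M)"
    and init: "I 0 s" and time: "(\<Sum>v<N. T v + 2) + 2 \<le> t"
  shows "ok (WhileLe a b c) s t Q"
proof -
  have "ok (WhileLe a b c) s' ((\<Sum>v=v0..<N. T v + 2) + 2) Q" if "I v0 s'" "v0 \<le> N" for v0 s'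
    using that
  proof (induction "N - v0" arbitrary: v0 s')
    case 0
    then have "I N s'" by simp
    with 0 final[of "fst s'" "snd s'"] run.intros(5)[of s' a b c] show ?case
      unfolding ok_def by (intro exI[of _ 2] exI[of _ s']) auto
  next
    case (Suc x)
    then have v: "v0 < N" by simp
    obtain t' s'' where 1: "run c s' t' s''" "t' \<le> T v0" "I (Suc v0) s''" "fst s' a \<le> fst s' b"
      using step[of v0 "fst s'" "snd s'"] Suc.prems v by (auto simp: ok_def)
    have "ok (WhileLe a b c) s'' ((\<Sum>v=Suc v0..<N. T v + 2) + 2) Q"
      using Suc.hyps(1)[of "Suc v0" s''] Suc.hyps(2) 1 v by simp
    then obtain t'' s3 where 2: "run (WhileLe a b c) s'' t'' s3"
      "t'' \<le> (\<Sum>v=Suc v0..<N. T v + 2) + 2" "Q s3" by (auto simp: ok_def)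
    have "(\<Sum>v=v0..<N. T v + 2) = T v0 + 2 + (\<Sum>v=Suc v0..<N. T v + 2)"
      using v by (simp add: sum.atLeast_Suc_lessThan)
    then have "t' + 2 + t'' \<le> (\<Sum>v=v0..<N. T v + 2) + 2" using 1 2 by simp
    with run.intros(6)[OF 1(4,1) 2(1)] 2 show ?case unfolding ok_def by blast
  qed
  from this[of 0 s] init have "ok (WhileLe a b c) s ((\<Sum>v<N. T v + 2) + 2) Q"
    by (simp add: atLeast0LessThan)
  then show ?thesis using time ok_mono by blast
qed

text \<open>For loops whose number of rounds is not known in advance; it is used for the search in a
  tree, where \<open>v\<close> bounds the remaining rounds.\<close>

lemma ok_WhileLe_measure:
  assumes step: "\<And>v R M. I v (R, M) \<Longrightarrow> R a \<le> R b \<Longrightarrow> ok c (R, M) T (\<lambda>s'. \<exists>v'<v. I v' s')"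
    and final: "\<And>v R M. I v (R, M) \<Longrightarrow> \<not> R a \<le> R b \<Longrightarrow> Q (R, M)"
    and init: "I v s" and time: "v * (T + 2) + 2 \<le> t"
  shows "ok (WhileLe a b c) s t Q"
proof -
  have "ok (WhileLe a b c) s (v * (T + 2) + 2) Q" using init
  proof (induction v arbitrary: s rule: less_induct)
    case (less v)
    show ?case
    proof (cases "fst s a \<le> fst s b")
      case False
      with less.prems final[of v "fst s" "snd s"] run.intros(5)[of s a b c] show ?thesis
        unfolding ok_def by (intro exI[of _ 2] exI[of _ s]) auto
    next
      case True
      then obtain t' s' v' where 1: "run c s t' s'" "t' \<le> T" "v' < v" "I v' s'"
        using step[of v "fst s" "snd s"] less.prems by (auto simp: ok_def)
      obtain t'' s'' where 2: "run (WhileLe a b c) s' t'' s''" "t'' \<le> v' * (T + 2) + 2" "Q s''"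
        using less.IH[OF 1(3,4)] by (auto simp: ok_def)
      have "Suc v' * (T + 2) \<le> v * (T + 2)" using 1 by (intro mult_right_mono) auto
      then have "t' + 2 + t'' \<le> v * (T + 2) + 2" using 1 2 by simp
      with run.intros(6)[OF True 1(1) 2(1)] 2 show ?thesis unfolding ok_def by blast
    qed
  qed
  then show ?thesis using time ok_mono by blast
qed

section \<open>The recurrence for two memory levels\<close>

locale recurrence =
  fixes p q :: "nat \<Rightarrow> real" and \<mu> :: "nat \<Rightarrow> real"
begin

definition W :: "nat \<Rightarrow> nat \<Rightarrow> real" where
  "W i j = (\<Sum>t=i+1..j. p t) + (\<Sum>t=i..j. q t)"

text \<open>The external node at \<open>i\<close> is a child of the root \<open>r\<close> exactly if
  the left interval is empty, that is \<open>r = i + 1\<close>; symmetrically on the right for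
  \<open>r = j\<close>. Its weight then counts a second time, since it is also part of
  \<open>W i j\<close>.\<close>

definition node_weight :: "nat \<Rightarrow> nat \<Rightarrow> nat \<Rightarrow> real" where
  "node_weight i j r = W i j + (if r = i + 1 then q i else 0) + (if r = j then q j else 0)"

text \<open>
  A choice \<open>(r, l, c)\<close> for the keys \<open>i + 1, \<dots>, j\<close>, of which \<open>k\<close> are to be stored in level \<open>1\<close>
  (the smaller of the two memory levels; level \<open>0\<close> is the other one):
  root \<open>r\<close>, level \<open>l\<close> of the root, number \<open>c\<close> of level-\<open>1\<close> nodes in its left subtree.
\<close>

definition choices :: "nat \<Rightarrow> nat \<Rightarrow> nat \<Rightarrow> (nat \<times> nat \<times> nat) set" where
  "choices i j k = {(r, l, c). i < r \<and> r \<le> j \<and> l \<le> 1 \<and> l + c \<le> k \<and>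
     c + i + 1 \<le> r \<and> k + r \<le> j + l + c}"

lemma finite_choices: "finite (choices i j k)"
  by (rule finite_subset[of _ "{..j} \<times> {..1} \<times> {..k}"]) (auto simp: choices_def)

text \<open>Projections instead of a tuple pattern let the membership in
  \<open>choices i j k\<close> reach the termination proof. If \<open>i < j\<close> and
  \<open>k > j - i\<close> there is no choice, and the minimum of the empty set is unspecified; such
  values are never relied on.\<close>

function opt :: "nat \<Rightarrow> nat \<Rightarrow> nat \<Rightarrow> real" where
  "opt i j k = (if i < j then
     Min ((\<lambda>x. \<mu> (fst (snd x)) * node_weight i j (fst x) + opt i (fst x - 1) (snd (snd x))
        + opt (fst x) j (k - fst (snd x) - snd (snd x))) ` choices i j k)
   else 0)"
  by auto
termination
  by (relation "measure (\<lambda>(i, j, k). j - i)") (auto simp: choices_def)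

declare opt.simps [simp del]

definition val :: "nat \<Rightarrow> nat \<Rightarrow> nat \<Rightarrow> nat \<times> nat \<times> nat \<Rightarrow> real" where
  "val i j k = (\<lambda>(r, l, c). \<mu> l * node_weight i j r + opt i (r - 1) c + opt r j (k - l - c))"

lemma opt_diag [simp]: "opt i i k = 0"
  by (simp add: opt.simps)

lemma opt_eq_Min: "i < j \<Longrightarrow> opt i j k = Min (val i j k ` choices i j k)"
  by (subst opt.simps) (simp add: val_def case_prod_beta)

lemma opt_le: "x \<in> choices i j k \<Longrightarrow> opt i j k \<le> val i j k x"
  using opt_eq_Min[of i j k] finite_choices[of i j k]
  by (auto simp: choices_def intro!: Min_le)

lemma choices_nonempty:
  assumes "i < j" "k \<le> j - i" shows "choices i j k \<noteq> {}"
proof -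
  \<comment> \<open>The last key as root, itself in level 1 if \<open>k\<close> is positive, with
    the remaining \<open>k - 1\<close> in the left subtree; truncated subtraction makes this 0 for
    \<open>k = 0\<close>.\<close>
  have "(j, if k = 0 then 0 else 1, k - 1) \<in> choices i j k"
    using assms by (auto simp: choices_def)
  then show ?thesis by blast
qed

lemma opt_attained:
  assumes "i < j" "k \<le> j - i" shows "\<exists>x\<in>choices i j k. val i j k x = opt i j k"
proof -
  have "Min (val i j k ` choices i j k) \<in> val i j k ` choices i j k"
    using choices_nonempty[OF assms] finite_choices by (intro Min_in) auto
  then show ?thesis unfolding opt_eq_Min[OF assms(1)] by auto
qed

text \<open>Ties are broken by the root alone, as this is all that the monotonicity of roots needs;
  among choices with the same root any best one will do.\<close>

definition first_best :: "nat \<Rightarrow> nat \<Rightarrow> nat \<Rightarrow> (nat \<times> nat \<times> nat) set \<Rightarrow> nat \<times> nat \<times> nat \<Rightarrow> bool" where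
  "first_best i j k X x \<longleftrightarrow> x \<in> X \<and>
     (\<forall>y\<in>X. val i j k x \<le> val i j k y \<and> (val i j k x = val i j k y \<longrightarrow> fst x \<le> fst y))"

text \<open>Candidates arrive with nondecreasing roots, so on a tie the old one has the smaller or
  an equal root and may stay. Accordingly the program replaces its candidate only on strict
  improvement.\<close>

lemma first_best_insert_keep:
  assumes "first_best i j k X x" "val i j k x \<le> val i j k y" "\<forall>z\<in>X. fst z \<le> fst y"
  shows "first_best i j k (insert y X) x"
  using assms by (auto simp: first_best_def)

lemma first_best_insert_new:
  assumes "first_best i j k X x" "val i j k y < val i j k x"
  shows "first_best i j k (insert y X) y"
  using assms by (force simp: first_best_def)

lemma val_first_best:
  assumes "first_best i j k (choices i j k) x"
  shows "val i j k x = opt i j k"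
proof -
  have "x \<in> choices i j k" using assms by (simp add: first_best_def)
  then have ij: "i < j" "k \<le> j - i" by (auto simp: choices_def)
  from opt_attained[OF this] obtain y where "y \<in> choices i j k" "val i j k y = opt i j k" by blast
  with assms \<open>x \<in> _\<close> opt_le[of x i j k] show ?thesis by (auto simp: first_best_def intro: antisym)
qed

subsection \<open>One memory level\<close>

definition first_root :: "nat \<Rightarrow> nat \<Rightarrow> nat" where
  "first_root i j = (LEAST r. (r, 0, 0) \<in> choices i j 0 \<and> val i j 0 (r, 0, 0) = opt i j 0)"

lemma choices_0: "choices i j 0 = (\<lambda>r. (r, 0, 0)) ` {i<..j}"
  by (auto simp: choices_def)

lemma first_root:
  assumes "i < j"
  shows "i < first_root i j" "first_root i j \<le> j" "val i j 0 (first_root i j, 0, 0) = opt i j 0"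
    and first_root_least: "\<And>r. i < r \<Longrightarrow> r \<le> j \<Longrightarrow> val i j 0 (r, 0, 0) = opt i j 0 \<Longrightarrow> first_root i j \<le> r"
proof -
  have "\<exists>r. (r, 0, 0) \<in> choices i j 0 \<and> val i j 0 (r, 0, 0) = opt i j 0"
    using opt_attained[OF assms, of 0] by (auto simp: choices_0)
  from LeastI_ex[OF this] show "i < first_root i j" "first_root i j \<le> j"
    "val i j 0 (first_root i j, 0, 0) = opt i j 0"
    by (auto simp: first_root_def choices_0)
  show "\<And>r. i < r \<Longrightarrow> r \<le> j \<Longrightarrow> val i j 0 (r, 0, 0) = opt i j 0 \<Longrightarrow> first_root i j \<le> r"
    unfolding first_root_def by (rule Least_le) (auto simp: choices_0)
qed

lemma first_best_first_root:
  assumes "first_best i j 0 (choices i j 0) x" shows "fst x = first_root i j"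
proof -
  from assms have "x \<in> choices i j 0" by (simp add: first_best_def)
  then obtain r where x: "x = (r, 0, 0)" and r: "i < r" "r \<le> j" by (auto simp: choices_0)
  then have ij: "i < j" by simp
  have v: "val i j 0 (r, 0, 0) = opt i j 0" using val_first_best[OF assms] x by simp
  have "(first_root i j, 0, 0) \<in> choices i j 0" using first_root[OF ij] by (simp add: choices_0)
  with assms v x first_root(3)[OF ij] have "r \<le> first_root i j"
    by (force simp: first_best_def)
  moreover have "first_root i j \<le> r"
    using first_root_least[OF ij r v] .
  ultimately show ?thesis using x by simp
qed

text \<open>
  With one level the external node of an empty interval can be charged to the interval itself rather
  than to its parent, which turns the recurrence into Knuth's.
\<close>

definition e :: "nat \<Rightarrow> nat \<Rightarrow> real" where
  "e i j = (if i = j then \<mu> 0 * q i else opt i j 0)"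

lemma val_e:
  assumes "i < r" "r \<le> j"
  shows "val i j 0 (r, 0, 0) = \<mu> 0 * W i j + e i (r - 1) + e r j"
  using assms by (auto simp: val_def node_weight_def e_def algebra_simps)

lemma e_le:
  assumes "i < r" "r \<le> j" shows "e i j \<le> \<mu> 0 * W i j + e i (r - 1) + e r j"
proof -
  have "(r, 0, 0) \<in> choices i j 0" using assms by (simp add: choices_0)
  from opt_le[OF this] show ?thesis using assms unfolding val_e[OF assms] by (simp add: e_def[of i j])
qed

lemma e_attained:
  assumes "i < j"
  obtains r where "i < r" "r \<le> j" "e i j = \<mu> 0 * W i j + e i (r - 1) + e r j"
proof
  note r = first_root[OF assms]
  show "i < first_root i j" "first_root i j \<le> j" by (fact r)+
  show "e i j = \<mu> 0 * W i j + e i (first_root i j - 1) + e (first_root i j) j"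
    using val_e[OF r(1,2)] r(3) assms by (simp add: e_def[of i j])
qed

text \<open>\<open>W\<close> sums point weights over an interval, hence the quadrangle condition
  holds for it with equality: the two sides differ only by exchanging the stretch from
  \<open>j\<close> to \<open>j'\<close>.\<close>

lemma W_exchange:
  assumes "i \<le> i'" "i' \<le> j" "j \<le> j'"
  shows "W i j + W i' j' = W i j' + W i' j"
proof -
  have "(\<Sum>t=a..j'. f t) = (\<Sum>t=a..j. f t) + (\<Sum>t=j+1..j'. f t)" if "a \<le> j + 1" for a and f :: "nat \<Rightarrow> real"
    using sum.ub_add_nat[of a j f "j' - j"] that assms by simp
  from this[of "i + 1" p] this[of "i' + 1" p] this[of i q] this[of i' q]
  show ?thesis using assms unfolding W_def by linarith
qed

lemma W_mono:
  assumes "i \<le> i'" "j \<le> j'" "\<And>t. t \<in> {1..j'} \<Longrightarrow> 0 \<le> p t" "\<And>t. t \<le> j' \<Longrightarrow> 0 \<le> q t"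
  shows "W i' j \<le> W i j'"
  unfolding W_def using assms by (intro add_mono sum_mono2) auto

section \<open>Quadrangle inequality and monotonicity of optimal roots\<close>

context
  fixes n :: nat
  assumes p_nonneg: "\<And>t. t \<in> {1..n} \<Longrightarrow> 0 \<le> p t" and q_nonneg: "\<And>t. t \<le> n \<Longrightarrow> 0 \<le> q t"
    and \<mu>_nonneg: "0 \<le> \<mu> 0"
begin

text \<open>Yao's argument by induction on the length of the outer interval: the optimal roots of
  the two intervals on the right-hand side serve as possibly suboptimal roots for the intervals on
  the left, and the induction hypothesis is applied to the pieces that remain.\<close>

lemma quadrangle_inequality:
  assumes "i \<le> i'" "i' \<le> j" "j \<le> j'" "j' \<le> n"
  shows "e i j + e i' j' \<le> e i j' + e i' j"
  using assms
proof (induction "j' - i" arbitrary: i i' j j' rule: less_induct)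
  case less
  have mono: "\<mu> 0 * W a b \<le> \<mu> 0 * W i j'" if "i \<le> a" "b \<le> j'" for a b
    using that less.prems p_nonneg q_nonneg \<mu>_nonneg by (intro mult_left_mono W_mono) auto
  have exch: "\<mu> 0 * W i j + \<mu> 0 * W i' j' = \<mu> 0 * W i j' + \<mu> 0 * W i' j"
    using W_exchange[OF less.prems(1-3)] by (metis distrib_left)
  consider "i = i'" | "j = j'" | "i < i'" "i' = j" "j < j'" | "i < i'" "i' < j" "j < j'"
    using less.prems by linarith
  then show ?case
  proof cases
    \<comment> \<open>The inner interval is empty. The root \<open>r\<close> of the outer interval
      lies in one of the two halves and is reused there; the other half is absorbed by the induction
      hypothesis. One weight term is left on the right, so monotonicity of \<open>W\<close>
      suffices.\<close>
    case 3
    obtain r where r: "i < r" "r \<le> j'" "e i j' = \<mu> 0 * W i j' + e i (r - 1) + e r j'"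
      using e_attained[of i j'] 3 by auto
    show ?thesis
    proof (cases "r \<le> j")
      case True
      have "e r j + e j j' \<le> e r j' + e j j"
        using less.hyps[of j' r j j] True r 3 less.prems by simp
      with e_le[of i r j] mono[of i j] True r 3 show ?thesis by simp
    next
      case False
      have "e i j + e j (r - 1) \<le> e i (r - 1) + e j j"
        using less.hyps[of "r - 1" i j j] False r 3 less.prems by auto
      with e_le[of j r j'] mono[of j j'] False r 3 show ?thesis by simp
    qed
  next
    \<comment> \<open>Of the roots \<open>y\<close> of the inner and \<open>z\<close> of the outer
      interval, the smaller is used for \<open>(i, j)\<close> and the larger for
      \<open>(i', j')\<close>. The weights cancel by \<open>exch\<close>; the parts to the right or
      to the left of the roots form a shorter quadrangle, according to which root is
      smaller.\<close>
    case 4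
    obtain y where y: "i' < y" "y \<le> j" "e i' j = \<mu> 0 * W i' j + e i' (y - 1) + e y j"
      using e_attained[of i' j] 4 by auto
    obtain z where z: "i < z" "z \<le> j'" "e i j' = \<mu> 0 * W i j' + e i (z - 1) + e z j'"
      using e_attained[of i j'] 4 by auto
    show ?thesis
    proof (cases "z \<le> y")
      case True
      have "e z j + e y j' \<le> e z j' + e y j"
        using less.hyps[of j' z y j] True y z 4 less.prems by simp
      with e_le[of i z j] e_le[of i' y j'] True y z 4 exch show ?thesis by simp
    next
      case False
      have "e i (y - 1) + e i' (z - 1) \<le> e i (z - 1) + e i' (y - 1)"
        using less.hyps[of "z - 1" i i' "y - 1"] False y z 4 less.prems by auto
      with e_le[of i y j] e_le[of i' z j'] False y z 4 exch show ?thesis by simp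
    qed
  qed auto
qed

lemma first_root_mono:
  assumes "i + 1 < j" "j \<le> n"
  shows "first_root i (j - 1) \<le> first_root i j" "first_root i j \<le> first_root (i + 1) j"
proof -
  let ?a = "first_root i (j - 1)" and ?b = "first_root (i + 1) j" and ?r = "first_root i j"
  have a: "i < ?a" "?a \<le> j - 1" "val i (j - 1) 0 (?a, 0, 0) = opt i (j - 1) 0"
    using first_root[of i "j - 1"] assms by auto
  have b: "i + 1 < ?b" "?b \<le> j" "val (i + 1) j 0 (?b, 0, 0) = opt (i + 1) j 0"
    using first_root[of "i + 1" j] assms by auto
  have r: "i < ?r" "?r \<le> j" "val i j 0 (?r, 0, 0) = opt i j 0"
    using first_root[of i j] assms by auto
  show "?a \<le> ?r"
  proof (rule ccontr)
    \<comment> \<open>On \<open>(i, j - 1)\<close> the root \<open>?r\<close> would be strictly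
      worse than \<open>?a\<close>, because \<open>?a\<close> is the least optimal one. The
      quadrangle inequality carries the strict gap over to \<open>(i, j)\<close>, against the
      optimality of \<open>?r\<close>.\<close>
    assume "\<not> ?a \<le> ?r"
    then have lt: "?r < ?a" by simp
    have "val i (j - 1) 0 (?r, 0, 0) \<ge> opt i (j - 1) 0"
      using opt_le[of "(?r, 0, 0)" i "j - 1" 0] r a lt by (auto simp: choices_0)
    moreover have "val i (j - 1) 0 (?r, 0, 0) \<noteq> opt i (j - 1) 0"
      using first_root_least[of i "j - 1" ?r] r a lt assms by auto
    ultimately have "val i (j - 1) 0 (?a, 0, 0) < val i (j - 1) 0 (?r, 0, 0)" using a by simp
    moreover have "e ?r (j - 1) + e ?a j \<le> e ?r j + e ?a (j - 1)"
      using quadrangle_inequality[of ?r ?a "j - 1" j] lt a assms by simp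
    moreover have "val i j 0 (?r, 0, 0) \<le> val i j 0 (?a, 0, 0)"
      using opt_le[of "(?a, 0, 0)" i j 0] r a by (auto simp: choices_0)
    moreover have "val i (j - 1) 0 (?r, 0, 0) = \<mu> 0 * W i (j - 1) + e i (?r - 1) + e ?r (j - 1)"
      "val i (j - 1) 0 (?a, 0, 0) = \<mu> 0 * W i (j - 1) + e i (?a - 1) + e ?a (j - 1)"
      "val i j 0 (?r, 0, 0) = \<mu> 0 * W i j + e i (?r - 1) + e ?r j"
      "val i j 0 (?a, 0, 0) = \<mu> 0 * W i j + e i (?a - 1) + e ?a j"
      using a r lt by (intro val_e; simp)+
    ultimately show False by linarith
  qed
  show "?r \<le> ?b"
  proof (rule ccontr)
    \<comment> \<open>On \<open>(i + 1, j)\<close> the root \<open>?b\<close> is at least as good as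
      \<open>?r\<close>; the quadrangle inequality carries this over to \<open>(i, j)\<close>, where
      \<open>?b\<close> would be a smaller optimal root. Here the leastness of \<open>?r\<close>
      gives the contradiction.\<close>
    assume "\<not> ?r \<le> ?b"
    then have lt: "?b < ?r" by simp
    have "val (i + 1) j 0 (?b, 0, 0) \<le> val (i + 1) j 0 (?r, 0, 0)"
      using opt_le[of "(?r, 0, 0)" "i + 1" j 0] r b lt by (auto simp: choices_0)
    moreover have "e i (?b - 1) + e (i + 1) (?r - 1) \<le> e i (?r - 1) + e (i + 1) (?b - 1)"
      using quadrangle_inequality[of i "i + 1" "?b - 1" "?r - 1"] lt b r assms by auto
    moreover have "val (i + 1) j 0 (?r, 0, 0) = \<mu> 0 * W (i + 1) j + e (i + 1) (?r - 1) + e ?r j"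
      "val (i + 1) j 0 (?b, 0, 0) = \<mu> 0 * W (i + 1) j + e (i + 1) (?b - 1) + e ?b j"
      "val i j 0 (?r, 0, 0) = \<mu> 0 * W i j + e i (?r - 1) + e ?r j"
      "val i j 0 (?b, 0, 0) = \<mu> 0 * W i j + e i (?b - 1) + e ?b j"
      using b r lt by (intro val_e; simp)+
    ultimately have "val i j 0 (?b, 0, 0) \<le> val i j 0 (?r, 0, 0)" by linarith
    then have "val i j 0 (?b, 0, 0) = opt i j 0"
      using opt_le[of "(?b, 0, 0)" i j 0] b r by (auto simp: choices_0)
    with first_root_least[of i j ?b] b lt assms show False by auto
  qed
qed

end

end

section \<open>The cost of a tree as a recursion\<close>

lemma internals_Key_mem: "Key a x b \<in> subtrees T \<Longrightarrow> x \<in> set (internals T)"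
  by (induction T) auto

lemma externals_Key_mem:
  "Key a x b \<in> subtrees T \<Longrightarrow> set (externals a) \<union> set (externals b) \<subseteq> set (externals T)"
  by (induction T) auto

text \<open>Distinct keys make the definite description unique at the root and, in the next two
  lemmas, local to the subtree that holds the key.\<close>

lemma subtree_at_root:
  assumes "distinct (internals (Key l x r))"
  shows "subtree_at (Key l x r) x = Key l x r"
  unfolding subtree_at_def
  using assms by (intro the_equality) (auto dest: internals_Key_mem)

lemma subtree_at_left:
  assumes "distinct (internals (Key l x r))" "i \<in> set (internals l)"
  shows "subtree_at (Key l x r) i = subtree_at l i"
  unfolding subtree_at_def
  using assms by (intro arg_cong[where f = The] ext) (auto dest: internals_Key_mem)

lemma subtree_at_right:
  assumes "distinct (internals (Key l x r))" "i \<in> set (internals r)"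
  shows "subtree_at (Key l x r) i = subtree_at r i"
  unfolding subtree_at_def
  using assms by (intro arg_cong[where f = The] ext) (auto dest: internals_Key_mem)

lemma ext_parent_left:
  assumes "distinct (externals (Key l x r))" "j \<in> set (externals l)"
  shows "ext_parent (Key l x r) j = (case l of Ext _ \<Rightarrow> x | Key _ _ _ \<Rightarrow> ext_parent l j)"
proof -
  have *: "Key (Ext j) i b \<notin> subtrees r" "Key b i (Ext j) \<notin> subtrees r" "r \<noteq> Ext j" for i b
    using assms externals_Key_mem[of "Ext j" i b r] externals_Key_mem[of b i "Ext j" r] by auto
  show ?thesis
  proof (cases l)
    case (Ext j')
    then show ?thesis unfolding ext_parent_def using assms * by (auto intro!: the_equality)
  next
    case (Key l1 y l2)
    have "l \<noteq> Ext j" using Key by simp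
    then have "(\<exists>a b. Key a i b \<in> subtrees (Key l x r) \<and> (a = Ext j \<or> b = Ext j)) \<longleftrightarrow>
      (\<exists>a b. Key a i b \<in> subtrees l \<and> (a = Ext j \<or> b = Ext j))" for i
      using * by auto
    then show ?thesis unfolding ext_parent_def Key by simp
  qed
qed

lemma ext_parent_right:
  assumes "distinct (externals (Key l x r))" "j \<in> set (externals r)"
  shows "ext_parent (Key l x r) j = (case r of Ext _ \<Rightarrow> x | Key _ _ _ \<Rightarrow> ext_parent r j)"
proof -
  have *: "Key (Ext j) i b \<notin> subtrees l" "Key b i (Ext j) \<notin> subtrees l" "l \<noteq> Ext j" for i b
    using assms externals_Key_mem[of "Ext j" i b l] externals_Key_mem[of b i "Ext j" l] by auto
  show ?thesis
  proof (cases r)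
    case (Ext j')
    then show ?thesis unfolding ext_parent_def using assms * by (auto intro!: the_equality)
  next
    case (Key l1 y l2)
    have "r \<noteq> Ext j" using Key by simp
    then have "(\<exists>a b. Key a i b \<in> subtrees (Key l x r) \<and> (a = Ext j \<or> b = Ext j)) \<longleftrightarrow>
      (\<exists>a b. Key a i b \<in> subtrees r \<and> (a = Ext j \<or> b = Ext j))" for i
      using * by auto
    then show ?thesis unfolding ext_parent_def Key by simp
  qed
qed

fun ext_weight :: "(nat \<Rightarrow> real) \<Rightarrow> etree \<Rightarrow> real" where
  "ext_weight q (Ext j) = q j"
| "ext_weight q (Key l i r) = 0"

fun tree_cost :: "(nat \<Rightarrow> real) \<Rightarrow> (nat \<Rightarrow> real) \<Rightarrow> (nat \<Rightarrow> real) \<Rightarrow> etree \<Rightarrow> real" where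
  "tree_cost p q \<nu> (Ext j) = 0"
| "tree_cost p q \<nu> (Key l i r) =
     \<nu> i * (weight p q (Key l i r) + ext_weight q l + ext_weight q r)
     + tree_cost p q \<nu> l + tree_cost p q \<nu> r"

lemma tree_cost_cong:
  "(\<And>i. i \<in> set (internals T) \<Longrightarrow> \<nu> i = \<nu>' i) \<Longrightarrow> tree_cost p q \<nu> T = tree_cost p q \<nu>' T"
  by (induction T) auto

lemma sum_internals:
  fixes f :: "nat \<Rightarrow> real"
  assumes "distinct (internals (Key l x r))"
  shows "(\<Sum>i\<in>set (internals (Key l x r)). f i) =
    f x + (\<Sum>i\<in>set (internals l). f i) + (\<Sum>i\<in>set (internals r). f i)"
proof -
  have "set (internals (Key l x r)) = insert x (set (internals l) \<union> set (internals r))" by auto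
  moreover have "x \<notin> set (internals l) \<union> set (internals r)"
    "set (internals l) \<inter> set (internals r) = {}" using assms by auto
  ultimately show ?thesis by (simp add: sum.union_disjoint)
qed

text \<open>A lone external node has no parent, so its \<open>ext_parent\<close> is unspecified. The
  last term carries this junk value on both sides to let the induction start; one level up it is
  replaced by the charge \<open>ext_weight\<close> to the actual parent.\<close>

lemma sum_internal_costs:
  assumes "distinct (internals T)" "distinct (externals T)"
  shows "(\<Sum>i\<in>set (internals T). weight p q (subtree_at T i) * \<nu> i)
     + (\<Sum>j\<in>set (externals T). q j * \<nu> (ext_parent T j))
    = tree_cost p q \<nu> T + (case T of Ext j \<Rightarrow> q j * \<nu> (ext_parent T j) | Key _ _ _ \<Rightarrow> 0)"
  using assms
proof (induction T)
  case (Key l x r)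
  let ?T = "Key l x r"
  let ?E = "\<lambda>S T. \<Sum>j\<in>set (externals S). q j * \<nu> (ext_parent T j)"
  let ?I = "\<lambda>S T. \<Sum>i\<in>set (internals S). weight p q (subtree_at T i) * \<nu> i"
  have d: "distinct (internals l)" "distinct (externals l)" "distinct (internals r)" "distinct (externals r)"
    using Key.prems by auto
  have "?I l ?T = ?I l l" "?I r ?T = ?I r r"
    using Key.prems by (auto intro!: sum.cong simp: subtree_at_left subtree_at_right simp del: internals.simps)
  then have I: "?I ?T ?T = weight p q ?T * \<nu> x + ?I l l + ?I r r"
    using sum_internals[OF Key.prems(1)] subtree_at_root[OF Key.prems(1)] by simp
  have "set (externals ?T) = set (externals l) \<union> set (externals r)"
    "set (externals l) \<inter> set (externals r) = {}" using Key.prems by auto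
  then have "?E ?T ?T = ?E l ?T + ?E r ?T" by (simp add: sum.union_disjoint)
  moreover have "?I l l + ?E l ?T = \<nu> x * ext_weight q l + tree_cost p q \<nu> l"
  proof -
    have "?E l ?T = (\<Sum>j\<in>set (externals l). q j * \<nu> (case l of Ext _ \<Rightarrow> x | Key _ _ _ \<Rightarrow> ext_parent l j))"
      using ext_parent_left[OF Key.prems(2)] by (intro sum.cong) simp_all
    then show ?thesis using Key.IH(1)[OF d(1,2)] by (cases l) (simp_all split: etree.splits)
  qed
  moreover have "?I r r + ?E r ?T = \<nu> x * ext_weight q r + tree_cost p q \<nu> r"
  proof -
    have "?E r ?T = (\<Sum>j\<in>set (externals r). q j * \<nu> (case r of Ext _ \<Rightarrow> x | Key _ _ _ \<Rightarrow> ext_parent r j))"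
      using ext_parent_right[OF Key.prems(2)] by (intro sum.cong) simp_all
    then show ?thesis using Key.IH(2)[OF d(3,4)] by (cases r) (simp_all split: etree.splits)
  qed
  ultimately have "?I ?T ?T + ?E ?T ?T = weight p q ?T * \<nu> x
      + (\<nu> x * ext_weight q l + tree_cost p q \<nu> l) + (\<nu> x * ext_weight q r + tree_cost p q \<nu> r)"
    using I by linarith
  then show ?case by (simp add: algebra_simps)
qed simp

lemma cost_eq_tree_cost:
  assumes "is_BST (m1 + m2) T" "1 \<le> m1 + m2"
  shows "cost m1 m2 c1 c2 p q T \<phi> = tree_cost p q (\<lambda>i. real (access_cost m1 c1 c2 (\<phi> i))) T"
proof -
  have I: "internals T = [1..<m1 + m2 + 1]" and E: "externals T = [0..<m1 + m2 + 1]"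
    using assms(1) by (auto simp: is_BST_def)
  have s: "set (internals T) = {1..m1 + m2}" "set (externals T) = {0..m1 + m2}"
    unfolding I E by auto
  have "\<exists>l i r. T = Key l i r" using I assms(2) by (cases T) auto
  moreover have "weight p q (Ext j) = q j" for j by (simp add: weight_def)
  moreover have "distinct (internals T)" "distinct (externals T)" unfolding I E by auto
  ultimately show ?thesis
    using sum_internal_costs[of T p q "\<lambda>i. real (access_cost m1 c1 c2 (\<phi> i))"]
    by (auto simp: cost_def Let_def s)
qed

section \<open>Optimality of the recurrence\<close>

definition bst_on :: "nat \<Rightarrow> nat \<Rightarrow> etree \<Rightarrow> bool" where
  "bst_on i j T \<longleftrightarrow> i \<le> j \<and> internals T = [i+1..<j+1] \<and> externals T = [i..<j+1]"

lemma is_BST_iff: "is_BST n T \<longleftrightarrow> bst_on 0 n T"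
  by (auto simp: is_BST_def bst_on_def)

text \<open>Tells where the list of external nodes splits once the split of the keys at the root is
  known; this is what makes \<open>bst_on_Key\<close> go through.\<close>

lemma length_externals: "length (externals T) = length (internals T) + 1"
  by (induction T) auto

lemma bst_on_Ext [simp]: "bst_on i j (Ext a) \<longleftrightarrow> i = j \<and> a = i"
  by (auto simp: bst_on_def upt_rec)

lemma upt_append_split:
  assumes "xs @ ys = [a..<b]"
  shows "xs = [a..<a + length xs] \<and> ys = [a + length xs..<b]"
proof -
  have l: "length xs + length ys = b - a" using arg_cong[OF assms, of length] by simp
  have "xs = take (length xs) [a..<b]" "ys = drop (length xs) [a..<b]"
    using assms by (metis append_eq_conv_conj)+
  with l show ?thesis by (cases "length xs = 0") (auto simp: take_upt)
qed

lemma bst_on_Key: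
  "bst_on i j (Key l x r) \<longleftrightarrow> i < x \<and> x \<le> j \<and> bst_on i (x - 1) l \<and> bst_on x j r"
proof
  assume b: "bst_on i j (Key l x r)"
  let ?L = "length (internals l)"
  from b have "internals l @ (x # internals r) = [i+1..<j+1]" by (simp add: bst_on_def)
  from upt_append_split[OF this] have l: "internals l = [i+1..<i+1+?L]"
    and xr: "x # internals r = [i+1+?L..<j+1]" by auto
  from xr[symmetric] have x: "x = i+1+?L" "x \<le> j" "internals r = [x+1..<j+1]"
    unfolding upt_eq_Cons_conv by (auto simp del: upt_Suc)
  from b have "externals l @ externals r = [i..<j+1]" by (simp add: bst_on_def)
  from upt_append_split[OF this] have "externals l = [i..<x]" "externals r = [x..<j+1]"
    using x(1) by (auto simp: length_externals)
  with l x show "i < x \<and> x \<le> j \<and> bst_on i (x - 1) l \<and> bst_on x j r"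
    by (auto simp: bst_on_def simp del: upt_Suc)
next
  assume "i < x \<and> x \<le> j \<and> bst_on i (x - 1) l \<and> bst_on x j r"
  then have *: "i < x" "x \<le> j" "internals l = [i+1..<x]" "internals r = [x+1..<j+1]"
    "externals l = [i..<x]" "externals r = [x..<j+1]" by (auto simp: bst_on_def simp del: upt_Suc)
  have "[i+1..<x] @ [x..<j+1] = [i+1..<j+1]" "[i..<x] @ [x..<j+1] = [i..<j+1]"
    using *(1,2) upt_add_eq_append[of "i+1" x "j+1-x"] upt_add_eq_append[of i x "j+1-x"] by (simp_all del: upt_Suc)
  moreover have "[x..<j+1] = x # [x+1..<j+1]" using *(2) by (simp add: upt_conv_Cons del: upt_Suc)
  ultimately show "bst_on i j (Key l x r)" using * by (simp add: bst_on_def del: upt_Suc)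
qed

lemma bst_on_internals: "bst_on i j T \<Longrightarrow> set (internals T) = {i<..j}"
  by (auto simp: bst_on_def)

context recurrence
begin

lemma ext_weight_bst_on: "bst_on i j T \<Longrightarrow> ext_weight q T = (if i = j then q i else 0)"
  by (cases T) (auto simp: bst_on_Key)

lemma weight_bst_on:
  assumes "bst_on i j T" shows "weight p q T = W i j"
proof -
  have "(\<Sum>x\<leftarrow>[a..<b]. f x) = sum f {a..<b}" for a b and f :: "nat \<Rightarrow> real"
    by (simp add: sum_list_distinct_conv_sum_set)
  then show ?thesis using assms by (simp add: weight_def W_def bst_on_def atLeastLessThanSuc_atLeastAtMost del: upt_Suc)
qed

definition level_count :: "(nat \<Rightarrow> nat) \<Rightarrow> nat \<Rightarrow> nat \<Rightarrow> nat" where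
  "level_count lv i j = card {x \<in> {i<..j}. lv x = 1}"

lemma level_count_split:
  assumes "i < r" "r \<le> j" "lv r \<le> 1"
  shows "level_count lv i j = lv r + level_count lv i (r - 1) + level_count lv r j"
proof -
  have "{x \<in> {i<..j}. lv x = 1} =
    (if lv r = 1 then {r} else {}) \<union> {x \<in> {i<..r-1}. lv x = 1} \<union> {x \<in> {r<..j}. lv x = 1}"
    (is "?A = ?B")
  proof (intro set_eqI)
    show "x \<in> ?A \<longleftrightarrow> x \<in> ?B" for x
      using assms by (cases x r rule: linorder_cases) auto
  qed
  also have "card \<dots> = lv r + level_count lv i (r - 1) + level_count lv r j"
    using assms unfolding level_count_def by (subst card_Un_disjoint; auto)+
  finally show ?thesis by (simp add: level_count_def)
qed

lemma level_count_le: "level_count lv i j \<le> j - i"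
  unfolding level_count_def by (rule order_trans[OF card_mono[of "{i<..j}"]]) auto

lemma tree_cost_bst_on_Key:
  assumes "bst_on i j (Key l r t)"
  shows "tree_cost p q (\<lambda>x. \<mu> (lv x)) (Key l r t) = \<mu> (lv r) * node_weight i j r
    + tree_cost p q (\<lambda>x. \<mu> (lv x)) l + tree_cost p q (\<lambda>x. \<mu> (lv x)) t"
proof -
  have b: "i < r" "r \<le> j" "bst_on i (r - 1) l" "bst_on r j t" using assms by (auto simp: bst_on_Key)
  have "weight p q (Key l r t) + ext_weight q l + ext_weight q t = node_weight i j r"
    using b ext_weight_bst_on[OF b(3)] ext_weight_bst_on[OF b(4)] weight_bst_on[OF assms]
    by (auto simp: node_weight_def)
  then show ?thesis by simp
qed

text \<open>Each node of an arbitrary tree with levels makes one admissible choice of the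
  recurrence, with the counts of level-1 nodes that actually occur below it. A subtree of s keys
  holds at most s such nodes, which gives admissibility.\<close>

lemma opt_le_tree_cost:
  assumes "bst_on i j T" "\<And>x. lv x \<le> 1"
  shows "opt i j (level_count lv i j) \<le> tree_cost p q (\<lambda>x. \<mu> (lv x)) T"
  using assms(1)
proof (induction T arbitrary: i j)
  case (Key l r t)
  have b: "i < r" "r \<le> j" "bst_on i (r - 1) l" "bst_on r j t" using Key.prems by (auto simp: bst_on_Key)
  let ?k = "level_count lv i j" and ?c = "level_count lv i (r - 1)" and ?d = "level_count lv r j"
  have k: "?k = lv r + ?c + ?d" by (rule level_count_split[OF b(1,2) assms(2)])
  have "(r, lv r, ?c) \<in> choices i j ?k"
    using b k assms(2)[of r] level_count_le[of lv i "r - 1"] level_count_le[of lv r j]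
    by (auto simp: choices_def)
  from opt_le[OF this] have "opt i j ?k \<le> \<mu> (lv r) * node_weight i j r + opt i (r - 1) ?c + opt r j ?d"
    using k by (simp add: val_def)
  then show ?case using Key.IH(1)[OF b(3)] Key.IH(2)[OF b(4)]
    unfolding tree_cost_bst_on_Key[OF Key.prems] by linarith
qed simp

end

text \<open>Abstracts from the memory: any functions that name an optimal choice for every feasible
  \<open>(i, j, k)\<close> determine an optimal tree. The final table supplies them later.\<close>

locale decisions = recurrence +
  fixes n m :: nat and rt lv lc :: "nat \<Rightarrow> nat \<Rightarrow> nat \<Rightarrow> nat"
  assumes decision: "\<And>i j k. i < j \<Longrightarrow> j \<le> n \<Longrightarrow> k \<le> m \<Longrightarrow> k \<le> j - i \<Longrightarrow>
    (rt i j k, lv i j k, lc i j k) \<in> choices i j k \<and>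
    val i j k (rt i j k, lv i j k, lc i j k) = opt i j k"
begin

text \<open>The guard secures termination also outside the range in which \<open>decision\<close>
  says anything about \<open>rt\<close>.\<close>

function build :: "nat \<Rightarrow> nat \<Rightarrow> nat \<Rightarrow> etree" where
  "build i j k = (if i < rt i j k \<and> rt i j k \<le> j
     then Key (build i (rt i j k - 1) (lc i j k)) (rt i j k)
            (build (rt i j k) j (k - lv i j k - lc i j k))
     else Ext i)"
  by auto
termination by (relation "measure (\<lambda>(i, j, k). j - i)") auto

declare build.simps [simp del]

function level :: "nat \<Rightarrow> nat \<Rightarrow> nat \<Rightarrow> nat \<Rightarrow> nat" where
  "level i j k x = (if i < rt i j k \<and> rt i j k \<le> j
     then if x = rt i j k then lv i j k
       else if x < rt i j k then level i (rt i j k - 1) (lc i j k) x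
       else level (rt i j k) j (k - lv i j k - lc i j k) x
     else 0)"
  by auto
termination by (relation "measure (\<lambda>(i, j, k, x). j - i)") auto

declare level.simps [simp del]

lemma build_diag [simp]: "build i i k = Ext i"
  by (subst build.simps) auto

lemma decision_bounds:
  assumes "i < j" "j \<le> n" "k \<le> m" "k \<le> j - i"
  defines "r \<equiv> rt i j k" and "c \<equiv> lc i j k" and "d \<equiv> k - lv i j k - lc i j k"
  shows "i < r" "r \<le> j" "lv i j k \<le> 1" "c \<le> r - 1 - i" "d \<le> j - r" "c \<le> m" "d \<le> m"
    "lv i j k + c + d = k"
  using decision[OF assms(1-4)] assms(3,4) unfolding r_def c_def d_def by (auto simp: choices_def)

lemma level_le: "j \<le> n \<Longrightarrow> k \<le> m \<Longrightarrow> i \<le> j \<Longrightarrow> k \<le> j - i \<Longrightarrow> level i j k x \<le> 1"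
proof (induction i j k x rule: level.induct)
  case (1 i j k x)
  show ?case
  proof (cases "i < j")
    case True
    note d = decision_bounds[OF True 1(3,4,6)]
    show ?thesis using d 1(1,2,3) by (subst level.simps) auto
  next
    case False
    then show ?thesis by (subst level.simps) auto
  qed
qed

text \<open>The choice at the root splits \<open>k\<close> exactly into the root, the left and the
  right part. On the keys of a subtree the function \<open>level\<close> coincides with the one of
  that subtree, so costs and counts add up along the recursion.\<close>

lemma build_correct:
  assumes "i \<le> j" "j \<le> n" "k \<le> m" "k \<le> j - i"
  shows "bst_on i j (build i j k) \<and> tree_cost p q (\<lambda>x. \<mu> (level i j k x)) (build i j k) = opt i j k
    \<and> level_count (level i j k) i j = k"
  using assms
proof (induction i j k rule: build.induct)
  case (1 i j k)
  show ?case
  proof (cases "i < j")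
    case True
    let ?r = "rt i j k" and ?c = "lc i j k" and ?l = "lv i j k"
    let ?d = "k - ?l - ?c"
    note d = decision_bounds[OF True 1(4,5,6)]
    have b: "build i j k = Key (build i (?r - 1) ?c) ?r (build ?r j ?d)"
      using d by (subst build.simps) simp
    have L: "level i j k ?r = ?l" "\<And>x. x < ?r \<Longrightarrow> level i j k x = level i (?r - 1) ?c x"
      "\<And>x. x > ?r \<Longrightarrow> level i j k x = level ?r j ?d x"
      using d by (subst level.simps; simp)+
    have IH1: "bst_on i (?r - 1) (build i (?r - 1) ?c)"
      "tree_cost p q (\<lambda>x. \<mu> (level i (?r - 1) ?c x)) (build i (?r - 1) ?c) = opt i (?r - 1) ?c"
      "level_count (level i (?r - 1) ?c) i (?r - 1) = ?c"
      using 1(1) d 1(4) by auto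
    have IH2: "bst_on ?r j (build ?r j ?d)"
      "tree_cost p q (\<lambda>x. \<mu> (level ?r j ?d x)) (build ?r j ?d) = opt ?r j ?d"
      "level_count (level ?r j ?d) ?r j = ?d"
      using 1(2) d 1(4) by auto
    have bst: "bst_on i j (build i j k)" unfolding b bst_on_Key using d IH1(1) IH2(1) by simp
    have "tree_cost p q (\<lambda>x. \<mu> (level i j k x)) (build i (?r - 1) ?c) = opt i (?r - 1) ?c"
      unfolding IH1(2)[symmetric]
    proof (intro tree_cost_cong)
      fix x assume "x \<in> set (internals (build i (?r - 1) ?c))"
      then have "x < ?r" using bst_on_internals[OF IH1(1)] d by auto
      then show "\<mu> (level i j k x) = \<mu> (level i (?r - 1) ?c x)" by (simp add: L(2))
    qed
    moreover have "tree_cost p q (\<lambda>x. \<mu> (level i j k x)) (build ?r j ?d) = opt ?r j ?d"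
      unfolding IH2(2)[symmetric]
    proof (intro tree_cost_cong)
      fix x assume "x \<in> set (internals (build ?r j ?d))"
      then have "?r < x" using bst_on_internals[OF IH2(1)] by auto
      then show "\<mu> (level i j k x) = \<mu> (level ?r j ?d x)" by (simp add: L(3))
    qed
    moreover have "val i j k (?r, ?l, ?c) = opt i j k" using decision True 1 by blast
    ultimately have "tree_cost p q (\<lambda>x. \<mu> (level i j k x)) (build i j k) = opt i j k"
      unfolding b tree_cost_bst_on_Key[OF bst[unfolded b]] L(1) by (simp add: val_def)
    moreover have "level_count (level i j k) i j = k"
    proof -
      have "level_count (level i j k) i (?r - 1) = level_count (level i (?r - 1) ?c) i (?r - 1)"
        "level_count (level i j k) ?r j = level_count (level ?r j ?d) ?r j"
        unfolding level_count_def using d(1,2)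
        by (auto simp: L(2,3) intro!: arg_cong[where f = card])
      then show ?thesis
        using level_count_split[of i ?r j "level i j k"] d L(1) IH1(3) IH2(3) by simp
    qed
    ultimately show ?thesis using bst by simp
  next
    case False
    with 1 show ?thesis by (auto simp: level_count_def)
  qed
qed

end

section \<open>Memory assignments\<close>

text \<open>The rank within \<open>A\<close> increases strictly on \<open>A\<close>, hence is
  injective, and its range lies in a set with as many elements as \<open>A\<close>.\<close>

lemma bij_betw_rank:
  assumes "finite A" "A \<subseteq> {1..n}"
  shows "bij_betw (\<lambda>x::nat. card (A \<inter> {1..x})) A {1..card A}"
proof -
  have "card (A \<inter> {1..x}) < card (A \<inter> {1..y})" if "x < y" "y \<in> A" for x y
  proof (intro psubset_card_mono psubsetI)
    have "y \<in> A \<inter> {1..y}" "y \<notin> A \<inter> {1..x}" using that assms by auto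
    then show "A \<inter> {1..x} \<noteq> A \<inter> {1..y}" by blast
  qed (use that in auto)
  then have "inj_on (\<lambda>x. card (A \<inter> {1..x})) A"
    by (intro inj_onI) (metis less_irrefl linorder_neqE_nat)
  moreover have "(\<lambda>x. card (A \<inter> {1..x})) ` A \<subseteq> {1..card A}"
  proof
    fix y assume "y \<in> (\<lambda>x. card (A \<inter> {1..x})) ` A"
    then obtain x where x: "x \<in> A" "y = card (A \<inter> {1..x})" by auto
    then have "x \<in> A \<inter> {1..x}" using assms by auto
    then have "0 < y" unfolding x(2) card_gt_0_iff by blast
    moreover have "y \<le> card A" unfolding x(2) using assms by (intro card_mono) auto
    ultimately show "y \<in> {1..card A}" by simp
  qed
  ultimately show ?thesis
    by (simp add: bij_betw_def card_image card_subset_eq)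
qed

lemma card_preimage_bij:
  assumes "bij_betw \<phi> {1..n} {1..n}" "a \<le> n"
  shows "card {x \<in> {1..n}. \<phi> x \<le> a} = a"
proof -
  have "\<phi> ` {x \<in> {1..n}. \<phi> x \<le> a} = {1..a}"
  proof (intro equalityI subsetI)
    fix y assume "y \<in> {1..a}"
    then have "y \<in> \<phi> ` {1..n}" using assms by (auto simp: bij_betw_def)
    then show "y \<in> \<phi> ` {x \<in> {1..n}. \<phi> x \<le> a}" using \<open>y \<in> {1..a}\<close> by auto
  qed (use assms in \<open>auto simp: bij_betw_def\<close>)
  moreover have "inj_on \<phi> {x \<in> {1..n}. \<phi> x \<le> a}"
    using assms by (auto simp: bij_betw_def intro: inj_on_subset)
  ultimately show ?thesis using card_image by force
qed

text \<open>The keys of each level get consecutive addresses in key order, above \<open>a\<close>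
  for level 1 and above \<open>b\<close> otherwise. Two running counters therefore suffice to
  produce the assignment key by key.\<close>

definition assignment :: "nat \<Rightarrow> nat \<Rightarrow> (nat \<Rightarrow> nat) \<Rightarrow> nat \<Rightarrow> nat" where
  "assignment a b lv x = (if lv x = 1 then a + card {y \<in> {1..x}. lv y = 1}
     else b + card {y \<in> {1..x}. lv y \<noteq> 1})"

lemma assignment_correct:
  assumes c: "card {x \<in> {1..m1 + m2}. lv x = 1} = (if m1 \<le> m2 then m1 else m2)"
  defines "\<phi> \<equiv> assignment (if m1 \<le> m2 then 0 else m1) (if m1 \<le> m2 then m1 else 0) lv"
  shows "bij_betw \<phi> {1..m1 + m2} {1..m1 + m2}"
    "x \<in> {1..m1 + m2} \<Longrightarrow> \<phi> x \<le> m1 \<longleftrightarrow> (if m1 \<le> m2 then lv x = 1 else lv x \<noteq> 1)"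
proof -
  let ?n = "m1 + m2"
  define A where "A = {x \<in> {1..?n}. lv x = 1}"
  define B where "B = {x \<in> {1..?n}. lv x \<noteq> 1}"
  define a where "a = (if m1 \<le> m2 then 0 else m1)"
  define b where "b = (if m1 \<le> m2 then m1 else 0)"
  have U: "A \<union> B = {1..?n}" "A \<inter> B = {}" by (auto simp: A_def B_def)
  have fin: "finite A" "finite B" by (auto simp: A_def B_def)
  have cA: "card A = (if m1 \<le> m2 then m1 else m2)" using c by (simp add: A_def)
  have "card A + card B = ?n" using card_Un_disjoint[OF fin U(2)] U(1) by simp
  with cA have cB: "card B = (if m1 \<le> m2 then m2 else m1)" by (simp split: if_splits)
  have \<phi>A: "\<phi> x = a + card (A \<inter> {1..x})" if "x \<in> A" for x
    using that by (auto simp: \<phi>_def assignment_def a_def A_def intro!: arg_cong[where f = card])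
  have \<phi>B: "\<phi> x = b + card (B \<inter> {1..x})" if "x \<in> B" for x
    using that by (auto simp: \<phi>_def assignment_def b_def B_def intro!: arg_cong[where f = card])
  have shift: "bij_betw (\<lambda>y. d + y) {1..k} {d+1..d+k}" for d k :: nat
    by (auto simp: bij_betw_def image_add_atLeastAtMost)
  have "bij_betw \<phi> A {a+1..a+card A}"
    using bij_betw_trans[OF bij_betw_rank[of A ?n] shift[of a "card A"]] \<phi>A fin U
    by (subst bij_betw_cong[of A \<phi> "(+) a \<circ> (\<lambda>x. card (A \<inter> {1..x}))"]) auto
  moreover have "bij_betw \<phi> B {b+1..b+card B}"
    using bij_betw_trans[OF bij_betw_rank[of B ?n] shift[of b "card B"]] \<phi>B fin U
    by (subst bij_betw_cong[of B \<phi> "(+) b \<circ> (\<lambda>x. card (B \<inter> {1..x}))"]) auto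
  moreover have "{a+1..a+card A} \<inter> {b+1..b+card B} = {}"
    "{a+1..a+card A} \<union> {b+1..b+card B} = {1..?n}"
    using cA cB by (auto simp: a_def b_def split: if_splits)
  ultimately show "bij_betw \<phi> {1..?n} {1..?n}" using bij_betw_combine U(1) by metis
  show "\<phi> x \<le> m1 \<longleftrightarrow> (if m1 \<le> m2 then lv x = 1 else lv x \<noteq> 1)" if x: "x \<in> {1..?n}"
  proof -
    have "0 < card (A \<inter> {1..x}) \<and> card (A \<inter> {1..x}) \<le> card A" if "x \<in> A"
      using that x fin by (auto simp: card_gt_0_iff intro: card_mono)
    moreover have "0 < card (B \<inter> {1..x}) \<and> card (B \<inter> {1..x}) \<le> card B" if "x \<in> B"
      using that x fin by (auto simp: card_gt_0_iff intro: card_mono)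
    moreover have "x \<in> A \<longleftrightarrow> lv x = 1" "x \<in> B \<longleftrightarrow> lv x \<noteq> 1" using x by (auto simp: A_def B_def)
    ultimately show ?thesis using \<phi>A[of x] \<phi>B[of x] cA cB
      by (cases "lv x = 1") (auto simp: a_def b_def)
  qed
qed

text \<open>The cost depends on an assignment only through the levels, and a bijection puts exactly
  \<open>m\<close> keys into the smaller level; so every competitor is bounded below by the
  recurrence at this \<open>m\<close>. Level 1 is the smaller level, and
  \<open>(l = 1) = (m1 \<le> m2)\<close> says that \<open>l\<close> is the fast one.\<close>

lemma optimum_solutionI:
  fixes m1 m2 c1 c2 :: nat and p q :: "nat \<Rightarrow> real"
  defines "m \<equiv> if m1 \<le> m2 then m1 else m2"
    and "\<mu> \<equiv> \<lambda>l. real (if (l = (1::nat)) = (m1 \<le> m2) then c1 else c2)"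
    and "a \<equiv> if m1 \<le> m2 then 0 else m1" and "b \<equiv> if m1 \<le> m2 then m1 else 0"
  assumes n: "1 \<le> m1 + m2" and T: "is_BST (m1 + m2) T"
    and lv: "\<And>x. lv x \<le> 1" "card {x \<in> {0<..m1 + m2}. lv x = 1} = m"
    and c: "tree_cost p q (\<lambda>x. \<mu> (lv x)) T = recurrence.opt p q \<mu> 0 (m1 + m2) m"
  shows "optimum_solution m1 m2 c1 c2 p q T (assignment a b lv)"
proof -
  interpret recurrence p q \<mu> .
  let ?n = "m1 + m2" and ?\<phi> = "assignment a b lv"
  have S: "{0<..?n} = {1..?n}" by auto
  have cm: "card {x \<in> {1..?n}. lv x = 1} = (if m1 \<le> m2 then m1 else m2)"
    using lv(2) by (simp add: S m_def)
  note ac = assignment_correct[OF cm, folded a_def b_def]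
  have s: "set (internals T) = {1..?n}" using T by (auto simp: is_BST_def)
  have "cost m1 m2 c1 c2 p q T ?\<phi> = tree_cost p q (\<lambda>x. \<mu> (lv x)) T"
    unfolding cost_eq_tree_cost[OF T n]
    by (intro tree_cost_cong) (use ac(2) in \<open>auto simp: s access_cost_def \<mu>_def\<close>)
  then have eq: "cost m1 m2 c1 c2 p q T ?\<phi> = opt 0 ?n m" using c by simp
  have "opt 0 ?n m \<le> cost m1 m2 c1 c2 p q T' \<phi>'" if "is_solution ?n T' \<phi>'" for T' \<phi>'
  proof -
    \<comment> \<open>The equivalence holds exactly for the keys that the competitor stores in the
      smaller of the two address ranges.\<close>
    define lv' :: "nat \<Rightarrow> nat" where "lv' x = (if (\<phi>' x \<le> m1) = (m1 \<le> m2) then 1 else 0)" for x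
    have T': "is_BST ?n T'" "bij_betw \<phi>' {1..?n} {1..?n}" using that by (auto simp: is_solution_def)
    have c1: "card {x \<in> {1..?n}. \<phi>' x \<le> m1} = m1" using card_preimage_bij[OF T'(2)] by simp
    have "card ({1..?n} - {x \<in> {1..?n}. \<phi>' x \<le> m1}) = card {1..?n} - card {x \<in> {1..?n}. \<phi>' x \<le> m1}"
      by (rule card_Diff_subset) auto
    then have "card ({1..?n} - {x \<in> {1..?n}. \<phi>' x \<le> m1}) = m2" unfolding c1 by simp
    moreover have "{1..?n} - {x \<in> {1..?n}. \<phi>' x \<le> m1} = {x \<in> {1..?n}. \<not> \<phi>' x \<le> m1}" by auto
    ultimately have c2: "card {x \<in> {1..?n}. \<not> \<phi>' x \<le> m1} = m2" by simp
    have "level_count lv' 0 ?n = m"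
    proof (cases "m1 \<le> m2")
      case True
      then have "{x \<in> {0<..?n}. lv' x = 1} = {x \<in> {1..?n}. \<phi>' x \<le> m1}" by (auto simp: lv'_def)
      then show ?thesis using c1 True by (simp add: level_count_def m_def)
    next
      case False
      then have "{x \<in> {0<..?n}. lv' x = 1} = {x \<in> {1..?n}. \<not> \<phi>' x \<le> m1}" by (auto simp: lv'_def)
      then show ?thesis using c2 False by (simp add: level_count_def m_def)
    qed
    moreover have "opt 0 ?n (level_count lv' 0 ?n) \<le> tree_cost p q (\<lambda>x. \<mu> (lv' x)) T'"
      using T' by (intro opt_le_tree_cost) (auto simp: is_BST_iff lv'_def)
    moreover have "cost m1 m2 c1 c2 p q T' \<phi>' = tree_cost p q (\<lambda>x. \<mu> (lv' x)) T'"
      unfolding cost_eq_tree_cost[OF T'(1) n]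
      by (intro tree_cost_cong) (auto simp: access_cost_def \<mu>_def lv'_def)
    ultimately show ?thesis by simp
  qed
  then show ?thesis using eq T ac(1) by (simp add: optimum_solution_def is_solution_def)
qed

section \<open>The program\<close>

text \<open>
  With \<open>n = m\<^sub>1 + m\<^sub>2\<close> and \<open>m = min m\<^sub>1 m\<^sub>2\<close>, registers \<open>0\<close> to \<open>14\<close> hold the output base \<open>B\<close>, \<open>0\<close>, \<open>1\<close>,
  \<open>n\<close>, \<open>m\<close>, \<open>n + 1\<close>, \<open>m + 1\<close>, \<open>4\<close>, the table base, \<open>\<mu> 0\<close>, \<open>\<mu> 1 - \<mu> 0\<close>, the last used address of
  each level (level \<open>1\<close> first), \<open>n + 4\<close> and \<open>3\<close>. In the dynamic program, registers \<open>15\<close> to \<open>34\<close> hold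
  \<open>i\<close>, \<open>q i\<close>, \<open>W i j\<close>, \<open>j\<close>, \<open>q j\<close>, the least and the largest root tried, \<open>k\<close>, \<open>r\<close>, \<open>r - 1 - i\<close>,
  \<open>node_weight i j r\<close>, \<open>r - 1\<close>, \<open>l\<close>, \<open>k - l\<close>, \<open>\<mu> l * node_weight i j r\<close>, \<open>c\<close>, and the best value
  with its choice \<open>(r, l, c)\<close>, where root \<open>0\<close> means that there is none yet.
\<close>

definition cell_addr :: "nat \<Rightarrow> nat \<Rightarrow> nat \<Rightarrow> nat \<Rightarrow> instr list" where
  "cell_addr d i j k = [Arith Mul d i 5, Arith Add d d j, Arith Mul d d 6, Arith Add d d k,
     Arith Mul d d 7, Arith Add d d 8]"

definition take_candidate :: com where
  "take_candidate = Block [Move 31 37, Move 32 23, Move 33 27, Move 34 30]"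

text \<open>The two outer tests are the capacity conditions of \<open>choices\<close>: neither
  subtree may be asked for more level-1 nodes than it has keys. The other conditions follow from the
  loop bounds.\<close>

definition try_candidate :: com where
  "try_candidate =
     IfLe 30 24
       (Block [Arith Sub 35 28 30, Arith Sub 36 18 23] ;;
        IfLe 35 36
          (Block (cell_addr 37 15 26 30 @ Load 37 37 # cell_addr 38 23 18 35 @
             [Load 38 38, Arith Add 37 37 38, Arith Add 37 37 29]) ;;
           IfLe 32 1 take_candidate (IfLe 31 37 (Block []) take_candidate))
          (Block []))
       (Block [])"

definition try_level :: com where
  "try_level =
     Block [Arith Sub 28 22 27, Arith Mul 29 27 10, Arith Add 29 29 9, Arith Mul 29 29 25, Const 30 0] ;;
     WhileLe 30 28 (try_candidate ;; Block [Arith Add 30 30 2])"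

definition try_root :: com where
  "try_root =
     Block [Arith Sub 26 23 2, Arith Sub 24 26 15, Move 25 17] ;;
     IfLe 24 1 (Block [Arith Add 25 25 16]) (Block []) ;;
     IfLe 18 23 (Block [Arith Add 25 25 19]) (Block []) ;;
     Block [Const 27 0] ;;
     WhileLe 27 2 (try_level ;; Block [Arith Add 27 27 2])"

definition fill_cell :: com where
  "fill_cell =
     Block [Const 32 0, Move 23 20] ;;
     WhileLe 23 21 (try_root ;; Block [Arith Add 23 23 2]) ;;
     Block (cell_addr 35 15 18 22 @ [Store 35 31, Arith Add 35 35 2, Store 35 32,
       Arith Add 35 35 2, Store 35 33, Arith Add 35 35 2, Store 35 34])"

definition root_range :: com where
  "root_range =
     Block [Arith Add 20 15 2, Move 21 18] ;;
     IfLe 4 1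
       (IfLe 18 20 (Block [])
         (Block (Arith Sub 35 18 2 # Arith Add 36 15 2 # cell_addr 37 15 35 1 @
            Arith Add 37 37 2 # Load 20 37 # cell_addr 37 36 18 1 @ [Arith Add 37 37 2, Load 21 37])))
       (Block [])"

definition fill_interval :: com where
  "fill_interval =
     Block [Arith Add 35 13 18, Load 19 35, Arith Add 35 14 18, Load 35 35,
       Arith Add 17 17 35, Arith Add 17 17 19] ;;
     root_range ;;
     Block [Const 22 0] ;;
     WhileLe 22 4 (fill_cell ;; Block [Arith Add 22 22 2])"

definition fill_row :: com where
  "fill_row =
     Block [Arith Add 35 13 15, Load 16 35, Move 17 16, Arith Add 18 15 2] ;;
     WhileLe 18 3 (fill_interval ;; Block [Arith Add 18 18 2])"

text \<open>\<open>i\<close> descends while \<open>j\<close> ascends in each row, so that all proper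
  subintervals of \<open>(i, j)\<close> are ready and \<open>W i j\<close> grows by one key and one
  external node at a time.\<close>

definition fill_table :: com where
  "fill_table = Block [Arith Sub 15 3 2] ;; WhileLe 1 15 (fill_row ;; Block [Arith Sub 15 15 2])"

section \<open>Correctness of the dynamic program\<close>

text \<open>Otherwise the literal \<open>1\<close> naming a register becomes \<open>Suc 0\<close>.\<close>

declare One_nat_def [simp del]

text \<open>Discharges the address conditions of \<open>exec_block\<close> when an address is
  obtained by adding a constant to a known one.\<close>

lemma real_eq_real_simps [simp]:
  "real a + 1 = real b \<longleftrightarrow> b = a + 1"
  "real a + numeral v = real b \<longleftrightarrow> b = a + numeral v"
  "1 + real a = real b \<longleftrightarrow> b = a + 1"
  "numeral v + real a = real b \<longleftrightarrow> b = a + numeral v"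
  by (metis of_nat_1 of_nat_numeral of_nat_add of_nat_eq_iff add.commute)+

lemma ok_Block_Seq:
  assumes "exec_block is s (\<lambda>s'. ok d s' tb Q)" "length is + tb \<le> t"
  shows "ok (Block is ;; d) s t Q"
  using ok_Seq[OF ok_Block[OF assms(1) order_refl] _ assms(2)] by simp

lemma ok_Seq_eq: "ok c s ta (\<lambda>s'. s' = s1) \<Longrightarrow> ok d s1 tb Q \<Longrightarrow> ta + tb \<le> t \<Longrightarrow> ok (c ;; d) s t Q"
  by (rule ok_Seq[where P = "\<lambda>s'. s' = s1"]) auto

text \<open>Registers are numbered by loop nesting, outer variables first; the frame condition of a
  program part is then a mere bound on register numbers.\<close>

definition agree :: "nat \<Rightarrow> (nat \<Rightarrow> real) \<Rightarrow> (nat \<Rightarrow> real) \<Rightarrow> bool" where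
  "agree a R R' \<longleftrightarrow> (\<forall>x<a. R' x = R x)"

lemma agree_refl [simp]: "agree a R R"
  by (simp add: agree_def)

lemma agree_trans: "agree a R R' \<Longrightarrow> agree b R' R'' \<Longrightarrow> a \<le> b \<Longrightarrow> agree a R R''"
  by (simp add: agree_def)

lemma agree_upd [simp]: "a \<le> x \<Longrightarrow> agree a R (R'(x := v)) \<longleftrightarrow> agree a R R'"
  by (auto simp: agree_def)

locale two_level =
  fixes m1 m2 c1 c2 :: nat and p q :: "nat \<Rightarrow> real"
  assumes valid: "valid_instance m1 m2 c1 c2 p q"
begin

definition n where "n = m1 + m2"
definition m where "m = min m1 m2"
definition \<mu> :: "nat \<Rightarrow> real" where "\<mu> l = real (if (l = 1) = (m1 \<le> m2) then c1 else c2)"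

sublocale recurrence p q \<mu> .

lemma n_pos: "1 \<le> n" and p_nonneg: "\<And>t. t \<in> {1..n} \<Longrightarrow> 0 \<le> p t" and q_nonneg: "\<And>t. t \<le> n \<Longrightarrow> 0 \<le> q t"
  using valid by (auto simp: valid_instance_def Let_def n_def)

lemma \<mu>_nonneg: "0 \<le> \<mu> l"
  by (simp add: \<mu>_def)

text \<open>Mixed-radix index with four fields per entry: value, root, level and left count. The
  input fills the addresses below \<open>5 + 2 * n\<close> and the output those from there to
  \<open>5 + 5 * n\<close>, hence the offset.\<close>

definition cell :: "nat \<Rightarrow> nat \<Rightarrow> nat \<Rightarrow> nat" where
  "cell i j k = ((i * (n + 1) + j) * (m + 1) + k) * 4 + (6 + 5 * n)"

lemma mixed_radix_inj: "a * b + x = a' * b + x' \<Longrightarrow> x < b \<Longrightarrow> x' < b \<Longrightarrow> a = a' \<and> x = x'" for a b :: nat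
  by (metis add.commute div_mult_self1_is_m div_mult_self2 add_cancel_right_left div_less mod_mult_self2 mod_less
      less_nat_zero_code neq0_conv mult.commute div_mult_self3)

lemma cell_inj:
  assumes "cell i j k + f = cell i' j' k' + f'" "f < 4" "f' < 4" "k \<le> m" "k' \<le> m" "j \<le> n" "j' \<le> n"
  shows "i = i' \<and> j = j' \<and> k = k' \<and> f = f'"
proof -
  have "((i * (n + 1) + j) * (m + 1) + k) * 4 + f = ((i' * (n + 1) + j') * (m + 1) + k') * 4 + f'"
    using assms(1) by (simp add: cell_def)
  from mixed_radix_inj[OF this assms(2,3)]
  have "(i * (n + 1) + j) * (m + 1) + k = (i' * (n + 1) + j') * (m + 1) + k'" and f: "f = f'" by auto
  from mixed_radix_inj[OF this(1)] assms have "i * (n + 1) + j = i' * (n + 1) + j'" and k: "k = k'" by auto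
  from mixed_radix_inj[OF this(1)] assms f k show ?thesis by auto
qed

definition constants :: "(nat \<Rightarrow> real) \<Rightarrow> bool" where
  "constants R \<longleftrightarrow> R 0 = real (5 + 2 * n) \<and> R 1 = 0 \<and> R 2 = 1 \<and> R 3 = real n \<and> R 4 = real m \<and>
     R 5 = real (n + 1) \<and> R 6 = real (m + 1) \<and> R 7 = 4 \<and> R 8 = real (6 + 5 * n) \<and>
     R 9 = \<mu> 0 \<and> R 10 = \<mu> 1 - \<mu> 0 \<and> R 13 = real (4 + n) \<and> R 14 = 3"

lemma constants_agree: "constants R \<Longrightarrow> agree a R R' \<Longrightarrow> 15 \<le> a \<Longrightarrow> constants R'"
  by (simp add: constants_def agree_def)

lemma exec_cell_addr:
  assumes "constants R" "R a = real i" "R b = real j" "R c = real k" "d \<notin> {a, b, c}" "d > 14"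
  shows "exec_block (cell_addr d a b c @ is) (R, M) Q = exec_block is (R(d := real (cell i j k)), M) Q"
  using assms by (simp add: cell_addr_def constants_def cell_def algebra_simps)

lemma length_cell_addr [simp]: "length (cell_addr d a b c) = 6"
  by (simp add: cell_addr_def)

text \<open>For an empty interval zero memory is right: value 0 and null pointer. Nothing is
  demanded for \<open>k > j - i\<close>; the capacity tests keep such entries from being read as
  candidates.\<close>

definition table_entry :: "(nat \<Rightarrow> real) \<Rightarrow> nat \<Rightarrow> nat \<Rightarrow> nat \<Rightarrow> bool" where
  "table_entry M i j k \<longleftrightarrow>
     (if i = j then k = 0 \<longrightarrow> M (cell i j k) = 0 \<and> M (cell i j k + 1) = 0
      else k \<le> j - i \<longrightarrow> (\<exists>r l c. first_best i j k (choices i j k) (r, l, c) \<and>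
        M (cell i j k) = opt i j k \<and> M (cell i j k + 1) = real r \<and>
        M (cell i j k + 2) = real l \<and> M (cell i j k + 3) = real c))"

lemma table_entry_opt: "table_entry M i j k \<Longrightarrow> i \<le> j \<Longrightarrow> k \<le> j - i \<Longrightarrow> M (cell i j k) = opt i j k"
  by (auto simp: table_entry_def split: if_splits)

definition at_interval :: "(nat \<Rightarrow> real) \<Rightarrow> nat \<Rightarrow> nat \<Rightarrow> bool" where
  "at_interval R i j \<longleftrightarrow> constants R \<and> R 15 = real i \<and> R 16 = q i \<and> R 17 = W i j \<and> R 18 = real j \<and>
     R 19 = q j \<and> i < j \<and> j \<le> n"

lemma at_interval_agree: "at_interval R i j \<Longrightarrow> agree a R R' \<Longrightarrow> 20 \<le> a \<Longrightarrow> at_interval R' i j"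
  using constants_agree[of R a R'] by (simp add: at_interval_def agree_def)

definition sub_entries :: "(nat \<Rightarrow> real) \<Rightarrow> nat \<Rightarrow> nat \<Rightarrow> bool" where
  "sub_entries M i j \<longleftrightarrow> (\<forall>r k. i < r \<and> r \<le> j \<and> k \<le> m \<longrightarrow> table_entry M i (r - 1) k \<and> table_entry M r j k)"

definition best_of :: "nat \<Rightarrow> nat \<Rightarrow> nat \<Rightarrow> (nat \<times> nat \<times> nat) set \<Rightarrow> (nat \<Rightarrow> real) \<Rightarrow> bool" where
  "best_of i j k X R \<longleftrightarrow> (X = {} \<and> R 32 = 0) \<or>
     (\<exists>r l c. first_best i j k X (r, l, c) \<and> R 31 = val i j k (r, l, c) \<and>
        R 32 = real r \<and> R 33 = real l \<and> R 34 = real c)"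

text \<open>The admissible candidates already tried when the three nested loops stand at
  \<open>(r, l, c)\<close>, given that the roots start at \<open>lo\<close>. The lemmas that follow
  advance these counters.\<close>

definition before :: "nat \<Rightarrow> nat \<Rightarrow> nat \<Rightarrow> nat \<Rightarrow> nat \<Rightarrow> nat \<Rightarrow> nat \<Rightarrow> (nat \<times> nat \<times> nat) set" where
  "before i j k lo r l c = {(r', l', c') \<in> choices i j k.
     lo \<le> r' \<and> (r' < r \<or> r' = r \<and> (l' < l \<or> l' = l \<and> c' < c))}"

lemma before_step: "lo \<le> r \<Longrightarrow> before i j k lo r l (Suc c) = before i j k lo r l c \<union> {(r, l, c)} \<inter> choices i j k"
  by (auto simp: before_def)

lemma before_end_c: "before i j k lo r l (k + 1 - l) = before i j k lo r (Suc l) 0"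
  by (auto simp: before_def choices_def)

lemma before_end_l: "before i j k lo r 2 0 = before i j k lo (Suc r) 0 0"
  by (auto simp: before_def choices_def)

lemma before_start: "before i j k lo lo 0 0 = {}"
  by (auto simp: before_def)

lemma fst_before: "x \<in> before i j k lo r l c \<Longrightarrow> fst x \<le> r"
  by (auto simp: before_def)

lemma before_choices: "before i j k lo r l c \<subseteq> choices i j k"
  by (auto simp: before_def)

lemma best_of_agree: "best_of i j k X R \<Longrightarrow> agree a R R' \<Longrightarrow> 35 \<le> a \<Longrightarrow> best_of i j k X R'"
  by (simp add: best_of_def agree_def)

definition at_candidate :: "(nat \<Rightarrow> real) \<Rightarrow> nat \<Rightarrow> nat \<Rightarrow> nat \<Rightarrow> nat \<Rightarrow> bool" where
  "at_candidate R i j k r \<longleftrightarrow> at_interval R i j \<and> k \<le> m \<and> i < r \<and> r \<le> j \<and> R 22 = real k \<and> R 23 = real r \<and>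
     R 24 = real (r - 1 - i) \<and> R 25 = node_weight i j r \<and> R 26 = real (r - 1)"

lemma try_candidate:
  assumes at: "at_candidate R i j k r" and sub: "sub_entries M i j"
    and R: "R 27 = real l" "R 28 = real k - real l" "R 29 = \<mu> l * node_weight i j r" "R 30 = real c"
    and l: "l \<le> 1" "l + c \<le> k"
    and X: "best_of i j k X R" "X \<subseteq> choices i j k" "\<forall>z\<in>X. fst z \<le> r"
  shows "ok try_candidate (R, M) 30
    (\<lambda>(R', M'). M' = M \<and> agree 31 R R' \<and> best_of i j k (X \<union> {(r, l, c)} \<inter> choices i j k) R')"
proof -
  have b: "constants R" "R 15 = real i" "R 18 = real j" "k \<le> m" "i < r" "r \<le> j" "j \<le> n"
    "R 22 = real k" "R 23 = real r" "R 24 = real (r - 1 - i)" "R 26 = real (r - 1)"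
    using at by (auto simp: at_candidate_def at_interval_def)
  have ch: "(r, l, c) \<in> choices i j k \<longleftrightarrow> c \<le> r - 1 - i \<and> k - l - c \<le> j - r"
    using b l by (auto simp: choices_def)
  have k': "real k - real l - real c = real (k - l - c)" using l by simp
  have skip: "best_of i j k (X \<union> {(r, l, c)} \<inter> choices i j k) R"
    if "\<not> (c \<le> r - 1 - i \<and> k - l - c \<le> j - r)" using that X(1) ch by auto
  let ?v = "val i j k (r, l, c)"
  have eval: "ok (IfLe 32 1 take_candidate (IfLe 31 37 (Block []) take_candidate)) (R', M) 8
      (\<lambda>(R', M'). M' = M \<and> agree 31 R R' \<and> best_of i j k (X \<union> {(r, l, c)} \<inter> choices i j k) R')"
    if ch': "(r, l, c) \<in> choices i j k" and R': "agree 35 R R'" "R' 37 = ?v" for R'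
  proof -
    have e: "R' 1 = 0" "R' 23 = real r" "R' 27 = real l" "R' 30 = real c" "agree 31 R R'"
      using R' b R by (auto simp: agree_def constants_def)
    have best: "best_of i j k X R'" using best_of_agree[OF X(1) R'(1)] by simp
    have u: "X \<union> {(r, l, c)} \<inter> choices i j k = insert (r, l, c) X" using ch' by auto
    have new: "ok take_candidate (R', M) 4
        (\<lambda>(R', M'). M' = M \<and> agree 31 R R' \<and> best_of i j k (X \<union> {(r, l, c)} \<inter> choices i j k) R')"
      if "first_best i j k (insert (r, l, c) X) (r, l, c)"
      unfolding take_candidate_def u
      by (rule ok_Block) (use that e R'(2) in \<open>auto simp: best_of_def\<close>)
    show ?thesis
    proof (rule ok_IfLe[where ta = 6])
      assume "R' 32 \<le> R' 1"
      then have "R' 32 \<le> 0" using e by simp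
      \<comment> \<open>Roots of admissible choices are positive, so a zero in register 32 can only
        mean that there is no candidate yet.\<close>
      moreover have "(0, l', c') \<notin> X" for l' c'
        using X(2) by (auto simp: choices_def)
      ultimately have "X = {}" using best by (auto simp: best_of_def first_best_def)
      then show "ok take_candidate (R', M) 6
        (\<lambda>(R', M'). M' = M \<and> agree 31 R R' \<and> best_of i j k (X \<union> {(r, l, c)} \<inter> choices i j k) R')"
        using new by (auto simp: first_best_def elim: ok_mono)
    next
      assume "\<not> R' 32 \<le> R' 1"
      then have "R' 32 \<noteq> 0" using e by simp
      then obtain r' l' c' where f: "first_best i j k X (r', l', c')" "R' 31 = val i j k (r', l', c')"
        "R' 32 = real r'" "R' 33 = real l'" "R' 34 = real c'" using best by (auto simp: best_of_def)
      show "ok (IfLe 31 37 (Block []) take_candidate) (R', M) 6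
        (\<lambda>(R', M'). M' = M \<and> agree 31 R R' \<and> best_of i j k (X \<union> {(r, l, c)} \<inter> choices i j k) R')"
      proof (rule ok_IfLe[where ta = 4])
        assume "R' 31 \<le> R' 37"
        then have "first_best i j k (insert (r, l, c) X) (r', l', c')"
          using first_best_insert_keep[OF f(1)] f(2) R'(2) X(3) by simp
        then have "best_of i j k (X \<union> {(r, l, c)} \<inter> choices i j k) R'"
          unfolding u best_of_def using f by blast
        then show "ok (Block []) (R', M) 4
          (\<lambda>(R', M'). M' = M \<and> agree 31 R R' \<and> best_of i j k (X \<union> {(r, l, c)} \<inter> choices i j k) R')"
          using e by (intro ok_Block) auto
      next
        assume "\<not> R' 31 \<le> R' 37"
        then show "ok take_candidate (R', M) 4
          (\<lambda>(R', M'). M' = M \<and> agree 31 R R' \<and> best_of i j k (X \<union> {(r, l, c)} \<inter> choices i j k) R')"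
          using new first_best_insert_new[OF f(1)] f(2) R'(2) by simp
      qed simp
    qed simp
  qed
  show ?thesis unfolding try_candidate_def
  proof (rule ok_IfLe[where ta = 28])
    assume "\<not> R 30 \<le> R 24"
    then show "ok (Block []) (R, M) 28
      (\<lambda>(R', M'). M' = M \<and> agree 31 R R' \<and> best_of i j k (X \<union> {(r, l, c)} \<inter> choices i j k) R')"
      using skip b R by (intro ok_Block) auto
  next
    assume "R 30 \<le> R 24"
    then have c: "c \<le> r - 1 - i" using b R by simp
    let ?R = "R(35 := real (k - l - c), 36 := real (j - r))"
    have step: "ok (IfLe 35 36
      (Block (cell_addr 37 15 26 30 @ Load 37 37 # cell_addr 38 23 18 35 @
             [Load 38 38, Arith Add 37 37 38, Arith Add 37 37 29]) ;;
           IfLe 32 1 take_candidate (IfLe 31 37 (Block []) take_candidate))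
          (Block [])) (?R, M) 26
      (\<lambda>(R', M'). M' = M \<and> agree 31 R R' \<and> best_of i j k (X \<union> {(r, l, c)} \<inter> choices i j k) R')"
    proof (rule ok_IfLe[where ta = 24])
      assume "\<not> ?R 35 \<le> ?R 36"
      then show "ok (Block []) (?R, M) 24
        (\<lambda>(R', M'). M' = M \<and> agree 31 R R' \<and> best_of i j k (X \<union> {(r, l, c)} \<inter> choices i j k) R')"
        using skip best_of_agree[of _ _ _ _ R 35 ?R] by (intro ok_Block) auto
    next
      assume "?R 35 \<le> ?R 36"
      then have c': "k - l - c \<le> j - r" by simp
      have "table_entry M i (r - 1) c" "table_entry M r j (k - l - c)"
        using sub b l by (auto simp: sub_entries_def)
      then have M: "M (cell i (r - 1) c) = opt i (r - 1) c" "M (cell r j (k - l - c)) = opt r j (k - l - c)"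
        using c c' b table_entry_opt by auto
      have cR: "constants ?R" using constants_agree[OF b(1), of 35] by simp
      show "ok (Block (cell_addr 37 15 26 30 @ Load 37 37 # cell_addr 38 23 18 35 @
             [Load 38 38, Arith Add 37 37 38, Arith Add 37 37 29]) ;;
           IfLe 32 1 take_candidate (IfLe 31 37 (Block []) take_candidate)) (?R, M) 24
        (\<lambda>(R', M'). M' = M \<and> agree 31 R R' \<and> best_of i j k (X \<union> {(r, l, c)} \<inter> choices i j k) R')"
        apply (rule ok_Block_Seq[where tb = 8])
        apply (subst exec_cell_addr[where i = i and j = "r - 1" and k = c])
        apply (use cR b R in simp_all)
        apply (subst exec_cell_addr[where i = r and j = j and k = "k - l - c"])
        apply (use constants_agree[OF cR, of 37] b R in simp_all)
        apply (rule eval)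
        using c c' ch M R(3) by (auto simp: val_def)
    qed simp
    show "ok (Block [Arith Sub 35 28 30, Arith Sub 36 18 23] ;; IfLe 35 36
      (Block (cell_addr 37 15 26 30 @ Load 37 37 # cell_addr 38 23 18 35 @
             [Load 38 38, Arith Add 37 37 38, Arith Add 37 37 29]) ;;
           IfLe 32 1 take_candidate (IfLe 31 37 (Block []) take_candidate))
          (Block [])) (R, M) 28
      (\<lambda>(R', M'). M' = M \<and> agree 31 R R' \<and> best_of i j k (X \<union> {(r, l, c)} \<inter> choices i j k) R')"
      by (rule ok_Block_Seq[where tb = 26]) (use step b R k' in \<open>simp_all add: of_nat_diff\<close>)
  qed simp
qed

lemma at_candidate_agree: "at_candidate R i j k r \<Longrightarrow> agree a R R' \<Longrightarrow> 27 \<le> a \<Longrightarrow> at_candidate R' i j k r"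
  using at_interval_agree[of R i j a R'] by (simp add: at_candidate_def agree_def)

lemma try_level:
  assumes at: "at_candidate R i j k r" and sub: "sub_entries M i j" and R: "R 27 = real l"
    and l: "l \<le> 1" and lo: "lo \<le> r" and X: "best_of i j k (before i j k lo r l 0) R"
  shows "ok try_level (R, M) (40 * (m + 1))
    (\<lambda>(R', M'). M' = M \<and> agree 28 R R' \<and> best_of i j k (before i j k lo r (Suc l) 0) R')"
proof -
  have b: "R 9 = \<mu> 0" "R 10 = \<mu> 1 - \<mu> 0" "R 22 = real k" "R 25 = node_weight i j r" "R 2 = 1" "k \<le> m"
    using at by (auto simp: at_candidate_def at_interval_def constants_def)
  \<comment> \<open>Interpolation between the two prices replaces a branch on the level; this is why
    register 10 holds the difference.\<close>
  have \<mu>: "real l * (\<mu> 1 - \<mu> 0) + \<mu> 0 = \<mu> l"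
  proof -
    have "l = 0 \<or> l = 1" using l by linarith
    then show ?thesis by auto
  qed
  let ?R = "R(28 := real k - real l, 29 := \<mu> l * node_weight i j r, 30 := 0)"
  let ?Q = "\<lambda>(R', M'). M' = M \<and> agree 28 R R' \<and> best_of i j k (before i j k lo r (Suc l) 0) R'"
  have "ok (WhileLe 30 28 (try_candidate ;; Block [Arith Add 30 30 2])) (?R, M) (33 * (k + 1 - l) + 2) ?Q"
  proof (rule ok_WhileLe[where N = "k + 1 - l" and T = "\<lambda>_. 31" and
      I = "\<lambda>c (R', M'). M' = M \<and> agree 30 ?R R' \<and> R' 30 = real c \<and> best_of i j k (before i j k lo r l c) R'"])
    fix c R' M' assume I: "case (R', M') of (R', M') \<Rightarrow> M' = M \<and> agree 30 ?R R' \<and> R' 30 = real c \<and>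
      best_of i j k (before i j k lo r l c) R'" and c: "c < k + 1 - l"
    have M': "M' = M" using I by simp
    have ag: "agree 28 R R'" and R': "R' 27 = real l" "R' 28 = real k - real l"
      "R' 29 = \<mu> l * node_weight i j r" "R' 30 = real c" "R' 2 = 1"
      using I R b by (auto simp: agree_def)
    have at': "at_candidate R' i j k r" using at_candidate_agree[OF at ag] by simp
    have "ok (try_candidate ;; Block [Arith Add 30 30 2]) (R', M) 31
      (\<lambda>(R'', M'). M' = M \<and> agree 30 R' R'' \<and> R'' 30 = real (Suc c) \<and>
        best_of i j k (before i j k lo r l (Suc c)) R'')"
    proof (rule ok_Seq)
      show "ok try_candidate (R', M) 30 (\<lambda>(R'', M'). M' = M \<and> agree 31 R' R'' \<and>
          best_of i j k (before i j k lo r l c \<union> {(r, l, c)} \<inter> choices i j k) R'')"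
        using I c l by (intro try_candidate[OF at' sub R'(1-4)] before_choices) (auto dest: fst_before)
      show "ok (Block [Arith Add 30 30 2]) (R'', M'') 1
        (\<lambda>(R'', M'). M' = M \<and> agree 30 R' R'' \<and> R'' 30 = real (Suc c) \<and>
          best_of i j k (before i j k lo r l (Suc c)) R'')"
        if "case (R'', M'') of (R'', M') \<Rightarrow> M' = M \<and> agree 31 R' R'' \<and>
          best_of i j k (before i j k lo r l c \<union> {(r, l, c)} \<inter> choices i j k) R''" for R'' M''
        using that R' by (intro ok_Block) (auto simp: before_step[OF lo] best_of_def agree_def)
    qed simp
    then have "ok (try_candidate ;; Block [Arith Add 30 30 2]) (R', M') 31
      (\<lambda>(R', M'). M' = M \<and> agree 30 ?R R' \<and> R' 30 = real (Suc c) \<and>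
        best_of i j k (before i j k lo r l (Suc c)) R')"
      unfolding M' using I by (elim ok_mono) (auto intro: agree_trans)
    moreover have "R' 30 \<le> R' 28" using R' c by linarith
    ultimately show "R' 30 \<le> R' 28 \<and> ok (try_candidate ;; Block [Arith Add 30 30 2]) (R', M') 31
      (\<lambda>(R', M'). M' = M \<and> agree 30 ?R R' \<and> R' 30 = real (Suc c) \<and>
        best_of i j k (before i j k lo r l (Suc c)) R')" by blast
  next
    fix R' M' assume "case (R', M') of (R', M') \<Rightarrow> M' = M \<and> agree 30 ?R R' \<and> R' 30 = real (k + 1 - l) \<and>
      best_of i j k (before i j k lo r l (k + 1 - l)) R'"
    then show "\<not> R' 30 \<le> R' 28 \<and> ?Q (R', M')"
      \<comment> \<open>The case \<open>l > k\<close> means \<open>l = 1\<close> and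
        \<open>k = 0\<close>. Register 28 then holds -1, and the loop makes no round, in accordance
        with the truncated \<open>k + 1 - l\<close>.\<close>
      using before_end_c[of i j k lo r l] by (cases "l \<le> k") (auto simp: agree_def)
  next
    show "case (?R, M) of (R', M') \<Rightarrow> M' = M \<and> agree 30 ?R R' \<and> R' 30 = real 0 \<and>
      best_of i j k (before i j k lo r l 0) R'"
      using X by (simp add: best_of_def)
  qed simp
  then have "ok (WhileLe 30 28 (try_candidate ;; Block [Arith Add 30 30 2])) (?R, M) (33 * (m + 1) + 2) ?Q"
    by (rule ok_mono) (use b in auto)
  then show ?thesis unfolding try_level_def
    by (intro ok_Block_Seq[where tb = "33 * (m + 1) + 2"]) (use b R \<mu> in \<open>simp_all add: add.commute\<close>)
qed

text \<open>Time: a candidate costs 30 + 1 + 2, hence a level 33(m+1) + 7, rounded up to 40(m+1);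
  two levels and the tests for empty children give 80(m+1) + 18, at most 98(m+1).\<close>

lemma try_root:
  assumes at: "at_interval R i j" and k: "k \<le> m" "R 22 = real k" and r: "i < r" "r \<le> j" "R 23 = real r"
    and sub: "sub_entries M i j" and lo: "lo \<le> r" and X: "best_of i j k (before i j k lo r 0 0) R"
  shows "ok try_root (R, M) (98 * (m + 1))
    (\<lambda>(R', M'). M' = M \<and> agree 24 R R' \<and> best_of i j k (before i j k lo (Suc r) 0 0) R')"
    (is "ok _ _ _ ?Q")
proof -
  have b: "constants R" "R 15 = real i" "R 16 = q i" "R 17 = W i j" "R 18 = real j" "R 19 = q j"
    "R 2 = 1" "R 1 = 0"
    using at by (auto simp: at_interval_def constants_def)
  let ?w1 = "W i j + (if r = i + 1 then q i else 0)"
  let ?R1 = "R(26 := real (r - 1), 24 := real (r - 1 - i), 25 := W i j)"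
  let ?R2 = "?R1(25 := ?w1)"
  let ?R3 = "?R1(25 := node_weight i j r)"
  let ?R4 = "?R3(27 := 0)"
  let ?I = "\<lambda>l (R', M'). M' = M \<and> agree 27 ?R4 R' \<and> R' 27 = real l \<and>
    best_of i j k (before i j k lo r l 0) R'"
  have at4: "at_candidate ?R4 i j k r"
    using at_interval_agree[OF at, of 20 ?R4] k r by (simp add: at_candidate_def)
  have loop: "ok (WhileLe 27 2 (try_level ;; Block [Arith Add 27 27 2])) (?R4, M) (2 * (40 * (m + 1) + 3) + 2) ?Q"
  proof (rule ok_WhileLe[where N = 2 and T = "\<lambda>_. 40 * (m + 1) + 1" and I = ?I])
    fix l R' M' assume I: "?I l (R', M')" and l: "l < 2"
    have M': "M' = M" using I by simp
    have R': "R' 2 = 1" using I b by (simp add: agree_def)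
    have "ok (try_level ;; Block [Arith Add 27 27 2]) (R', M) (40 * (m + 1) + 1) (?I (Suc l))"
    proof (rule ok_Seq)
      show "ok try_level (R', M) (40 * (m + 1)) (\<lambda>(R'', M'). M' = M \<and> agree 28 R' R'' \<and>
          best_of i j k (before i j k lo r (Suc l) 0) R'')"
        using I l lo by (intro try_level at_candidate_agree[OF at4] sub) auto
      show "ok (Block [Arith Add 27 27 2]) (R'', M'') 1 (?I (Suc l))"
        if "case (R'', M'') of (R'', M') \<Rightarrow> M' = M \<and> agree 28 R' R'' \<and>
          best_of i j k (before i j k lo r (Suc l) 0) R''" for R'' M''
        using that R' I by (intro ok_Block) (auto simp: best_of_def agree_def)
    qed simp
    then show "R' 27 \<le> R' 2 \<and> ok (try_level ;; Block [Arith Add 27 27 2]) (R', M')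
      (40 * (m + 1) + 1) (?I (Suc l))"
      unfolding M' using I R' l by simp
  next
    fix R' M' assume "?I 2 (R', M')"
    then show "\<not> R' 27 \<le> R' 2 \<and> ?Q (R', M')"
      using b by (auto simp: agree_def before_end_l)
  next
    show "?I 0 (?R4, M)" using X by (simp add: best_of_def)
  qed simp
  have 1: "ok (Block [Const 27 0] ;; WhileLe 27 2 (try_level ;; Block [Arith Add 27 27 2])) (?R3, M)
      (80 * (m + 1) + 9) ?Q"
    by (rule ok_Block_Seq[where tb = "2 * (40 * (m + 1) + 3) + 2"]) (use loop in simp_all)
  have 2: "ok (IfLe 18 23 (Block [Arith Add 25 25 19]) (Block [])) (?R2, M) 3 (\<lambda>s. s = (?R3, M))"
    by (rule ok_IfLe[where ta = 1]) (use b r in \<open>auto simp: node_weight_def intro!: ok_Block\<close>)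
  have 3: "ok (IfLe 18 23 (Block [Arith Add 25 25 19]) (Block []) ;;
      Block [Const 27 0] ;; WhileLe 27 2 (try_level ;; Block [Arith Add 27 27 2])) (?R2, M)
      (80 * (m + 1) + 12) ?Q"
    by (rule ok_Seq_eq[OF 2 1]) simp
  have 4: "ok (IfLe 24 1 (Block [Arith Add 25 25 16]) (Block [])) (?R1, M) 3 (\<lambda>s. s = (?R2, M))"
    by (rule ok_IfLe[where ta = 1]) (use b r in \<open>auto intro!: ok_Block\<close>)
  have "ok (IfLe 24 1 (Block [Arith Add 25 25 16]) (Block []) ;;
      IfLe 18 23 (Block [Arith Add 25 25 19]) (Block []) ;;
      Block [Const 27 0] ;; WhileLe 27 2 (try_level ;; Block [Arith Add 27 27 2])) (?R1, M)
      (80 * (m + 1) + 15) ?Q"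
    by (rule ok_Seq_eq[OF 4 3]) simp
  then show ?thesis unfolding try_root_def
    by (intro ok_Block_Seq[where tb = "80 * (m + 1) + 15"]) (use b r in \<open>simp_all add: of_nat_diff diff_diff_eq\<close>)
qed

section \<open>Range of the roots tried, and filling one interval\<close>

definition min_root :: "nat \<Rightarrow> nat \<Rightarrow> nat" where
  "min_root i j = (if m = 0 \<and> i + 1 < j then first_root i (j - 1) else i + 1)"

definition max_root :: "nat \<Rightarrow> nat \<Rightarrow> nat" where
  "max_root i j = (if m = 0 \<and> i + 1 < j then first_root (i + 1) j else j)"

lemma root_bounds:
  assumes "i < j" "j \<le> n"
  shows "i < min_root i j" "max_root i j \<le> j" "min_root i j \<le> max_root i j"
  using assms first_root[of i "j - 1"] first_root[of "i + 1" j]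
    first_root_mono[of n i j, OF p_nonneg q_nonneg \<mu>_nonneg]
  by (auto simp: min_root_def max_root_def intro: order_trans)

text \<open>For \<open>m = 0\<close> the range contains the least optimal root by monotonicity. A
  first best choice within the range thus has the optimal value and a root no larger than the least
  optimal one, so it is first best among all choices.\<close>

lemma choices_in_root_bounds:
  assumes "i < j" "j \<le> n" "k \<le> m"
  shows "first_best i j k (before i j k (min_root i j) (Suc (max_root i j)) 0 0) x \<Longrightarrow>
      first_best i j k (choices i j k) x"
    and "k \<le> j - i \<Longrightarrow> before i j k (min_root i j) (Suc (max_root i j)) 0 0 \<noteq> {}"
proof -
  let ?X = "before i j k (min_root i j) (Suc (max_root i j)) 0 0"
  have X: "?X = {x \<in> choices i j k. min_root i j \<le> fst x \<and> fst x \<le> max_root i j}"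
    by (auto simp: before_def)
  show "first_best i j k (choices i j k) x" if f: "first_best i j k ?X x"
  proof (cases "m = 0 \<and> i + 1 < j")
    case False
    then have "?X = choices i j k" unfolding X
      by (auto simp: choices_def min_root_def max_root_def)
    with f show ?thesis by simp
  next
    case True
    then have k: "k = 0" using assms by simp
    let ?r = "(first_root i j, 0, 0)"
    have "?r \<in> ?X" unfolding X
      using True k first_root[OF assms(1)] first_root_mono[of n i j, OF p_nonneg q_nonneg \<mu>_nonneg] assms
      by (auto simp: choices_0 min_root_def max_root_def)
    then have v: "val i j k x \<le> opt i j k"
      using f first_root(3)[OF assms(1)] k by (fastforce simp: first_best_def)
    have x: "x \<in> choices i j k" using f by (auto simp: first_best_def X)
    then have e: "val i j k x = opt i j k" using v opt_le[of x i j k] by simp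
    have le: "fst x \<le> first_root i j"
      using f \<open>?r \<in> ?X\<close> e first_root(3)[OF assms(1)] k by (fastforce simp: first_best_def)
    have "fst x \<le> fst y" if "y \<in> choices i j k" "val i j k y = opt i j k" for y
      using that le first_root_least[OF assms(1), of "fst y"] k by (fastforce simp: choices_0)
    then show ?thesis using x e opt_le by (auto simp: first_best_def)
  qed
  show "?X \<noteq> {}" if k': "k \<le> j - i"
  proof (cases "m = 0 \<and> i + 1 < j")
    case False
    then have "?X = choices i j k" unfolding X
      by (auto simp: choices_def min_root_def max_root_def)
    then show ?thesis using choices_nonempty[OF assms(1) k'] by simp
  next
    case True
    then have "(first_root i j, 0, 0) \<in> ?X" unfolding X
      using assms first_root[OF assms(1)] first_root_mono[of n i j, OF p_nonneg q_nonneg \<mu>_nonneg]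
      by (auto simp: choices_0 min_root_def max_root_def)
    then show ?thesis by blast
  qed
qed

definition same_outside :: "nat \<Rightarrow> nat \<Rightarrow> (nat \<Rightarrow> real) \<Rightarrow> (nat \<Rightarrow> real) \<Rightarrow> bool" where
  "same_outside i j M M' \<longleftrightarrow> (\<forall>a. (\<forall>k\<le>m. \<forall>f<4. a \<noteq> cell i j k + f) \<longrightarrow> M' a = M a)"

lemma same_outside_refl [simp]: "same_outside i j M M"
  by (simp add: same_outside_def)

lemma same_outside_trans: "same_outside i j M M' \<Longrightarrow> same_outside i j M' M'' \<Longrightarrow> same_outside i j M M''"
  by (simp add: same_outside_def)

lemma table_entry_cong:
  assumes "\<And>f. f < 4 \<Longrightarrow> M' (cell i j k + f) = M (cell i j k + f)" "table_entry M i j k"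
  shows "table_entry M' i j k"
proof -
  have e: "M' (cell i j k) = M (cell i j k)" "M' (cell i j k + 1) = M (cell i j k + 1)"
    "M' (cell i j k + 2) = M (cell i j k + 2)" "M' (cell i j k + 3) = M (cell i j k + 3)"
    using assms(1)[of 0] assms(1)[of 1] assms(1)[of 2] assms(1)[of 3] by simp_all
  show ?thesis using assms(2) unfolding table_entry_def e .
qed

lemma table_entry_same_outside:
  assumes "same_outside i j M M'" "table_entry M i' j' k'" "(i', j') \<noteq> (i, j)" "j \<le> n" "j' \<le> n" "k' \<le> m"
  shows "table_entry M' i' j' k'"
proof (rule table_entry_cong[OF _ assms(2)])
  fix f :: nat assume "f < 4"
  then have "\<forall>k\<le>m. \<forall>g<4. cell i' j' k' + f \<noteq> cell i j k + g"
    using cell_inj assms(3-6) by blast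
  then show "M' (cell i' j' k' + f) = M (cell i' j' k' + f)" using assms(1) by (auto simp: same_outside_def)
qed

lemma sub_entries_same_outside:
  assumes "same_outside i j M M'" "sub_entries M i j" "j \<le> n"
  shows "sub_entries M' i j"
  unfolding sub_entries_def
proof (intro allI impI)
  fix r k assume "i < r \<and> r \<le> j \<and> k \<le> m"
  then show "table_entry M' i (r - 1) k \<and> table_entry M' r j k"
    using assms table_entry_same_outside[OF assms(1)] by (auto simp: sub_entries_def)
qed

lemma fill_cell:
  assumes at: "at_interval R i j" and k: "k \<le> m" "R 22 = real k" and sub: "sub_entries M i j"
    and lohi: "R 20 = real (min_root i j)" "R 21 = real (max_root i j)"
  shows "ok fill_cell (R, M) (101 * (m + 1) * (max_root i j + 1 - min_root i j) + 17)
    (\<lambda>(R', M'). agree 23 R R' \<and> same_outside i j M M' \<and> table_entry M' i j k \<and>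
      (\<forall>k'\<le>m. k' \<noteq> k \<longrightarrow> table_entry M i j k' \<longrightarrow> table_entry M' i j k'))"
    (is "ok _ _ _ ?Q")
proof -
  have b: "constants R" "R 15 = real i" "R 18 = real j" "i < j" "j \<le> n"
    using at by (auto simp: at_interval_def)
  note rb = root_bounds[OF b(4,5)]
  let ?lo = "min_root i j" and ?hi = "max_root i j"
  let ?R1 = "R(32 := 0, 23 := real ?lo)"
  let ?X = "before i j k ?lo (Suc ?hi) 0 0"
  let ?P = "\<lambda>(R', M'). M' = M \<and> agree 23 R R' \<and> best_of i j k ?X R'"
  let ?I = "\<lambda>v (R', M'). M' = M \<and> agree 23 R R' \<and> R' 23 = real (?lo + v) \<and>
     best_of i j k (before i j k ?lo (?lo + v) 0 0) R'"
  have loop: "ok (WhileLe 23 21 (try_root ;; Block [Arith Add 23 23 2])) (?R1, M)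
    (100 * (m + 1) * (?hi + 1 - ?lo) + (?hi + 1 - ?lo) + 2) ?P"
  proof (rule ok_WhileLe[where N = "?hi + 1 - ?lo" and T = "\<lambda>_. 98 * (m + 1) + 1" and I = ?I])
    fix v R' M' assume I: "?I v (R', M')" and v: "v < ?hi + 1 - ?lo"
    have M': "M' = M" and ag: "agree 23 R R'" using I by auto
    have R': "R' 2 = 1" "R' 21 = real ?hi" "R' 22 = real k" "R' 23 = real (?lo + v)"
      using I b(1) lohi k by (auto simp: agree_def constants_def)
    have "ok (try_root ;; Block [Arith Add 23 23 2]) (R', M) (98 * (m + 1) + 1) (?I (Suc v))"
    proof (rule ok_Seq)
      show "ok try_root (R', M) (98 * (m + 1)) (\<lambda>(R'', M'). M' = M \<and> agree 24 R' R'' \<and>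
          best_of i j k (before i j k ?lo (Suc (?lo + v)) 0 0) R'')"
        using I v rb R' k by (intro try_root at_interval_agree[OF at ag] sub) auto
      show "ok (Block [Arith Add 23 23 2]) (R'', M'') 1 (?I (Suc v))"
        if "case (R'', M'') of (R'', M') \<Rightarrow> M' = M \<and> agree 24 R' R'' \<and>
          best_of i j k (before i j k ?lo (Suc (?lo + v)) 0 0) R''" for R'' M''
        using that R' I by (intro ok_Block) (auto simp: best_of_def agree_def)
    qed simp
    moreover have "R' 23 \<le> R' 21" unfolding R' using v by simp
    ultimately show "R' 23 \<le> R' 21 \<and> ok (try_root ;; Block [Arith Add 23 23 2]) (R', M')
      (98 * (m + 1) + 1) (?I (Suc v))"
      unfolding M' by blast
  next
    fix R' M' assume I: "?I (?hi + 1 - ?lo) (R', M')"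
    have e: "?lo + (?hi + 1 - ?lo) = Suc ?hi" using rb by simp
    have "R' 21 = real ?hi" using I lohi by (simp add: agree_def)
    then show "\<not> R' 23 \<le> R' 21 \<and> ?P (R', M')"
      using I unfolding e by auto
  next
    show "?I 0 (?R1, M)" by (simp add: before_start best_of_def)
  next
    show "(\<Sum>v<?hi + 1 - ?lo. 98 * (m + 1) + 1 + 2) + 2 \<le> 100 * (m + 1) * (?hi + 1 - ?lo) + (?hi + 1 - ?lo) + 2"
      by (simp add: algebra_simps)
  qed
  let ?a = "cell i j k"
  let ?store = "cell_addr 35 15 18 22 @ [Store 35 31, Arith Add 35 35 2, Store 35 32,
       Arith Add 35 35 2, Store 35 33, Arith Add 35 35 2, Store 35 34]"
  have fin: "ok (Block ?store) (R', M') 13 ?Q" if P: "?P (R', M')" for R' M'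
  proof -
    have M': "M' = M" and ag: "agree 23 R R'" using P by auto
    have R': "constants R'" "R' 15 = real i" "R' 18 = real j" "R' 22 = real k" "R' 2 = 1"
      using ag b k constants_agree[OF b(1) ag] by (auto simp: agree_def constants_def)
    let ?M = "M(?a := R' 31, ?a + 1 := R' 32, ?a + 2 := R' 33, ?a + 3 := R' 34)"
    have "same_outside i j M ?M"
      unfolding same_outside_def
    proof (intro allI impI)
      fix x assume *: "\<forall>k\<le>m. \<forall>f<4. x \<noteq> cell i j k + f"
      have "x \<noteq> ?a + 0" "x \<noteq> ?a + 1" "x \<noteq> ?a + 2" "x \<noteq> ?a + 3"
        by (rule *[rule_format, OF k(1)]; simp)+
      then show "?M x = M x" by simp
    qed
    moreover have "table_entry ?M i j k"
    \<comment> \<open>For \<open>k > j - i\<close> no candidate exists and the stored fields are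
      meaningless, which \<open>table_entry\<close> permits.\<close>
    proof (cases "k \<le> j - i")
      case True
      from choices_in_root_bounds(2)[OF b(4,5) k(1) True] have "?X \<noteq> {}" .
      with P obtain r l c where f: "first_best i j k ?X (r, l, c)" "R' 31 = val i j k (r, l, c)"
        "R' 32 = real r" "R' 33 = real l" "R' 34 = real c" by (auto simp: best_of_def)
      from choices_in_root_bounds(1)[OF b(4,5) k(1) f(1)]
      have f': "first_best i j k (choices i j k) (r, l, c)" .
      from val_first_best[OF this] f f' b(4) show ?thesis
        unfolding table_entry_def by auto
    qed (use b in \<open>simp add: table_entry_def\<close>)
    moreover have "table_entry ?M i j k'" if "k' \<le> m" "k' \<noteq> k" "table_entry M i j k'" for k'
    proof (rule table_entry_cong[OF _ that(3)])
      fix f :: nat assume "f < 4"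
      then have "cell i j k' + f \<noteq> ?a + g" if "g < 4" for g
        using cell_inj[of i j k' f i j k g] that \<open>k' \<le> m\<close> \<open>k' \<noteq> k\<close> k(1) b by auto
      from this[of 0] this[of 1] this[of 2] this[of 3]
      show "?M (cell i j k' + f) = M (cell i j k' + f)" by simp
    qed
    ultimately show ?thesis unfolding M'
      apply (intro ok_Block)
       apply (subst exec_cell_addr[OF R'(1-4)])
         apply (use R' ag in \<open>simp_all add: agree_def\<close>)
      done
  qed
  have "ok (WhileLe 23 21 (try_root ;; Block [Arith Add 23 23 2]) ;; Block ?store) (?R1, M)
    (100 * (m + 1) * (?hi + 1 - ?lo) + (?hi + 1 - ?lo) + 15) ?Q"
    by (rule ok_Seq[OF loop fin]) auto
  moreover have time: "100 * (m + 1) * (?hi + 1 - ?lo) + (?hi + 1 - ?lo) \<le> 101 * (m + 1) * (?hi + 1 - ?lo)"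
  proof -
    have "1 * (?hi + 1 - ?lo) \<le> (m + 1) * (?hi + 1 - ?lo)" by (rule mult_right_mono) auto
    then show ?thesis unfolding mult.assoc by linarith
  qed
  ultimately show ?thesis unfolding fill_cell_def
  proof (intro ok_Block_Seq[where tb = "100 * (m + 1) * (?hi + 1 - ?lo) + (?hi + 1 - ?lo) + 15"])
    show "length [Const 32 0, Move 23 20] + (100 * (m + 1) * (?hi + 1 - ?lo) + (?hi + 1 - ?lo) + 15)
      \<le> 101 * (m + 1) * (?hi + 1 - ?lo) + 17" using time by simp
  qed (use lohi in simp)
qed

text \<open>Here the tie-breaking pays off: the stored root is precisely the one to which
  \<open>first_root_mono\<close> applies.\<close>

lemma table_entry_first_root:
  "table_entry M i j 0 \<Longrightarrow> i < j \<Longrightarrow> M (cell i j 0 + 1) = real (first_root i j)"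
  using first_best_first_root[of i j] by (fastforce simp: table_entry_def)

lemma root_range:
  assumes at: "at_interval R i j" and sub: "sub_entries M i j"
  shows "ok root_range (R, M) 24 (\<lambda>(R', M'). M' = M \<and> agree 20 R R' \<and>
    R' 20 = real (min_root i j) \<and> R' 21 = real (max_root i j))"
    (is "ok _ _ _ ?Q")
proof -
  have b: "constants R" "R 1 = real 0" "R 15 = real i" "R 18 = real j" "R 2 = 1" "R 4 = real m" "i < j" "j \<le> n"
    using at by (auto simp: at_interval_def constants_def)
  let ?R = "R(20 := real i + 1, 21 := real j)"
  let ?load = "Block (Arith Sub 35 18 2 # Arith Add 36 15 2 # cell_addr 37 15 35 1 @
            Arith Add 37 37 2 # Load 20 37 # cell_addr 37 36 18 1 @ [Arith Add 37 37 2, Load 21 37])"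
  have "ok (IfLe 4 1 (IfLe 18 20 (Block []) ?load) (Block [])) (?R, M) 22 ?Q"
  proof (rule ok_IfLe[where ta = 20])
    assume "\<not> ?R 4 \<le> ?R 1"
    then have "m \<noteq> 0" using b by simp
    then show "ok (Block []) (?R, M) 20 ?Q"
      by (intro ok_Block) (simp_all add: min_root_def max_root_def)
  next
    assume "?R 4 \<le> ?R 1"
    then have m: "m = 0" using b by simp
    show "ok (IfLe 18 20 (Block []) ?load) (?R, M) 20 ?Q"
    proof (rule ok_IfLe[where ta = 18])
      assume "?R 18 \<le> ?R 20"
      then have "\<not> i + 1 < j" using b by simp
      then show "ok (Block []) (?R, M) 18 ?Q"
        by (intro ok_Block) (simp_all add: min_root_def max_root_def)
    next
      assume "\<not> ?R 18 \<le> ?R 20"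
      then have ij: "i + 1 < j" using b by simp
      have c: "constants (?R(35 := real j - 1, 36 := real i + 1))"
        by (rule constants_agree[OF b(1), of 15]) simp_all
      let ?R' = "?R(35 := real j - 1, 36 := real i + 1, 37 := real (cell i (j - 1) 0 + 1),
        20 := real (min_root i j))"
      have c': "constants ?R'"
        by (rule constants_agree[OF b(1), of 15]) simp_all
      have "table_entry M i (j - 1) 0" "table_entry M (i + 1) j 0"
        using sub b ij by (auto simp: sub_entries_def)
      then have M: "M (cell i (j - 1) 0 + 1) = real (min_root i j)"
        "M (cell (i + 1) j 0 + 1) = real (max_root i j)"
        using table_entry_first_root ij m by (auto simp: min_root_def max_root_def)
      have fin: "exec_block (cell_addr 37 36 18 1 @ [Arith Add 37 37 2, Load 21 37]) (?R', M) ?Q"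
        by (subst exec_cell_addr[OF c', where i = "i + 1" and j = j and k = 0])
          (use b M in \<open>simp_all add: add_ac\<close>)
      show "ok ?load (?R, M) 18 ?Q"
        apply (rule ok_Block)
         apply (simp add: b del: of_nat_Suc)
         apply (subst exec_cell_addr[OF c, where i = i and j = "j - 1" and k = 0])
              apply (use b ij M fin in \<open>simp_all add: of_nat_diff add_ac\<close>)
        done
    qed simp
  qed simp
  then show ?thesis unfolding root_range_def
    by (intro ok_Block_Seq[where tb = 22]) (use b in simp_all)
qed

definition inputs :: "(nat \<Rightarrow> real) \<Rightarrow> bool" where
  "inputs M \<longleftrightarrow> (\<forall>t\<in>{1..n}. M (3 + t) = p t) \<and> (\<forall>t\<le>n. M (4 + n + t) = q t)"

lemma inputs_same_outside: "inputs M \<Longrightarrow> same_outside i j M M' \<Longrightarrow> inputs M'"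
proof -
  assume *: "inputs M" "same_outside i j M M'"
  have "M' a = M a" if "a < 6 + 5 * n" for a
    using *(2) that by (auto simp: same_outside_def cell_def)
  then show ?thesis using *(1) by (auto simp: inputs_def)
qed

lemma W_step: "i < j \<Longrightarrow> W i j = W i (j - 1) + p j + q j"
  by (cases j) (auto simp: W_def)

lemma fill_interval:
  assumes R: "constants R" "R 15 = real i" "R 16 = q i" "R 17 = W i (j - 1)" "R 18 = real j"
    and ij: "i < j" "j \<le> n" and sub: "sub_entries M i j" and inp: "inputs M"
  shows "ok fill_interval (R, M) (154 * (m + 1)\<^sup>2 * (max_root i j + 1 - min_root i j))
    (\<lambda>(R', M'). agree 17 R R' \<and> R' 17 = W i j \<and> R' 18 = real j \<and> same_outside i j M M' \<and>
      (\<forall>k\<le>m. table_entry M' i j k))"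
    (is "ok _ _ _ ?Q")
proof -
  define N where "N = max_root i j + 1 - min_root i j"
  have N: "1 \<le> N" using root_bounds[OF ij] by (simp add: N_def)
  have b: "R 13 = real (4 + n)" "R 14 = 3" "R 4 = real m" using R by (auto simp: constants_def)
  let ?R1 = "R(35 := p j, 19 := q j, 17 := W i j)"
  have at1: "at_interval ?R1 i j"
    using constants_agree[OF R(1), of 15 ?R1] R ij by (simp add: at_interval_def)
  let ?I = "\<lambda>v (R', M'). at_interval R' i j \<and> agree 17 R R' \<and> R' 20 = real (min_root i j) \<and>
    R' 21 = real (max_root i j) \<and> R' 22 = real v \<and> same_outside i j M M' \<and> (\<forall>k<v. table_entry M' i j k)"
  have loop: "ok (WhileLe 22 4 (fill_cell ;; Block [Arith Add 22 22 2])) s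
      ((m + 1) * (101 * (m + 1) * N + 20) + 2) ?Q" if "?I 0 s" for s
  proof (rule ok_WhileLe[where N = "m + 1" and T = "\<lambda>_. 101 * (m + 1) * N + 18" and I = ?I])
    fix v R' M' assume I: "?I v (R', M')" and v: "v < m + 1"
    have R': "R' 4 = real m" "R' 2 = 1" using I by (auto simp: at_interval_def constants_def)
    have "ok (fill_cell ;; Block [Arith Add 22 22 2]) (R', M') (101 * (m + 1) * N + 18) (?I (Suc v))"
    proof (rule ok_Seq)
      show "ok fill_cell (R', M') (101 * (m + 1) * N + 17)
        (\<lambda>(R'', M''). agree 23 R' R'' \<and> same_outside i j M' M'' \<and> table_entry M'' i j v \<and>
          (\<forall>k'\<le>m. k' \<noteq> v \<longrightarrow> table_entry M' i j k' \<longrightarrow> table_entry M'' i j k'))"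
        unfolding N_def using I v
        by (intro fill_cell) (auto intro: sub_entries_same_outside[OF _ sub ij(2)])
      show "ok (Block [Arith Add 22 22 2]) (R'', M'') 1 (?I (Suc v))"
        if "case (R'', M'') of (R'', M'') \<Rightarrow> agree 23 R' R'' \<and> same_outside i j M' M'' \<and> table_entry M'' i j v \<and>
          (\<forall>k'\<le>m. k' \<noteq> v \<longrightarrow> table_entry M' i j k' \<longrightarrow> table_entry M'' i j k')" for R'' M''
      proof -
        have *: "agree 23 R' R''" "same_outside i j M M''" using that I same_outside_trans by auto
        let ?R = "R''(22 := R'' 22 + R'' 2)"
        have "agree 22 R' ?R" using *(1) by (auto simp: agree_def)
        then have "at_interval ?R i j" "agree 17 R ?R"
          using at_interval_agree[of R' i j 22 ?R] agree_trans[of 17 R R' 22 ?R] I by auto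
        moreover have "\<forall>k<Suc v. table_entry M'' i j k" using that I v by (auto simp: less_Suc_eq)
        ultimately show ?thesis using *(2) I R' \<open>agree 22 R' ?R\<close> *(1)
          by (intro ok_Block) (auto simp: agree_def)
      qed
    qed simp
    then show "R' 22 \<le> R' 4 \<and> ok (fill_cell ;; Block [Arith Add 22 22 2]) (R', M')
      (101 * (m + 1) * N + 18) (?I (Suc v))"
      using I R' v by simp
  next
    fix R' M' assume "?I (m + 1) (R', M')"
    then show "\<not> R' 22 \<le> R' 4 \<and> ?Q (R', M')"
      by (auto simp: at_interval_def constants_def)
  next
    show "(\<Sum>v<m + 1. 101 * (m + 1) * N + 18 + 2) + 2 \<le> (m + 1) * (101 * (m + 1) * N + 20) + 2" by simp
  qed (fact that)
  have set0: "ok (Block [Const 22 0] ;; WhileLe 22 4 (fill_cell ;; Block [Arith Add 22 22 2])) (R', M')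
      ((m + 1) * (101 * (m + 1) * N + 20) + 3) ?Q"
    if "M' = M" "agree 20 ?R1 R'" "R' 20 = real (min_root i j)" "R' 21 = real (max_root i j)" for R' M'
  proof -
    let ?R = "R'(22 := 0)"
    have "agree 20 ?R1 ?R" using that by simp
    moreover from this have "agree 17 R ?R" by (auto simp: agree_def)
    ultimately have "?I 0 (?R, M')"
      using at_interval_agree[OF at1, of 20 ?R] that by simp
    from loop[OF this] show ?thesis by (intro ok_Block_Seq[where tb = "(m + 1) * (101 * (m + 1) * N + 20) + 2"]) simp_all
  qed
  have "ok (root_range ;; Block [Const 22 0] ;; WhileLe 22 4 (fill_cell ;; Block [Arith Add 22 22 2])) (?R1, M)
      (24 + ((m + 1) * (101 * (m + 1) * N + 20) + 3)) ?Q"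
    by (rule ok_Seq[OF root_range[OF at1 sub]]) (use set0 in auto)
  moreover have "M (4 + n + j) = q j" "M (3 + j) = p j" using inp ij by (auto simp: inputs_def)
  moreover have a: "R 13 + R 18 = real (4 + n + j)" "R 14 + R 18 = real (3 + j)"
    using R(5) b by simp_all
  \<comment> \<open>All lower-order terms are absorbed into the leading one, using that
    \<open>N\<close> and \<open>m + 1\<close> are at least 1: 154 = 101 + 20 + 33.\<close>
  moreover have "6 + (24 + ((m + 1) * (101 * (m + 1) * N + 20) + 3)) \<le> 154 * (m + 1)\<^sup>2 * N"
  proof -
    define a where "a = m + 1"
    have "1 * 1 \<le> a * N" using N by (intro mult_le_mono) (auto simp: a_def)
    moreover from this have "a * 1 \<le> a * (a * N)" by (intro mult_le_mono2) simp
    moreover have "1 \<le> a" by (simp add: a_def)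
    moreover have "6 + (24 + (a * (101 * a * N + 20) + 3)) = 101 * (a * (a * N)) + 20 * a + 33"
      by (simp add: algebra_simps)
    moreover have "154 * a\<^sup>2 * N = 154 * (a * (a * N))" by (simp add: power2_eq_square)
    ultimately show ?thesis unfolding a_def[symmetric] by linarith
  qed
  ultimately show ?thesis unfolding fill_interval_def N_def[symmetric]
    by (intro ok_Block_Seq[where tb = "24 + ((m + 1) * (101 * (m + 1) * N + 20) + 3)"])
      (use R(4) a W_step[OF ij(1)] in \<open>simp_all add: fun_upd_twist del: of_nat_add\<close>)
qed

text \<open>In the loop invariants \<open>S\<close> always includes \<open>Id\<close>: the empty
  intervals are correct from the start and are never written.\<close>

definition filled :: "(nat \<Rightarrow> real) \<Rightarrow> (nat \<times> nat) set \<Rightarrow> bool" where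
  "filled M S \<longleftrightarrow> (\<forall>(i, j)\<in>S. i \<le> j \<longrightarrow> j \<le> n \<longrightarrow> (\<forall>k\<le>m. table_entry M i j k))"

lemma filledD: "filled M S \<Longrightarrow> (i, j) \<in> S \<Longrightarrow> i \<le> j \<Longrightarrow> j \<le> n \<Longrightarrow> k \<le> m \<Longrightarrow> table_entry M i j k"
  by (auto simp: filled_def)

definition row_time :: "nat \<Rightarrow> nat" where
  "row_time i = 6 + (\<Sum>j=i+1..n. 154 * (m + 1)\<^sup>2 * (max_root i j + 1 - min_root i j) + 3)"

lemma fill_row:
  assumes R: "constants R" "R 15 = real i" and i: "i < n" and inp: "inputs M"
    and fl: "filled M ({(i', j'). i < i'} \<union> Id)"
  shows "ok fill_row (R, M) (row_time i)
    (\<lambda>(R', M'). agree 16 R R' \<and> inputs M' \<and> filled M' ({(i', j'). i \<le> i'} \<union> Id))"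
    (is "ok _ _ _ ?Q")
proof -
  let ?I = "\<lambda>v (R', M'). agree 16 R R' \<and> R' 16 = q i \<and> R' 17 = W i (i + v) \<and> R' 18 = real (i + 1 + v) \<and>
    inputs M' \<and> filled M' ({(i', j'). i < i' \<or> i' = i \<and> j' \<le> i + v} \<union> Id)"
  let ?T = "\<lambda>j. 154 * (m + 1)\<^sup>2 * (max_root i j + 1 - min_root i j)"
  let ?R = "R(35 := real (4 + n + i), 16 := q i, 17 := q i, 18 := real i + 1)"
  have b: "R 2 = 1" "R 3 = real n" "R 13 = real (4 + n)" using R by (auto simp: constants_def)
  have loop: "ok (WhileLe 18 3 (fill_interval ;; Block [Arith Add 18 18 2])) (?R, M)
      ((\<Sum>v<n - i. ?T (i + 1 + v) + 3) + 2) ?Q"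
  proof (rule ok_WhileLe[where N = "n - i" and T = "\<lambda>v. ?T (i + 1 + v) + 1" and I = ?I])
    fix v R' M' assume I: "?I v (R', M')" and v: "v < n - i"
    let ?j = "i + 1 + v"
    have R': "constants R'" "R' 15 = real i" "R' 2 = 1" "R' 3 = real n"
      using I R constants_agree[OF R(1), of 16 R'] by (auto simp: agree_def constants_def)
    have fl': "filled M' ({(i', j'). i < i' \<or> i' = i \<and> j' \<le> i + v} \<union> Id)" using I by simp
    have sub: "sub_entries M' i ?j" unfolding sub_entries_def
    proof (intro allI impI)
      show "table_entry M' i (r - 1) k \<and> table_entry M' r ?j k" if "i < r \<and> r \<le> ?j \<and> k \<le> m" for r k
      proof -
        have "r - 1 \<le> i + v" "i \<le> r - 1" "r - 1 \<le> n" using that v by linarith+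
        then show ?thesis
          using that v filledD[OF fl', of i "r - 1" k] filledD[OF fl', of r ?j k] by auto
      qed
    qed
    have "ok (fill_interval ;; Block [Arith Add 18 18 2]) (R', M') (?T ?j + 1) (?I (Suc v))"
    proof (rule ok_Seq)
      show "ok fill_interval (R', M') (?T ?j)
        (\<lambda>(R'', M''). agree 17 R' R'' \<and> R'' 17 = W i ?j \<and> R'' 18 = real ?j \<and> same_outside i ?j M' M'' \<and>
          (\<forall>k\<le>m. table_entry M'' i ?j k))"
        by (rule fill_interval[OF R'(1,2)]) (use I v sub in auto)
      show "ok (Block [Arith Add 18 18 2]) (R'', M'') 1 (?I (Suc v))"
        if P: "case (R'', M'') of (R'', M'') \<Rightarrow> agree 17 R' R'' \<and> R'' 17 = W i ?j \<and> R'' 18 = real ?j \<and>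
          same_outside i ?j M' M'' \<and> (\<forall>k\<le>m. table_entry M'' i ?j k)" for R'' M''
      proof -
        have ag: "agree 17 R' R''" and so: "same_outside i ?j M' M''" using P by auto
        have "table_entry M'' i' j' k"
          if "i < i' \<or> i' = i \<and> j' \<le> i + Suc v \<or> i' = j'" "i' \<le> j'" "j' \<le> n" "k \<le> m" for i' j' k
        proof (cases "(i', j') = (i, ?j)")
          case False
          then have "table_entry M' i' j' k" using I that by (auto simp: filled_def)
          then show ?thesis using table_entry_same_outside[OF so _ False] that v by auto
        qed (use P that in auto)
        then have "filled M'' ({(i', j'). i < i' \<or> i' = i \<and> j' \<le> i + Suc v} \<union> Id)"
          by (auto simp: filled_def)
        moreover have "inputs M''" using I so inputs_same_outside by auto
        moreover have "agree 16 R R''" using I ag by (auto intro: agree_trans)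
        moreover have "R'' 16 = q i" "R'' 2 = 1" using I ag R' by (auto simp: agree_def)
        ultimately show ?thesis using P by (intro ok_Block) (simp_all add: add_ac Suc_eq_plus1)
      qed
    qed simp
    then show "R' 18 \<le> R' 3 \<and> ok (fill_interval ;; Block [Arith Add 18 18 2]) (R', M')
      (?T ?j + 1) (?I (Suc v))"
      using I R' v by simp
  next
    fix R' M' assume I: "?I (n - i) (R', M')"
    then have "filled M' ({(i', j'). i \<le> i'} \<union> Id)" using i by (auto simp: filled_def)
    moreover have "R' 3 = real n" using I b by (auto simp: agree_def)
    ultimately show "\<not> R' 18 \<le> R' 3 \<and> ?Q (R', M')" using I i by auto
  next
    show "?I 0 (?R, M)" using inp fl by (auto simp: filled_def W_def)
  next
    show "(\<Sum>v<n - i. ?T (i + 1 + v) + 1 + 2) + 2 \<le> (\<Sum>v<n - i. ?T (i + 1 + v) + 3) + 2"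
      by (simp add: add.assoc del: add_2_eq_Suc')
  qed
  have "(\<Sum>v<n - i. ?T (i + 1 + v) + 3) = (\<Sum>j=i+1..n. ?T j + 3)"
    by (rule sum.reindex_bij_witness[of _ "\<lambda>j. j - (i + 1)" "\<lambda>v. i + 1 + v"]) (use i in auto)
  then have "ok (WhileLe 18 3 (fill_interval ;; Block [Arith Add 18 18 2])) (?R, M)
      ((\<Sum>j=i+1..n. ?T j + 3) + 2) ?Q" using loop by simp
  moreover have a: "R 13 + R 15 = real (4 + n + i)" using R b by simp
  moreover have "M (4 + n + i) = q i" using inp i by (auto simp: inputs_def)
  ultimately show ?thesis unfolding fill_row_def row_time_def
    by (intro ok_Block_Seq[where tb = "(\<Sum>j=i+1..n. ?T j + 3) + 2"])
      (use R(2) b(1) a in \<open>simp_all del: of_nat_add\<close>)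
qed

lemma fill_table:
  assumes R: "constants R" and inp: "inputs M" and fl: "filled M Id"
  shows "ok fill_table (R, M) (3 + (\<Sum>i<n. row_time i + 3))
    (\<lambda>(R', M'). agree 15 R R' \<and> filled M' UNIV)"
    (is "ok _ _ _ ?Q")
proof -
  let ?I = "\<lambda>v (R', M'). agree 15 R R' \<and> R' 15 = real n - 1 - real v \<and>
    inputs M' \<and> filled M' ({(i', j'). n \<le> i' + v} \<union> Id)"
  let ?R = "R(15 := real n - 1)"
  have b: "R 1 = 0" "R 2 = 1" "R 3 = real n" using R by (auto simp: constants_def)
  have loop: "ok (WhileLe 1 15 (fill_row ;; Block [Arith Sub 15 15 2])) (?R, M)
      ((\<Sum>v<n. row_time (n - Suc v) + 3) + 2) ?Q"
  proof (rule ok_WhileLe[where N = n and T = "\<lambda>v. row_time (n - Suc v) + 1" and I = ?I])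
    fix v R' M' assume I: "?I v (R', M')" and v: "v < n"
    let ?i = "n - Suc v"
    have R': "constants R'" "R' 15 = real ?i" "R' 2 = 1" "R' 1 = 0"
      using I R v constants_agree[OF R, of 15 R'] by (auto simp: agree_def constants_def of_nat_diff)
    have "ok (fill_row ;; Block [Arith Sub 15 15 2]) (R', M') (row_time ?i + 1) (?I (Suc v))"
    proof (rule ok_Seq)
      show "ok fill_row (R', M') (row_time ?i)
        (\<lambda>(R'', M''). agree 16 R' R'' \<and> inputs M'' \<and> filled M'' ({(i', j'). ?i \<le> i'} \<union> Id))"
        using I v by (intro fill_row[OF R'(1,2)]) (auto simp: filled_def)
      show "ok (Block [Arith Sub 15 15 2]) (R'', M'') 1 (?I (Suc v))"
        if P: "case (R'', M'') of (R'', M'') \<Rightarrow> agree 16 R' R'' \<and> inputs M'' \<and>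
          filled M'' ({(i', j'). ?i \<le> i'} \<union> Id)" for R'' M''
      proof -
        have "R'' 15 = real n - 1 - real v" "R'' 2 = 1" using P R' I v by (auto simp: agree_def)
        moreover have "agree 15 R R''" using I P by (auto intro: agree_trans)
        moreover have "filled M'' ({(i', j'). n \<le> i' + Suc v} \<union> Id)" using P v by (auto simp: filled_def)
        ultimately show ?thesis using P by (intro ok_Block) auto
      qed
    qed simp
    moreover have "R' 1 \<le> R' 15" using R' by simp
    ultimately show "R' 1 \<le> R' 15 \<and> ok (fill_row ;; Block [Arith Sub 15 15 2]) (R', M')
      (row_time ?i + 1) (?I (Suc v))" by blast
  next
    fix R' M' assume I: "?I n (R', M')"
    then have "filled M' UNIV" by (auto simp: filled_def)
    moreover have "R' 1 = 0" using I b by (auto simp: agree_def)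
    ultimately show "\<not> R' 1 \<le> R' 15 \<and> ?Q (R', M')" using I by auto
  next
    show "?I 0 (?R, M)" using inp fl by (auto simp: filled_def)
  next
    show "(\<Sum>v<n. row_time (n - Suc v) + 1 + 2) + 2 \<le> (\<Sum>v<n. row_time (n - Suc v) + 3) + 2"
      by (simp add: add.assoc del: add_2_eq_Suc')
  qed
  have "(\<Sum>v<n. row_time (n - Suc v) + 3) = (\<Sum>i<n. row_time i + 3)"
    by (rule sum.nat_diff_reindex)
  with loop show ?thesis unfolding fill_table_def
    by (intro ok_Block_Seq[where tb = "(\<Sum>v<n. row_time (n - Suc v) + 3) + 2"]) (use b in simp_all)
qed

end

section \<open>Writing the solution\<close>

text \<open>
  Register \<open>16\<close> holds the last address written and register \<open>18\<close> the key \<open>x\<close>, whose subtree is found by a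
  search from the root. Registers \<open>20\<close> to \<open>22\<close> hold the current \<open>i\<close>, \<open>j\<close>, \<open>k\<close>, and registers \<open>26\<close>, \<open>24\<close>
  and \<open>25\<close> the choice made there. The root entry of an empty interval is \<open>0\<close>, which is the null pointer.
\<close>

definition descend :: com where
  "descend =
     Block (cell_addr 35 20 21 22 @ [Arith Add 35 35 2, Load 26 35, Arith Add 35 35 2, Load 24 35,
       Arith Add 35 35 2, Load 25 35]) ;;
     IfLe 26 18
       (IfLe 18 26 (Block [Const 23 1])
         (Block [Arith Sub 22 22 24, Arith Sub 22 22 25, Move 20 26]))
       (Block [Arith Sub 21 26 2, Move 22 25])"

definition write_key :: com where
  "write_key =
     Block [Arith Add 16 16 2, Const 20 0, Move 21 3, Move 22 4, Const 23 0] ;;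
     WhileLe 23 1 descend ;;
     Block (Arith Sub 26 18 2 # cell_addr 35 20 26 25 @ Arith Add 35 35 2 # Load 35 35 # Store 16 35 #
       Arith Add 16 16 2 # Arith Sub 27 22 24 # Arith Sub 27 27 25 # cell_addr 35 18 21 27 @
       [Arith Add 35 35 2, Load 35 35, Store 16 35, Arith Add 16 16 2]) ;;
     IfLe 24 1 (Block [Arith Add 12 12 2, Store 16 12]) (Block [Arith Add 11 11 2, Store 16 11])"

definition write_solution :: com where
  "write_solution =
     Block (cell_addr 35 1 3 4 @ [Arith Add 35 35 2, Load 35 35, Store 0 35, Move 16 0, Const 18 1]) ;;
     WhileLe 18 3 (write_key ;; Block [Arith Add 18 18 2])"

text \<open>Registers 1, 2, 15 and 14, holding 0 to 3, serve as addresses of the first four inputs.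
  Of registers 11 and 12 only one is assigned; the other keeps its initial 0, the base of the level
  that starts at address 1.\<close>

definition initialize :: com where
  "initialize =
     Block [Const 2 1, Const 7 4, Const 14 3, Const 15 2, Load 35 1, Load 36 2, Load 37 15, Load 38 14,
       Arith Add 3 35 36, Arith Add 5 3 2, Arith Add 13 3 7, Const 15 5, Arith Mul 8 3 15, Const 15 6,
       Arith Add 8 8 15, Const 15 5, Arith Add 0 3 3, Arith Add 0 0 15] ;;
     IfLe 35 36 (Block [Move 4 35, Move 9 38, Arith Sub 10 37 38, Move 12 35])
       (Block [Move 4 36, Move 9 37, Arith Sub 10 38 37, Move 11 35]) ;;
     Block [Arith Add 6 4 2]"

context two_level
begin

definition base1 :: nat where "base1 = (if m1 \<le> m2 then 0 else m1)"
definition base0 :: nat where "base0 = (if m1 \<le> m2 then m1 else 0)"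

lemma initialize:
  defines "M \<equiv> input_memory m1 m2 c1 c2 p q"
  shows "ok initialize (\<lambda>_. 0, M) 25 (\<lambda>(R', M'). M' = M \<and> constants R' \<and>
    R' 11 = real base1 \<and> R' 12 = real base0)"
    (is "ok _ _ _ ?Q")
proof -
  have M: "M 0 = real m1" "M 1 = real m2" "M 2 = real c1" "M 3 = real c2"
    by (simp_all add: M_def input_memory_def Let_def nth_append numeral_2_eq_2 numeral_3_eq_3 One_nat_def)
  let ?if = "IfLe 35 36 (Block [Move 4 35, Move 9 38, Arith Sub 10 37 38, Move 12 35])
       (Block [Move 4 36, Move 9 37, Arith Sub 10 38 37, Move 11 35])"
  have fin: "ok (Block [Arith Add 6 4 2]) (R', M') 1 ?Q"
    if "M' = M \<and> R' 0 = real (5 + 2 * n) \<and> R' 1 = 0 \<and> R' 2 = 1 \<and> R' 3 = real n \<and> R' 4 = real m \<and>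
     R' 5 = real (n + 1) \<and> R' 7 = 4 \<and> R' 8 = real (6 + 5 * n) \<and>
     R' 9 = \<mu> 0 \<and> R' 10 = \<mu> 1 - \<mu> 0 \<and> R' 13 = real (4 + n) \<and> R' 14 = 3 \<and>
     R' 11 = real base1 \<and> R' 12 = real base0" for R' M'
    using that by (intro ok_Block) (auto simp: constants_def)
  show ?thesis unfolding initialize_def
    apply (rule ok_Block_Seq[where tb = 7])
     apply (simp add: M)
     apply (rule ok_Seq[where ta = 6 and tb = 1 and
          P = "\<lambda>(R', M'). M' = M \<and> R' 0 = real (5 + 2 * n) \<and> R' 1 = 0 \<and> R' 2 = 1 \<and> R' 3 = real n \<and>
            R' 4 = real m \<and> R' 5 = real (n + 1) \<and> R' 7 = 4 \<and> R' 8 = real (6 + 5 * n) \<and>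
            R' 9 = \<mu> 0 \<and> R' 10 = \<mu> 1 - \<mu> 0 \<and> R' 13 = real (4 + n) \<and> R' 14 = 3 \<and>
            R' 11 = real base1 \<and> R' 12 = real base0", OF _ fin])
       apply (rule ok_IfLe[where ta = 4]; (rule ok_Block)?)
    by (simp_all add: n_def m_def \<mu>_def base0_def base1_def)
qed

end

section \<open>Reading the tree off the finished table\<close>

lemma Key_subtree_unique:
  assumes "distinct (internals T)" "Key l x r \<in> subtrees T" "Key l' x r' \<in> subtrees T"
  shows "l = l' \<and> r = r'"
  using assms by (induction T) (auto dest: internals_Key_mem)

lemma subtrees_trans: "S \<in> subtrees T \<Longrightarrow> subtrees S \<subseteq> subtrees T"
  by (induction T) auto

lemma subtrees_self [simp]: "T \<in> subtrees T"
  by (cases T) auto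

locale solved_table = two_level +
  fixes M0 :: "nat \<Rightarrow> real"
  assumes filled: "filled M0 UNIV"
begin

text \<open>The floor only converts types: in every feasible entry the stored fields are natural
  numbers.\<close>

definition rt :: "nat \<Rightarrow> nat \<Rightarrow> nat \<Rightarrow> nat" where "rt i j k = nat \<lfloor>M0 (cell i j k + 1)\<rfloor>"
definition lv :: "nat \<Rightarrow> nat \<Rightarrow> nat \<Rightarrow> nat" where "lv i j k = nat \<lfloor>M0 (cell i j k + 2)\<rfloor>"
definition lc :: "nat \<Rightarrow> nat \<Rightarrow> nat \<Rightarrow> nat" where "lc i j k = nat \<lfloor>M0 (cell i j k + 3)\<rfloor>"

lemma entries:
  assumes "i < j" "j \<le> n" "k \<le> m" "k \<le> j - i"
  shows "first_best i j k (choices i j k) (rt i j k, lv i j k, lc i j k)"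
    "M0 (cell i j k + 1) = real (rt i j k)" "M0 (cell i j k + 2) = real (lv i j k)"
    "M0 (cell i j k + 3) = real (lc i j k)"
proof -
  have "table_entry M0 i j k" using filledD[OF filled] assms by simp
  then obtain r l c where "first_best i j k (choices i j k) (r, l, c)"
    and e: "M0 (cell i j k + 1) = real r" "M0 (cell i j k + 2) = real l" "M0 (cell i j k + 3) = real c"
    using assms unfolding table_entry_def by auto
  moreover have "rt i j k = r" "lv i j k = l" "lc i j k = c" by (simp_all only: rt_def lv_def lc_def e floor_of_nat nat_int)
  ultimately show "first_best i j k (choices i j k) (rt i j k, lv i j k, lc i j k)"
    "M0 (cell i j k + 1) = real (rt i j k)" "M0 (cell i j k + 2) = real (lv i j k)"
    "M0 (cell i j k + 3) = real (lc i j k)" by simp_all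
qed

sublocale decisions p q \<mu> n m rt lv lc
proof
  fix i j k assume "i < j" "j \<le> n" "k \<le> m" "k \<le> j - i"
  note b = entries(1)[OF this]
  show "(rt i j k, lv i j k, lc i j k) \<in> choices i j k \<and>
    val i j k (rt i j k, lv i j k, lc i j k) = opt i j k"
    using b val_first_best[OF b] unfolding first_best_def by blast
qed

lemma build_Key:
  assumes "i < j" "j \<le> n" "k \<le> m" "k \<le> j - i"
  shows "build i j k = Key (build i (rt i j k - 1) (lc i j k)) (rt i j k)
    (build (rt i j k) j (k - lv i j k - lc i j k))"
  using decision_bounds(1,2)[OF assms] by (subst build.simps) simp

text \<open>The root field of a subinterval serves as the pointer to that child; for an empty
  interval it is the zero left from the initial memory, which is the null pointer.\<close>

lemma root_entry:
  assumes "i \<le> j" "j \<le> n" "k \<le> m" "k \<le> j - i"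
  shows "M0 (cell i j k + 1) = real (node_ptr (build i j k))"
proof (cases "i < j")
  case True
  then show ?thesis using entries(2) build_Key assms by simp
next
  case False
  then have "i = j" "k = 0" using assms by auto
  moreover have "table_entry M0 i j k" using filledD[OF filled] assms by simp
  ultimately show ?thesis by (simp add: table_entry_def)
qed

abbreviation "root_tree \<equiv> build 0 n m"
abbreviation "root_level \<equiv> level 0 n m"

text \<open>The output area ends just below the table, so the table can still be searched while the
  solution is being written.\<close>

definition table_kept :: "(nat \<Rightarrow> real) \<Rightarrow> bool" where
  "table_kept M \<longleftrightarrow> (\<forall>a\<ge>6 + 5 * n. M a = M0 a)"

lemma table_kept_cell: "table_kept M \<Longrightarrow> M (cell i j k + f) = M0 (cell i j k + f)"
  by (simp add: table_kept_def cell_def)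

definition at_subtree :: "nat \<Rightarrow> nat \<Rightarrow> nat \<Rightarrow> nat \<Rightarrow> bool" where
  "at_subtree x i j k \<longleftrightarrow> i < x \<and> x \<le> j \<and> j \<le> n \<and> k \<le> m \<and> k \<le> j - i \<and>
    build i j k \<in> subtrees root_tree \<and> level i j k x = root_level x"

lemma at_subtree_root: "1 \<le> x \<Longrightarrow> x \<le> n \<Longrightarrow> at_subtree x 0 n m"
  by (simp add: at_subtree_def m_def n_def)

text \<open>A child inherits a feasible count from \<open>decision_bounds\<close>, so its table
  entry is meaningful again, and its interval is strictly shorter, so the search ends.\<close>

lemma at_subtree_child:
  assumes "at_subtree x i j k"
  shows "x < rt i j k \<Longrightarrow> at_subtree x i (rt i j k - 1) (lc i j k)"
    "rt i j k < x \<Longrightarrow> at_subtree x (rt i j k) j (k - lv i j k - lc i j k)"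
proof -
  have b: "i < j" "j \<le> n" "k \<le> m" "k \<le> j - i" "i < x" "x \<le> j" "build i j k \<in> subtrees root_tree"
    "level i j k x = root_level x"
    using assms by (auto simp: at_subtree_def)
  note d = decision_bounds[OF b(1-4)]
  have s: "subtrees (build i j k) \<subseteq> subtrees root_tree" using b(7) by (rule subtrees_trans)
  have k: "build i (rt i j k - 1) (lc i j k) \<in> subtrees root_tree"
    "build (rt i j k) j (k - lv i j k - lc i j k) \<in> subtrees root_tree"
    using s unfolding build_Key[OF b(1-4)] by auto
  have l: "x < rt i j k \<Longrightarrow> level i j k x = level i (rt i j k - 1) (lc i j k) x"
    "rt i j k < x \<Longrightarrow> level i j k x = level (rt i j k) j (k - lv i j k - lc i j k) x"
    using d(1,2) by (subst level.simps; simp)+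
  show "at_subtree x i (rt i j k - 1) (lc i j k)" if "x < rt i j k"
    unfolding at_subtree_def using that b(2,5) d k(1) l(1)[OF that] b(8) by auto
  show "at_subtree x (rt i j k) j (k - lv i j k - lc i j k)" if "rt i j k < x"
    unfolding at_subtree_def using that b(2,6) d k(2) l(2)[OF that] b(8) by auto
qed

text \<open>Register 23 tells whether the key has been found. Until then \<open>v\<close> is the
  length of the current interval, which bounds the remaining rounds; on success it drops to
  0.\<close>

definition at_search :: "nat \<Rightarrow> nat \<Rightarrow> (nat \<Rightarrow> real) \<Rightarrow> bool" where
  "at_search x v R \<longleftrightarrow> (\<exists>i j k. at_subtree x i j k \<and> R 20 = real i \<and> R 21 = real j \<and> R 22 = real k \<and>
     (R 23 = 0 \<and> v = j - i \<or> R 23 = 1 \<and> v = 0 \<and> rt i j k = x \<and>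
        R 24 = real (lv i j k) \<and> R 25 = real (lc i j k)))"

lemma descend:
  assumes R: "constants R" "R 18 = real x" and s: "at_search x v R" "R 23 \<le> 0" and M: "table_kept M"
  shows "ok descend (R, M) 19 (\<lambda>s'. \<exists>v'<v. \<exists>R'. s' = (R', M) \<and> agree 20 R R' \<and> at_search x v' R')"
    (is "ok _ _ _ ?Q")
proof -
  obtain i j k where at: "at_subtree x i j k" and r: "R 20 = real i" "R 21 = real j" "R 22 = real k" "R 23 = 0"
    and v: "v = j - i"
    using s by (auto simp: at_search_def)
  then have b: "i < j" "j \<le> n" "k \<le> m" "k \<le> j - i" by (auto simp: at_subtree_def)
  note d = decision_bounds[OF b] and e = entries[OF b]
  let ?r = "rt i j k" and ?l = "lv i j k" and ?c = "lc i j k"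
  have M': "M (cell i j k + 1) = real ?r" "M (cell i j k + 2) = real ?l" "M (cell i j k + 3) = real ?c"
    using e(2-4) table_kept_cell[OF M, of i j k 1] table_kept_cell[OF M, of i j k 2]
      table_kept_cell[OF M, of i j k 3] by simp_all
  let ?R = "R(26 := real ?r, 24 := real ?l, 35 := 3 + real (cell i j k), 25 := real ?c)"
  have R2: "R 2 = 1" using R by (simp add: constants_def)
  have k: "real k - real ?l - real ?c = real (k - ?l - ?c)" using d(8) by simp
  have walk: "ok (IfLe 26 18
       (IfLe 18 26 (Block [Const 23 1]) (Block [Arith Sub 22 22 24, Arith Sub 22 22 25, Move 20 26]))
       (Block [Arith Sub 21 26 2, Move 22 25])) (?R, M) 7 ?Q"
  proof (rule ok_IfLe[where ta = 5])
    assume "\<not> ?R 26 \<le> ?R 18"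
    then have "x < ?r" using R by simp
    from at_subtree_child(1)[OF at this]
    have s: "at_search x (?r - 1 - i) (?R(21 := real ?r - 1, 22 := real ?c))"
      using r d(1) unfolding at_search_def
      by (intro exI[of _ i] exI[of _ "?r - 1"] exI[of _ ?c]) (simp add: of_nat_diff)
    have lt: "?r - 1 - i < v" using d(1,2) v by linarith
    show "ok (Block [Arith Sub 21 26 2, Move 22 25]) (?R, M) 5 ?Q"
      using R2 by (intro ok_Block) (simp_all, intro exI[of _ "?r - 1 - i"] conjI lt s)
  next
    assume "?R 26 \<le> ?R 18"
    then have le: "?r \<le> x" using R by simp
    show "ok (IfLe 18 26 (Block [Const 23 1]) (Block [Arith Sub 22 22 24, Arith Sub 22 22 25, Move 20 26])) (?R, M) 5 ?Q"
    proof (rule ok_IfLe[where ta = 3])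
      assume "?R 18 \<le> ?R 26"
      then have "?r = x" using le R by simp
      then have "at_search x 0 (?R(23 := 1))" using at r by (auto simp: at_search_def)
      moreover have "0 < v" using b v by simp
      ultimately show "ok (Block [Const 23 1]) (?R, M) 3 ?Q"
        by (intro ok_Block) (simp_all, intro exI[of _ 0] conjI)
    next
      assume "\<not> ?R 18 \<le> ?R 26"
      then have "?r < x" using R by simp
      from at_subtree_child(2)[OF at this]
      have "at_search x (j - ?r) (?R(22 := real (k - ?l - ?c), 20 := real ?r))"
        using r by (auto simp: at_search_def)
      moreover have "j - ?r < v" using d(1,2) b v by simp
      ultimately show "ok (Block [Arith Sub 22 22 24, Arith Sub 22 22 25, Move 20 26]) (?R, M) 3 ?Q"
        using r(3) k by (intro ok_Block) (simp_all del: of_nat_diff, intro exI[of _ "j - ?r"] conjI)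
    qed simp
  qed simp
  show ?thesis unfolding descend_def
    apply (rule ok_Block_Seq[where tb = 7])
     apply (subst exec_cell_addr[OF R(1) r(1-3)])
       apply (use R2 M' walk in \<open>simp_all add: fun_upd_twist\<close>)
    done
qed

text \<open>The search makes at most \<open>n\<close> rounds of 19 + 2 steps. The choice at the key
  gives both child intervals and its level, and the level selects the address counter to
  advance.\<close>

lemma write_key:
  assumes R: "constants R" "R 16 = real (2 + 2 * n + 3 * x)" "R 18 = real x" "R 11 = real a" "R 12 = real b"
    and x: "1 \<le> x" "x \<le> n" and M: "table_kept M"
  defines "w \<equiv> 3 + 2 * n + 3 * x"
  shows "ok write_key (R, M) (21 * n + 36) (\<lambda>(R', M'). constants R' \<and> R' 16 = real (w + 2) \<and> R' 18 = real x \<and>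
    (\<exists>l r. Key l x r \<in> subtrees root_tree \<and> M' w = real (node_ptr l) \<and> M' (w + 1) = real (node_ptr r)) \<and>
    (if root_level x = 1 then M' (w + 2) = real (a + 1) \<and> R' 11 = real (a + 1) \<and> R' 12 = real b
     else M' (w + 2) = real (b + 1) \<and> R' 11 = real a \<and> R' 12 = real (b + 1)) \<and>
    (\<forall>y. y < w \<or> w + 2 < y \<longrightarrow> M' y = M y))"
    (is "ok _ _ _ ?Q")
proof -
  have b: "R 1 = 0" "R 2 = 1" "R 3 = real n" "R 4 = real m" using R by (auto simp: constants_def)
  let ?R = "R(16 := real w, 20 := 0, 21 := real n, 22 := real m, 23 := 0)"
  let ?I = "\<lambda>v s. \<exists>R'. s = (R', M) \<and> agree 20 ?R R' \<and> at_search x v R'"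
  have cR: "constants ?R" by (rule constants_agree[OF R(1), of 15]) simp_all
  have loop: "ok (WhileLe 23 1 descend) (?R, M) (21 * n + 2)
    (\<lambda>s. \<exists>R' v. s = (R', M) \<and> agree 20 ?R R' \<and> at_search x v R' \<and> R' 23 \<noteq> 0)"
  proof (rule ok_WhileLe_measure[where I = ?I and T = 19 and v = n])
    fix v R' M' assume I: "?I v (R', M')" and g: "R' 23 \<le> R' 1"
    have "constants R'" using I constants_agree[OF cR, of 20 R'] by auto
    then have R': "constants R'" "R' 18 = real x" "R' 1 = 0" using I R b by (auto simp: agree_def)
    have "ok descend (R', M) 19 (\<lambda>s'. \<exists>v'<v. \<exists>R''. s' = (R'', M) \<and> agree 20 R' R'' \<and> at_search x v' R'')"
      using I g R' by (intro descend M) auto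
    moreover have "M' = M" "agree 20 ?R R'" using I by auto
    ultimately show "ok descend (R', M') 19 (\<lambda>s'. \<exists>v'<v. ?I v' s')"
      by (auto elim!: ok_mono intro: agree_trans)
  next
    fix v R' M' assume I: "?I v (R', M')" and g: "\<not> R' 23 \<le> R' 1"
    have "R' 1 = 0" using I b by (auto simp: agree_def)
    then show "\<exists>R'' v. (R', M') = (R'', M) \<and> agree 20 ?R R'' \<and> at_search x v R'' \<and> R'' 23 \<noteq> 0" using I g by auto
  next
    show "?I n (?R, M)" using at_subtree_root[OF x] by (auto simp: at_search_def)
  qed simp
  let ?store = "Arith Sub 26 18 2 # cell_addr 35 20 26 25 @ Arith Add 35 35 2 # Load 35 35 # Store 16 35 #
       Arith Add 16 16 2 # Arith Sub 27 22 24 # Arith Sub 27 27 25 # cell_addr 35 18 21 27 @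
       [Arith Add 35 35 2, Load 35 35, Store 16 35, Arith Add 16 16 2]"
  let ?if = "IfLe 24 1 (Block [Arith Add 12 12 2, Store 16 12]) (Block [Arith Add 11 11 2, Store 16 11])"
  have rest: "ok (Block ?store ;; ?if) (R', M) 28 ?Q"
    if ag: "agree 20 ?R R'" and s: "at_search x v R'" "R' 23 \<noteq> 0" for R' v
  proof -
    obtain i j k where at: "at_subtree x i j k" and r: "R' 20 = real i" "R' 21 = real j" "R' 22 = real k"
      "rt i j k = x" "R' 24 = real (lv i j k)" "R' 25 = real (lc i j k)"
      using s by (auto simp: at_search_def)
    then have bd: "i < j" "j \<le> n" "k \<le> m" "k \<le> j - i" by (auto simp: at_subtree_def)
    note d = decision_bounds[OF bd, unfolded r(4)]
    let ?l = "build i (x - 1) (lc i j k)" and ?r = "build x j (k - lv i j k - lc i j k)"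
    have key: "Key ?l x ?r \<in> subtrees root_tree" using at build_Key[OF bd] r(4) by (simp add: at_subtree_def)
    have lev: "root_level x = lv i j k" using at d(1,2) r(4)
      by (subst (asm) at_subtree_def, subst (asm) level.simps) auto
    have R': "constants R'" "R' 16 = real w" "R' 18 = real x" "R' 11 = real a" "R' 12 = real b" "R' 2 = 1" "R' 1 = 0"
      using ag constants_agree[OF cR ag] R b by (auto simp: agree_def)
    have p1: "M (cell i (x - 1) (lc i j k) + 1) = real (node_ptr ?l)"
      using root_entry[of i "x - 1" "lc i j k"] table_kept_cell[OF M] d bd x by auto
    have p2: "M (cell x j (k - lv i j k - lc i j k) + 1) = real (node_ptr ?r)"
      using root_entry[of x j "k - lv i j k - lc i j k"] table_kept_cell[OF M] d bd by auto
    \<comment> \<open>The first pointer is stored before the second is loaded from the table; this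
      store does not hit the table.\<close>
    have wc: "cell i' j' k' + 1 \<noteq> w" for i' j' k' using x by (simp add: w_def cell_def)
    have k: "real k - real (lv i j k) - real (lc i j k) = real (k - lv i j k - lc i j k)" using d(8) by simp
    let ?M = "M(w := real (node_ptr ?l), w + 1 := real (node_ptr ?r))"
    have fin: "ok ?if (R'', ?M) 5 ?Q" if "agree 15 R' R''" "R'' 16 = real (w + 2)" "R'' 18 = real x" "R'' 24 = real (lv i j k)" for R''
    proof (rule ok_IfLe[where ta = 2])
      have R'': "constants R''" "R'' 1 = 0" "R'' 2 = 1" "R'' 11 = real a" "R'' 12 = real b"
        using that constants_agree[OF R'(1) that(1)] R' by (auto simp: agree_def)
      have c: "constants (R''(12 := u))" "constants (R''(11 := u))" for u using R''(1) by (auto simp: constants_def)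
      {
        assume "R'' 24 \<le> R'' 1"
        then have "root_level x \<noteq> 1" using that R'' lev by simp
        then show "ok (Block [Arith Add 12 12 2, Store 16 12]) (R'', ?M) 2 ?Q"
          using that R'' c key by (intro ok_Block) auto
      next
        assume "\<not> R'' 24 \<le> R'' 1"
        then have "root_level x = 1" using that R'' lev d(3) by simp
        then show "ok (Block [Arith Add 11 11 2, Store 16 11]) (R'', ?M) 2 ?Q"
          using that R'' c key by (intro ok_Block) auto
      }
    qed simp
    define Q where "Q = (\<lambda>s. ok ?if s 5 ?Q)"
    let ?S = "R'(26 := real (x - 1))"
    have c1: "constants ?S" by (rule constants_agree[OF R'(1), of 15]) simp_all
    let ?S' = "?S(35 := real (node_ptr ?l), 16 := real w + 1, 27 := real (k - lv i j k - lc i j k))"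
    have c2: "constants ?S'" by (rule constants_agree[OF R'(1), of 15]) simp_all
    have Q: "Q (R'', ?M)" if "agree 15 R' R''" "R'' 16 = real w + 2" "R'' 18 = real x" "R'' 24 = real (lv i j k)" for R''
      unfolding Q_def using fin[of R''] that by simp
    have second: "exec_block (cell_addr 35 18 21 27 @ [Arith Add 35 35 2, Load 35 35, Store 16 35, Arith Add 16 16 2])
        (?S', M(w := real (node_ptr ?l))) Q"
      apply (subst exec_cell_addr[OF c2, where i = x and j = j and k = "k - lv i j k - lc i j k"])
           apply (use r R' in simp_all)[5]
      apply (simp add: R' wc p2 del: diff_diff_left)
      apply (rule Q)
         apply (use R' r x in \<open>simp_all\<close>)
      done
    have e: "real x - 1 = real (x - 1)" using x by simp
    have "exec_block ?store (R', M) Q"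
      apply (simp only: exec_block.simps apply_op.simps option.inject R' e ex_simps simp_thms)
      apply (subst exec_cell_addr[OF c1, where i = i and j = "x - 1" and k = "lc i j k"])
           apply (use r in simp_all)[5]
      apply (simp add: R' r p1 k del: of_nat_diff diff_diff_left)
      using second apply (simp del: of_nat_diff diff_diff_left)
      done
    then show ?thesis unfolding Q_def by (rule ok_Block_Seq) simp
  qed
  have w: "R 16 + R 2 = real w" using R(2) b(2) by (simp add: w_def)
  have main: "ok (WhileLe 23 1 descend ;; Block ?store ;; ?if) (?R, M) (21 * n + 30) ?Q"
  proof (rule ok_Seq[where tb = 28, OF loop])
    show "ok (Block ?store ;; ?if) (R', M') 28 ?Q"
      if "\<exists>R'' v. (R', M') = (R'', M) \<and> agree 20 ?R R'' \<and> at_search x v R'' \<and> R'' 23 \<noteq> 0" for R' M'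
      using that rest by blast
  qed simp
  show ?thesis unfolding write_key_def
    by (rule ok_Block_Seq[where tb = "21 * n + 30"]) (use main b(3,4) w in simp_all)
qed

abbreviation "root_assignment \<equiv> assignment base1 base0 root_level"

definition stored :: "(nat \<Rightarrow> real) \<Rightarrow> nat \<Rightarrow> bool" where
  "stored M x \<longleftrightarrow> (\<exists>l r. Key l x r \<in> subtrees root_tree \<and> M (3 + 2 * n + 3 * x) = real (node_ptr l) \<and>
     M (4 + 2 * n + 3 * x) = real (node_ptr r) \<and> M (5 + 2 * n + 3 * x) = real (root_assignment x))"

definition count1 where "count1 v = card {y \<in> {1..v}. root_level y = 1}"
definition count0 where "count0 v = card {y \<in> {1..v}. root_level y \<noteq> 1}"

lemma count_0 [simp]: "count1 0 = 0" "count0 0 = 0"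
  by (simp_all add: count1_def count0_def)

lemma count_Suc:
  "count1 (Suc v) = count1 v + (if root_level (Suc v) = 1 then 1 else 0)"
  "count0 (Suc v) = count0 v + (if root_level (Suc v) = 1 then 0 else 1)"
proof -
  have *: "{y \<in> {1..Suc v}. P y} = (if P (Suc v) then insert (Suc v) {y \<in> {1..v}. P y} else {y \<in> {1..v}. P y})" for P
    by (auto simp: le_Suc_eq)
  show "count1 (Suc v) = count1 v + (if root_level (Suc v) = 1 then 1 else 0)"
    unfolding count1_def by (subst *) simp
  show "count0 (Suc v) = count0 v + (if root_level (Suc v) = 1 then 0 else 1)"
    unfolding count0_def by (subst *) simp
qed

lemma root_assignment_eq:
  "root_assignment x = (if root_level x = 1 then base1 + count1 x else base0 + count0 x)"
  by (simp add: assignment_def count1_def count0_def)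

lemma bst_root_tree: "bst_on 0 n root_tree" "tree_cost p q (\<lambda>x. \<mu> (root_level x)) root_tree = opt 0 n m"
    "level_count root_level 0 n = m"
  using build_correct[of 0 n m] by (simp_all add: m_def n_def)

text \<open>\<open>stored\<close> speaks of some subtree with root \<open>x\<close>; distinct keys
  make it the one that \<open>stores_solution\<close> quantifies over.\<close>

lemma stores_solution_stored:
  assumes "M (5 + 2 * n) = real (node_ptr root_tree)" "\<forall>x\<in>{1..n}. stored M x"
  shows "stores_solution M (5 + 2 * n) root_tree root_assignment"
  unfolding stores_solution_def
proof (intro conjI allI impI)
  fix l i r assume K: "Key l i r \<in> subtrees root_tree"
  have "i \<in> {0<..n}" using internals_Key_mem[OF K] bst_on_internals[OF bst_root_tree(1)] by simp
  then have i: "i \<in> {1..n}" by auto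
  then obtain l' r' where K': "Key l' i r' \<in> subtrees root_tree"
    and M: "M (3 + 2 * n + 3 * i) = real (node_ptr l')" "M (4 + 2 * n + 3 * i) = real (node_ptr r')"
      "M (5 + 2 * n + 3 * i) = real (root_assignment i)"
    using assms(2)[rule_format, OF i] unfolding stored_def by blast
  have "distinct (internals root_tree)" using bst_root_tree(1) by (simp add: bst_on_def)
  from Key_subtree_unique[OF this K K'] have lr: "l' = l" "r' = r" by auto
  have "5 + 2 * n + 3 * i - 2 = 3 + 2 * n + 3 * i" "5 + 2 * n + 3 * i - 1 = 4 + 2 * n + 3 * i" by auto
  then show "M (5 + 2 * n + 3 * i - 2) = real (node_ptr l)" "M (5 + 2 * n + 3 * i - 1) = real (node_ptr r)"
    "M (5 + 2 * n + 3 * i) = real (root_assignment i)" using M unfolding lr by (simp_all only:)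
qed (rule assms(1))

lemma write_solution:
  assumes R: "constants R" "R 11 = real base1" "R 12 = real base0"
  shows "ok write_solution (R, M0) (13 + n * (21 * n + 39))
    (\<lambda>(R', M'). R' 0 = real (5 + 2 * n) \<and> stores_solution M' (5 + 2 * n) root_tree root_assignment)"
    (is "ok _ _ _ ?Q")
proof -
  let ?B = "5 + 2 * n"
  have b: "R 0 = real ?B" "R 1 = real 0" "R 2 = 1" "R 3 = real n" "R 4 = real m"
    using R by (auto simp: constants_def)
  let ?I = "\<lambda>v (R', M'). constants R' \<and> R' 18 = real (v + 1) \<and> R' 16 = real (2 + 2 * n + 3 * (v + 1)) \<and>
    R' 11 = real (base1 + count1 v) \<and>
    R' 12 = real (base0 + count0 v) \<and>
    table_kept M' \<and> M' ?B = real (node_ptr root_tree) \<and> (\<forall>x\<in>{1..v}. stored M' x)"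
  let ?R = "R(35 := real (node_ptr root_tree), 16 := R 0, 18 := 1)"
  let ?M = "M0(?B := real (node_ptr root_tree))"
  have loop: "ok (WhileLe 18 3 (write_key ;; Block [Arith Add 18 18 2])) (?R, ?M) (n * (21 * n + 39) + 2) ?Q"
  proof (rule ok_WhileLe[where N = n and T = "\<lambda>_. 21 * n + 37" and I = ?I])
    fix v R' M' assume I: "?I v (R', M')" and v: "v < n"
    let ?x = "v + 1"
    let ?a = "base1 + count1 v" and ?b = "base0 + count0 v"
    let ?w = "3 + 2 * n + 3 * ?x"
    have R': "constants R'" "R' 16 = real (2 + 2 * n + 3 * ?x)" "R' 18 = real ?x" "R' 11 = real ?a" "R' 12 = real ?b"
      and tk: "table_kept M'" using I by blast+
    have R3: "R' 3 = real n" using R' by (simp add: constants_def)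
    have x: "1 \<le> ?x" "?x \<le> n" using v by auto
    have "ok (write_key ;; Block [Arith Add 18 18 2]) (R', M') (21 * n + 37) (?I (Suc v))"
    proof (rule ok_Seq[OF write_key[OF R' x tk]])
      fix R'' M''
      assume P: "case (R'', M'') of (R'', M'') \<Rightarrow> constants R'' \<and> R'' 16 = real (?w + 2) \<and> R'' 18 = real ?x \<and>
        (\<exists>l r. Key l ?x r \<in> subtrees root_tree \<and> M'' ?w = real (node_ptr l) \<and> M'' (?w + 1) = real (node_ptr r)) \<and>
        (if root_level ?x = 1 then M'' (?w + 2) = real (?a + 1) \<and> R'' 11 = real (?a + 1) \<and> R'' 12 = real ?b
         else M'' (?w + 2) = real (?b + 1) \<and> R'' 11 = real ?a \<and> R'' 12 = real (?b + 1)) \<and>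
        (\<forall>y. y < ?w \<or> ?w + 2 < y \<longrightarrow> M'' y = M' y)"
      let ?a' = "base1 + count1 (Suc v)"
      let ?b' = "base0 + count0 (Suc v)"
      have c: "R'' 11 = real ?a'" "R'' 12 = real ?b'" "M'' (?w + 2) = real (root_assignment ?x)"
      proof -
        have x: "?x = Suc v" by simp
        have "if root_level ?x = 1 then M'' (?w + 2) = real (?a + 1) \<and> R'' 11 = real (?a + 1) \<and> R'' 12 = real ?b
          else M'' (?w + 2) = real (?b + 1) \<and> R'' 11 = real ?a \<and> R'' 12 = real (?b + 1)" using P by blast
        then show "R'' 11 = real ?a'" "R'' 12 = real ?b'" "M'' (?w + 2) = real (root_assignment ?x)"
          unfolding root_assignment_eq x count_Suc by (simp_all split: if_splits)
      qed
      have same: "M'' y = M' y" if "y < ?w \<or> ?w + 2 < y" for y using P that by blast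
      have "table_kept M''" using tk same x unfolding table_kept_def by auto
      moreover have "M'' ?B = real (node_ptr root_tree)" using I same[of ?B] by auto
      moreover have "stored M'' x" if "x \<in> {1..Suc v}" for x
      proof (cases "x = ?x")
        case True
        have "?w + 1 = 4 + 2 * n + 3 * ?x" "?w + 2 = 5 + 2 * n + 3 * ?x" by auto
        with P c(3) show ?thesis unfolding True stored_def by auto
      next
        case False
        then have "x \<in> {1..v}" using that by auto
        then have "stored M' x" "x \<le> v" using I by auto
        then show ?thesis unfolding stored_def using same[of "3 + 2 * n + 3 * x"] same[of "4 + 2 * n + 3 * x"]
          same[of "5 + 2 * n + 3 * x"] by auto
      qed
      moreover have "constants (R''(18 := u))" for u using P by (auto simp: constants_def)
      moreover have "R'' 2 = 1" "R'' 18 = real ?x" "R'' 16 = real (2 + 2 * n + 3 * (Suc v + 1))"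
        using P by (auto simp: constants_def)
      ultimately show "ok (Block [Arith Add 18 18 2]) (R'', M'') 1 (?I (Suc v))"
        using c(1,2) by (intro ok_Block) (simp_all only: exec_block.simps apply_op.simps, simp_all)
    qed simp
    moreover have "R' 18 \<le> R' 3" using R' R3 v by simp
    ultimately show "R' 18 \<le> R' 3 \<and> ok (write_key ;; Block [Arith Add 18 18 2]) (R', M') (21 * n + 37) (?I (Suc v))"
      by blast
  next
    fix R' M' assume I: "?I n (R', M')"
    then have "R' 3 = real n" "R' 0 = real ?B" by (auto simp: constants_def)
    then show "\<not> R' 18 \<le> R' 3 \<and> ?Q (R', M')" using I stores_solution_stored[of M'] by simp
  next
    have "constants ?R" by (rule constants_agree[OF R(1), of 15]) simp_all
    moreover have "table_kept ?M" by (simp add: table_kept_def)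
    ultimately show "?I 0 (?R, ?M)" using R b by simp
  qed simp
  have M: "M0 (cell 0 n m + 1) = real (node_ptr root_tree)" by (rule root_entry) (auto simp: m_def n_def)
  show ?thesis unfolding write_solution_def
    apply (rule ok_Block_Seq[where tb = "n * (21 * n + 39) + 2"])
     apply (subst exec_cell_addr[OF R(1) b(2,4,5)])
       apply (use b(1,3) M loop in \<open>simp_all add: fun_upd_twist del: of_nat_add of_nat_mult\<close>)
    done
qed

lemma optimum_root_tree: "optimum_solution m1 m2 c1 c2 p q root_tree root_assignment"
  unfolding base1_def base0_def
proof (rule optimum_solutionI)
  have \<mu>: "real (if (l = 1) = (m1 \<le> m2) then c1 else c2) = \<mu> l" for l by (simp add: \<mu>_def)
  have m: "m = (if m1 \<le> m2 then m1 else m2)" by (simp add: m_def)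
  show "1 \<le> m1 + m2" using n_pos by (simp add: n_def)
  show "is_BST (m1 + m2) root_tree" using bst_root_tree(1) by (simp add: is_BST_iff n_def)
  show "root_level x \<le> 1" for x using level_le[of n m 0 x] by (simp add: m_def n_def)
  show "card {x \<in> {0<..m1 + m2}. root_level x = 1} = (if m1 \<le> m2 then m1 else m2)"
    using bst_root_tree(3) unfolding level_count_def m[symmetric] n_def by simp
  show "tree_cost p q (\<lambda>x. (\<lambda>l. real (if (l = 1) = (m1 \<le> m2) then c1 else c2)) (root_level x)) root_tree =
    recurrence.opt p q (\<lambda>l. real (if (l = 1) = (m1 \<le> m2) then c1 else c2)) 0 (m1 + m2) (if m1 \<le> m2 then m1 else m2)"
    using bst_root_tree(2) unfolding \<mu> m[symmetric] n_def by simp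
qed

end

section \<open>Running time\<close>

definition two_level_program :: com where
  "two_level_program = initialize ;; fill_table ;; write_solution"

context two_level
begin

text \<open>Let \<open>P i\<close> be the sum of the roots in row \<open>i\<close>. Subtracting the
  shifted row \<open>i\<close> from row \<open>i + 1\<close> bounds the ranges of row
  \<open>i\<close> by \<open>2 * n + P (i + 1) - P i\<close>, and the differences telescope over
  \<open>i\<close>. Integers are used because a difference may be negative.\<close>

lemma sum_root_ranges_one_level:
  assumes "m = 0"
  shows "(\<Sum>i<n. \<Sum>j=i+1..n. max_root i j + 1 - min_root i j) \<le> 2 * n\<^sup>2"
proof -
  define K where "K i j = int (first_root i j)" for i j
  define P where "P i = (\<Sum>j=i+1..n. K i j)" for i
  have row: "int (\<Sum>j=i+1..n. max_root i j + 1 - min_root i j) \<le> 2 * int n + (P (i + 1) - P i)" if i: "i < n" for i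
  proof -
    obtain n' where n': "n = Suc n'" using i by (cases n) auto
    let ?N = "\<lambda>j. int (max_root i j + 1 - min_root i j)"
    have N: "?N j = K (i + 1) j + 1 - K i (j - 1)" if "j \<in> {i+1+1..n}" for j
      using that assms root_bounds[of i j] by (simp add: max_root_def min_root_def K_def)
    have "(\<Sum>j=i+1..n. ?N j) = ?N (i + 1) + (\<Sum>j=i+1+1..n. ?N j)"
      using i by (subst sum.atLeast_Suc_atMost) (simp_all add: Suc_eq_plus1)
    also have "?N (i + 1) = 1" by (simp add: max_root_def min_root_def)
    also have "(\<Sum>j=i+1+1..n. ?N j) = (\<Sum>j=i+1+1..n. K (i + 1) j + 1 - K i (j - 1))"
      using N by (rule sum.cong[OF refl])
    also have "\<dots> = P (i + 1) + int (n - (i + 1)) - (\<Sum>j=i+1+1..n. K i (j - 1))"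
      by (simp add: sum_subtractf sum.distrib P_def)
    also have "(\<Sum>j=i+1+1..n. K i (j - 1)) = (\<Sum>j=i+1..n'. K i j)"
      using sum.shift_bounds_cl_Suc_ivl[of "\<lambda>j. K i (j - 1)" "i + 1" n']
      unfolding n' by (simp only: Suc_eq_plus1 add_diff_cancel_right')
    also have "\<dots> = P i - K i n"
      using i by (simp add: P_def n')
    finally have "(\<Sum>j=i+1..n. ?N j) = 1 + (P (i + 1) + int (n - (i + 1)) - (P i - K i n))" .
    moreover have "K i n \<le> int n" using first_root(2)[OF i] by (simp add: K_def)
    ultimately show ?thesis using i by simp
  qed
  have "int (\<Sum>i<n. \<Sum>j=i+1..n. max_root i j + 1 - min_root i j)
      = (\<Sum>i<n. int (\<Sum>j=i+1..n. max_root i j + 1 - min_root i j))" by simp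
  also have "\<dots> \<le> (\<Sum>i<n. 2 * int n + (P (i + 1) - P i))" by (rule sum_mono) (use row in auto)
  also have "\<dots> = 2 * (int n)\<^sup>2 + (P n - P 0)"
    using sum_lessThan_telescope[of P n] by (simp add: sum.distrib power2_eq_square Suc_eq_plus1)
  also have "P n = 0" by (simp add: P_def)
  also have "0 \<le> P 0" by (auto simp: P_def K_def intro!: sum_nonneg)
  finally have "int (\<Sum>i<n. \<Sum>j=i+1..n. max_root i j + 1 - min_root i j) \<le> int (2 * n\<^sup>2)" by simp
  then show ?thesis by linarith
qed

lemma sum_root_ranges: "(\<Sum>i<n. \<Sum>j=i+1..n. max_root i j + 1 - min_root i j) \<le> n ^ 3"
proof -
  have "(\<Sum>j=i+1..n. max_root i j + 1 - min_root i j) \<le> (\<Sum>j=i+1..n. n)" for i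
  proof (rule sum_mono)
    fix j assume "j \<in> {i+1..n}"
    then show "max_root i j + 1 - min_root i j \<le> n" using root_bounds[of i j] by auto
  qed
  also have "\<dots> i \<le> n * n" for i by simp
  finally have "(\<Sum>i<n. \<Sum>j=i+1..n. max_root i j + 1 - min_root i j) \<le> (\<Sum>i<n. n * n)"
    by (rule sum_mono)
  then show ?thesis by (simp add: power3_eq_cube)
qed

definition total_time :: nat where
  "total_time = 25 + ((3 + (\<Sum>i<n. row_time i + 3)) + (13 + n * (21 * n + 39)))"

lemma total_time_le:
  "total_time \<le> 113 * n\<^sup>2 + 154 * (m + 1)\<^sup>2 * (\<Sum>i<n. \<Sum>j=i+1..n. max_root i j + 1 - min_root i j)"
proof -
  let ?S = "\<lambda>i. \<Sum>j=i+1..n. max_root i j + 1 - min_root i j" and ?A = "154 * (m + 1)\<^sup>2"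
  have "row_time i + 3 \<le> 9 + 3 * n + ?A * ?S i" for i
    by (simp add: row_time_def sum.distrib sum_distrib_left)
  then have "(\<Sum>i<n. row_time i + 3) \<le> (\<Sum>i<n. 9 + 3 * n + ?A * ?S i)" by (rule sum_mono)
  also have "\<dots> = n * (9 + 3 * n) + ?A * (\<Sum>i<n. ?S i)"
    by (simp add: sum.distrib sum_distrib_left)
  finally have "total_time \<le> 41 + n * (9 + 3 * n) + n * (21 * n + 39) + ?A * (\<Sum>i<n. ?S i)"
    by (simp add: total_time_def)
  \<comment> \<open>As \<open>n\<close> is positive, every term is at most its coefficient times
    \<open>n\<^sup>2\<close>: 41 + 48 + 24 = 113.\<close>
  moreover have "41 + n * (9 + 3 * n) + n * (21 * n + 39) \<le> 113 * n\<^sup>2"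
  proof -
    have "n * 1 \<le> n * n" using n_pos by (intro mult_le_mono2)
    moreover have "1 * 1 \<le> n * n" using n_pos by (intro mult_le_mono)
    moreover have "41 + n * (9 + 3 * n) + n * (21 * n + 39) = 41 + 48 * n + 24 * (n * n)"
      by (simp add: algebra_simps)
    ultimately show ?thesis unfolding power2_eq_square by linarith
  qed
  ultimately show ?thesis by linarith
qed

text \<open>For \<open>m >= 1\<close>, \<open>(m + 1)\<^sup>2\<close> is at most
  \<open>4 * m * n\<close>, and \<open>n\<close> at most \<open>2 * (n - m)\<close> because
  \<open>m\<close> is a minimum of two numbers with sum \<open>n\<close>; this yields the factor 113
  + 154 * 16 = 2577. For \<open>m = 0\<close> it is 113 + 308 = 421. Both lie below the round
  3000.\<close>

lemma total_time_bound:
  "total_time \<le> 3000 * (n * (n - m) + m * n\<^sup>2 * (n - m)\<^sup>2)"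
  "1 \<le> m \<Longrightarrow> total_time \<le> 3000 * (m * n\<^sup>2 * (n - m)\<^sup>2)"
proof -
  let ?S = "\<Sum>i<n. \<Sum>j=i+1..n. max_root i j + 1 - min_root i j"
  show two: "total_time \<le> 3000 * (m * n\<^sup>2 * (n - m)\<^sup>2)" if m: "1 \<le> m"
  proof -
    have h: "n \<le> 2 * (n - m)" "1 \<le> n - m" "m \<le> n" using n_pos by (auto simp: m_def n_def)
    have "(m + 1)\<^sup>2 \<le> (2 * m)\<^sup>2" using m by (intro power_mono) auto
    also have "\<dots> = 4 * (m * m)" by (simp add: power2_eq_square)
    also have "\<dots> \<le> 4 * (m * n)" using h by simp
    finally have "(m + 1)\<^sup>2 * ?S \<le> 4 * (m * n) * n ^ 3"
      using sum_root_ranges by (intro mult_le_mono)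
    also have "\<dots> = 4 * m * n\<^sup>2 * n\<^sup>2" by (simp add: power2_eq_square power3_eq_cube)
    also have "\<dots> \<le> 4 * m * n\<^sup>2 * (2 * (n - m))\<^sup>2" using h by (intro mult_le_mono2 power_mono) auto
    finally have 1: "(m + 1)\<^sup>2 * ?S \<le> 16 * (m * n\<^sup>2 * (n - m)\<^sup>2)" by (simp add: power_mult_distrib)
    have "1 * n\<^sup>2 * 1\<^sup>2 \<le> m * n\<^sup>2 * (n - m)\<^sup>2" using m h by (intro mult_le_mono power_mono) auto
    then have "n\<^sup>2 \<le> m * n\<^sup>2 * (n - m)\<^sup>2" by simp
    then show ?thesis using total_time_le 1 unfolding mult.assoc[of 154] by linarith
  qed
  show "total_time \<le> 3000 * (n * (n - m) + m * n\<^sup>2 * (n - m)\<^sup>2)"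
  proof (cases "m = 0")
    case True
    then have "154 * (m + 1)\<^sup>2 * ?S \<le> 154 * (2 * n\<^sup>2)" using sum_root_ranges_one_level by simp
    then have "total_time \<le> 421 * n\<^sup>2" using total_time_le by linarith
    then show ?thesis using True by (simp add: power2_eq_square)
  next
    case False
    then show ?thesis using two by (simp add: add_mult_distrib2)
  qed
qed

lemma input_memory_correct:
  defines "M \<equiv> input_memory m1 m2 c1 c2 p q"
  shows "inputs M" "filled M Id"
proof -
  define xs where "xs = [real m1, real m2, real c1, real c2]"
  define ps where "ps = map p [1..<n+1]"
  define qs where "qs = map q [0..<n+1]"
  have len: "length xs = 4" "length ps = n" "length qs = n + 1" by (simp_all add: xs_def ps_def qs_def)
  have M: "M a = (if a < length (xs @ ps @ qs) then (xs @ ps @ qs) ! a else 0)" for a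
    unfolding M_def input_memory_def Let_def xs_def ps_def qs_def n_def ..
  have "M (3 + t) = p t" if "t \<in> {1..n}" for t
  proof -
    have "t \<noteq> 0" using that by auto
    then obtain s where s: "t = Suc s" using not0_implies_Suc by blast
    have "M (3 + t) = ps ! s" using that len by (simp add: M nth_append s)
    also have "\<dots> = p t" using that s by (simp add: ps_def Suc_eq_plus1_left del: upt_Suc)
    finally show ?thesis .
  qed
  moreover have "M (4 + n + t) = q t" if "t \<le> n" for t
  proof -
    have "M (4 + n + t) = qs ! t" using that len by (simp add: M nth_append)
    also have "\<dots> = q t" using that by (simp add: qs_def nth_append)
    finally show ?thesis .
  qed
  ultimately show "inputs M" by (simp add: inputs_def)
  have "M (cell i i k) = 0" "M (cell i i k + 1) = 0" for i k
    using len by (simp_all add: M cell_def)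
  then show "filled M Id" by (auto simp: filled_def table_entry_def)
qed

lemma two_level_program:
  "ok two_level_program (\<lambda>_. 0, input_memory m1 m2 c1 c2 p q) total_time
    (\<lambda>(R', M'). R' 0 = real (5 + 2 * n) \<and>
      (\<exists>T \<phi>. stores_solution M' (5 + 2 * n) T \<phi> \<and> optimum_solution m1 m2 c1 c2 p q T \<phi>))"
    (is "ok _ (_, ?M) _ ?Q")
proof -
  have "ok (fill_table ;; write_solution) (R', M') ((3 + (\<Sum>i<n. row_time i + 3)) + (13 + n * (21 * n + 39))) ?Q"
    if P: "M' = ?M" "constants R'" "R' 11 = real base1" "R' 12 = real base0" for R' M'
  proof (rule ok_Seq[OF fill_table[OF P(2)]])
    show "inputs M'" "filled M' Id" using input_memory_correct P by auto
    fix R'' M'' assume 2: "case (R'', M'') of (R'', M'') \<Rightarrow> agree 15 R' R'' \<and> filled M'' UNIV"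
    \<comment> \<open>The memory left by the dynamic program becomes the fixed table
      \<open>M0\<close> from which tree and levels are defined.\<close>
    then interpret solved_table m1 m2 c1 c2 p q M'' by unfold_locales auto
    have "constants R''" "R'' 11 = real base1" "R'' 12 = real base0"
      using 2 P constants_agree[OF P(2), of 15 R''] by (auto simp: agree_def)
    from write_solution[OF this] optimum_root_tree
    show "ok write_solution (R'', M'') (13 + n * (21 * n + 39)) ?Q" by (auto elim!: ok_mono)
  qed simp
  then show ?thesis unfolding two_level_program_def total_time_def
    by (intro ok_Seq[OF initialize]) auto
qed

end

theorem mainTheorem4:
  "\<exists>(P :: program) (C :: nat).
     \<forall>(m1 :: nat) (m2 :: nat) (c1 :: nat) (c2 :: nat) (p :: nat \<Rightarrow> real) (q :: nat \<Rightarrow> real).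
       valid_instance m1 m2 c1 c2 p q \<longrightarrow>
       (let n = m1 + m2; m = min m1 m2 in
         \<exists>(t :: nat) T \<phi>.
           constructs_in P (input_memory m1 m2 c1 c2 p q) t T \<phi> \<and>
           optimum_solution m1 m2 c1 c2 p q T \<phi> \<and>
           t \<le> C * (n * (n - m) + m * n\<^sup>2 * (n - m)\<^sup>2) \<and>
           (1 \<le> m \<longrightarrow> t \<le> C * (m * n\<^sup>2 * (n - m)\<^sup>2)))"
proof (intro exI[of _ "compile 0 two_level_program"] exI[of _ 3000] allI impI)
  fix m1 m2 c1 c2 :: nat and p q :: "nat \<Rightarrow> real"
  assume "valid_instance m1 m2 c1 c2 p q"
  then interpret two_level m1 m2 c1 c2 p q by unfold_locales
  obtain t R M T \<phi> where t: "halts_in (compile 0 two_level_program) (input_memory m1 m2 c1 c2 p q) t R M"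
    "t \<le> total_time" and R: "R 0 = real (5 + 2 * n)" "stores_solution M (5 + 2 * n) T \<phi>"
    and opt: "optimum_solution m1 m2 c1 c2 p q T \<phi>"
    using ok_halts[OF two_level_program] by auto
  have "constructs_in (compile 0 two_level_program) (input_memory m1 m2 c1 c2 p q) t T \<phi>"
    unfolding constructs_in_def using t(1) R by blast
  with opt t(2) total_time_bound
  show "let n = m1 + m2; m = min m1 m2 in
         \<exists>(t :: nat) T \<phi>.
           constructs_in (compile 0 two_level_program) (input_memory m1 m2 c1 c2 p q) t T \<phi> \<and>
           optimum_solution m1 m2 c1 c2 p q T \<phi> \<and>
           t \<le> 3000 * (n * (n - m) + m * n\<^sup>2 * (n - m)\<^sup>2) \<and>
           (1 \<le> m \<longrightarrow> t \<le> 3000 * (m * n\<^sup>2 * (n - m)\<^sup>2))"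
    unfolding Let_def n_def m_def by (meson order_trans)
qed

end
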